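(* Let $B$ be a ball in $\mathbb{R}^n$ and let $K\subset\mathbb{R}^n$ be compact with $\sigma$-finite $(m-2)$-dimensional Hausdorff measure. Let $T$ be a minimal supercurrent of bidimension $(m,m)$ defined in $B\setminus K$. Assume that $T$ has finite mass, $$\int_{B\setminus K}T\wedge\beta^m<\infty.$$ Then the trivial extension of $T$, $\tilde T:=\chi_{B\setminus K}T$, is a minimal supercurrent in $B$.
   Context: Superforms: let $x=(x_1,\dots,x_n)$ be orthonormal coordinates on $\mathbb{R}^n$ and $\xi=(\xi_1,\dots,\xi_n)$ coordinates on a second copy of $\mathbb{R}^n$. A superform is a differential form $a=\sum a_{I,J}(x)\,dx_I\wedge d\xi_J$ on $\mathbb{R}^n_s=\mathbb{R}^n\oplus\mathbb{R}^n$ whose coefficients do not depend on $\xi$; it has bidegree $(p,q)$ if $|I|=p$, $|J|=q$. $J$ is the multiplicative operator on forms with $J(dx_i)=d\xi_i$, $J(d\xi_i)=-dx_i$; for $a$ of bidegree $(p,0)$ write $a^{\#}=J(a)$. Put $da=\sum \frac{\partial a_{I,J}}{\partial x_k}dx_k\wedge dx_I\wedge d\xi_J$. The superintegral of an $(n,n)$-form is $\int_{\mathbb{R}^n_s}a_0\,dx_1\wedge d\xi_1\wedge\dots\wedge dx_n\wedge d\xi_n=\int_{\mathbb{R}^n}a_0\,d\lambda$ ($\lambda$ Lebesgue measure). Supercurrents of bidegree $(p,q)$ (bidimension $(n-p,n-q)$) on an open set are the continuous linear functionals on smooth superforms of bidegree $(n-p,n-q)$ with compact support in $x$; equivalently superforms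 with distribution coefficients, acting by $T.\alpha=\int T\wedge\alpha$. In this setting the coefficients are at worst measures. A supercurrent of bidegree $(n,n)$ and order zero is identified with a measure on $\mathbb{R}^n$. The operator $d$ extends to supercurrents coefficientwise. $\beta=\sum_j dx_j\wedge d\xi_j$. A supercurrent $T$ of bidimension $(m,m)$ is (weakly) positive if $T.\alpha_1\wedge\alpha_1^{\#}\wedge\dots\wedge\alpha_m\wedge\alpha_m^{\#}\ge0$ for all compactly supported smooth $(1,0)$-forms $\alpha_j$; it is symmetric if $J(T)=T$. A positive symmetric supercurrent $T$ of bidimension $(m,m)$ is called minimal if $dT\wedge\beta^{m-1}=0$. Here $m\ge2$. The trivial extension $\chi_{B\setminus K}T$ is obtained by extending the coefficient measures of $T$ by zero across $K$.
   Formalization: That the coefficient measures of T, extended by zero across K, are locally finite in B (so the trivial extension exists) is assumed; with weak positivity, finite mass does not imply it, e.g. for n=4, m=2, K={0}, T=|x|^{-10} Σ ±dx_I∧dξ_{I^c}, which is minimal with mass 0. *)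

theory Defs
  imports "HOL-Analysis.Analysis"
begin

section \<open>Test functions and distributions\<close>

definition partial_deriv :: "'n::finite \<Rightarrow> (real ^ 'n \<Rightarrow> real) \<Rightarrow> real ^ 'n \<Rightarrow> real" where
  "partial_deriv k f = (\<lambda>x. frechet_derivative f (at x) (axis k 1))"

(* All iterated partial derivatives exist and are differentiable (hence continuous). *)
definition smooth :: "(real ^ 'n::finite \<Rightarrow> real) \<Rightarrow> bool" where
  "smooth f \<longleftrightarrow> (\<forall>ks. fold partial_deriv ks f differentiable_on UNIV)"

definition supp :: "(real ^ 'n::finite \<Rightarrow> real) \<Rightarrow> (real ^ 'n) set" where
  "supp f = closure {x. f x \<noteq> 0}"

definition test_functions :: "(real ^ 'n::finite) set \<Rightarrow> (real ^ 'n \<Rightarrow> real) set" where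
  "test_functions U = {f. smooth f \<and> compact (supp f) \<and> supp f \<subseteq> U}"

(* Convergence to 0 in D(U): supports in a common compact subset of U, and uniform
   convergence of all derivatives. *)
definition test_null_sequence ::
  "(real ^ 'n::finite) set \<Rightarrow> (nat \<Rightarrow> real ^ 'n \<Rightarrow> real) \<Rightarrow> bool" where
  "test_null_sequence U f \<longleftrightarrow>
     (\<forall>j. f j \<in> test_functions U) \<and>
     (\<exists>C. compact C \<and> C \<subseteq> U \<and> (\<forall>j. supp (f j) \<subseteq> C)) \<and>
     (\<forall>ks. uniform_limit UNIV (\<lambda>j. fold partial_deriv ks (f j)) (\<lambda>_. 0) sequentially)"

(* A distribution on U is represented by a total function on real functions of which only the
   values on test_functions U are relevant. *)
definition distribution ::
  "(real ^ 'n::finite) set \<Rightarrow> ((real ^ 'n \<Rightarrow> real) \<Rightarrow> real) \<Rightarrow> bool" where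
  "distribution U S \<longleftrightarrow>
     (\<forall>f \<in> test_functions U. \<forall>g \<in> test_functions U. S (\<lambda>x. f x + g x) = S f + S g) \<and>
     (\<forall>c. \<forall>f \<in> test_functions U. S (\<lambda>x. c * f x) = c * S f) \<and>
     (\<forall>f. test_null_sequence U f \<longrightarrow> (\<lambda>j. S (f j)) \<longlonglongrightarrow> 0)"

definition distr_deriv ::
  "'n::finite \<Rightarrow> ((real ^ 'n \<Rightarrow> real) \<Rightarrow> real) \<Rightarrow> (real ^ 'n \<Rightarrow> real) \<Rightarrow> real" where
  "distr_deriv k S = (\<lambda>f. - S (partial_deriv k f))"

section \<open>Superforms\<close>

(* A superform a is given by its coefficients: a I J is the coefficient function of
   dx_I \<and> d\<xi>_J, where dx_I and d\<xi>_J are the wedge products in increasing order of the indices. *)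
type_synonym 'n superform = "'n set \<Rightarrow> 'n set \<Rightarrow> real ^ 'n \<Rightarrow> real"

(* dx_I \<and> dx_J = shuffle_sign I J * dx_(I \<union> J) for disjoint I, J. *)
definition shuffle_sign :: "'n::{finite,linorder} set \<Rightarrow> 'n set \<Rightarrow> real" where
  "shuffle_sign I J = (- 1) ^ card {(i, j). i \<in> I \<and> j \<in> J \<and> j < i}"

(* (dx_I \<and> d\<xi>_J) \<and> (dx_K \<and> d\<xi>_L) = super_sign I J K L * dx_(I \<union> K) \<and> d\<xi>_(J \<union> L); the first factor
   comes from moving dx_K past d\<xi>_J. *)
definition super_sign ::
  "'n::{finite,linorder} set \<Rightarrow> 'n set \<Rightarrow> 'n set \<Rightarrow> 'n set \<Rightarrow> real" where
  "super_sign I J K L = (- 1) ^ (card J * card K) * shuffle_sign I K * shuffle_sign J L"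

definition wedge ::
  "'n::{finite,linorder} superform \<Rightarrow> 'n superform \<Rightarrow> 'n superform" where
  "wedge a b = (\<lambda>I J x. \<Sum>I'\<in>Pow I. \<Sum>J'\<in>Pow J.
     super_sign I' J' (I - I') (J - J') * (a I' J' x * b (I - I') (J - J') x))"

definition one_form :: "'n::{finite,linorder} superform" where
  "one_form = (\<lambda>I J x. if I = {} \<and> J = {} then 1 else 0)"

definition dx :: "'n::{finite,linorder} \<Rightarrow> 'n superform" where
  "dx j = (\<lambda>I J x. if I = {j} \<and> J = {} then 1 else 0)"

definition dxi :: "'n::{finite,linorder} \<Rightarrow> 'n superform" where
  "dxi j = (\<lambda>I J x. if I = {} \<and> J = {j} then 1 else 0)"

definition beta :: "'n::{finite,linorder} superform" where
  "beta = (\<lambda>I J x. \<Sum>j\<in>UNIV. wedge (dx j) (dxi j) I J x)"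

definition wedge_list :: "'n::{finite,linorder} superform list \<Rightarrow> 'n superform" where
  "wedge_list as = foldr wedge as one_form"

definition beta_pow :: "nat \<Rightarrow> 'n::{finite,linorder} superform" where
  "beta_pow k = wedge_list (replicate k beta)"

(* The multiplicative operator with J dx_i = d\<xi>_i and J d\<xi>_i = - dx_i maps dx_P \<and> d\<xi>_Q to
   (-1)^|Q| d\<xi>_P \<and> dx_Q = (-1)^(|Q| + |P||Q|) dx_Q \<and> d\<xi>_P.  The type 'x is real ^ 'n
   for superforms and real ^ 'n \<Rightarrow> real for supercurrents. *)
definition J_op ::
  "('n::{finite,linorder} set \<Rightarrow> 'n set \<Rightarrow> 'x \<Rightarrow> real) \<Rightarrow> 'n set \<Rightarrow> 'n set \<Rightarrow> 'x \<Rightarrow> real" where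
  "J_op a = (\<lambda>I J x. (- 1) ^ (card I + card J * card I) * a J I x)"

definition test_form ::
  "(real ^ 'n::{finite,linorder}) set \<Rightarrow> nat \<Rightarrow> nat \<Rightarrow> 'n::{finite,linorder} superform \<Rightarrow> bool" where
  "test_form U p q a \<longleftrightarrow>
     (\<forall>I J. a I J \<in> test_functions U) \<and>
     (\<forall>I J. \<not> (card I = p \<and> card J = q) \<longrightarrow> a I J = (\<lambda>x. 0))"

section \<open>Supercurrents\<close>

(* Superforms with distribution coefficients. *)
type_synonym 'n supercurrent = "'n set \<Rightarrow> 'n set \<Rightarrow> (real ^ 'n \<Rightarrow> real) \<Rightarrow> real"

(* Bidimension (p, q) means bidegree (n - p, n - q). *)
definition supercurrent ::
  "(real ^ 'n::{finite,linorder}) set \<Rightarrow> nat \<Rightarrow> nat \<Rightarrow> 'n::{finite,linorder} supercurrent \<Rightarrow> bool" where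
  "supercurrent U p q T \<longleftrightarrow>
     (\<forall>I J. distribution U (T I J)) \<and>
     (\<forall>I J. \<not> (card I + p = CARD('n) \<and> card J + q = CARD('n)) \<longrightarrow>
        (\<forall>f \<in> test_functions U. T I J f = 0))"

(* T \<and> a for a smooth superform a; the product of a distribution S and a smooth function g is
   f \<mapsto> S (g f). *)
definition current_wedge ::
  "'n::{finite,linorder} supercurrent \<Rightarrow> 'n superform \<Rightarrow> 'n supercurrent" where
  "current_wedge T a = (\<lambda>I J f. \<Sum>I'\<in>Pow I. \<Sum>J'\<in>Pow J.
     super_sign I' J' (I - I') (J - J') * T I' J' (\<lambda>x. a (I - I') (J - J') x * f x))"

(* Coefficientwise dT = \<Sum> \<partial>T_(I,J)/\<partial>x_k dx_k \<and> dx_I \<and> d\<xi>_J. *)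
definition current_d :: "'n::{finite,linorder} supercurrent \<Rightarrow> 'n supercurrent" where
  "current_d T = (\<lambda>I J f. \<Sum>k\<in>I. shuffle_sign {k} (I - {k}) * distr_deriv k (T (I - {k}) J) f)"

(* The distribution S_0 with S = S_0 dx_1 \<and> d\<xi>_1 \<and> ... \<and> dx_n \<and> d\<xi>_n, for S of bidegree (n, n):
   dx_1 \<and> d\<xi>_1 \<and> ... \<and> dx_n \<and> d\<xi>_n = (-1)^(n(n-1)/2) dx_1 \<and> ... \<and> dx_n \<and> d\<xi>_1 \<and> ... \<and> d\<xi>_n. *)
definition top_coeff ::
  "'n::{finite,linorder} supercurrent \<Rightarrow> (real ^ 'n::{finite,linorder} \<Rightarrow> real) \<Rightarrow> real" where
  "top_coeff S = (\<lambda>f. (- 1) ^ (CARD('n) * (CARD('n) - 1) div 2) * S UNIV UNIV f)"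

(* T.a, the superintegral of T \<and> a, for a of compact support. *)
definition current_apply :: "'n::{finite,linorder} supercurrent \<Rightarrow> 'n superform \<Rightarrow> real" where
  "current_apply T a = top_coeff (current_wedge T a) (\<lambda>x. 1)"

definition positive_current ::
  "(real ^ 'n::{finite,linorder}) set \<Rightarrow> nat \<Rightarrow> 'n::{finite,linorder} supercurrent \<Rightarrow> bool" where
  "positive_current U m T \<longleftrightarrow>
     (\<forall>as. length as = m \<and> (\<forall>a \<in> set as. test_form U 1 0 a) \<longrightarrow>
        0 \<le> current_apply T (wedge_list (map (\<lambda>a. wedge a (J_op a)) as)))"

definition symmetric_current ::
  "(real ^ 'n::{finite,linorder}) set \<Rightarrow> 'n::{finite,linorder} supercurrent \<Rightarrow> bool" where
  "symmetric_current U T \<longleftrightarrow> (\<forall>I J. \<forall>f \<in> test_functions U. J_op T I J f = T I J f)"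

definition minimal_current ::
  "(real ^ 'n::{finite,linorder}) set \<Rightarrow> nat \<Rightarrow> 'n::{finite,linorder} supercurrent \<Rightarrow> bool" where
  "minimal_current U m T \<longleftrightarrow>
     supercurrent U m m T \<and> positive_current U m T \<and> symmetric_current U T \<and>
     (\<forall>I J. \<forall>f \<in> test_functions U. current_wedge (current_d T) (beta_pow (m - 1)) I J f = 0)"

section \<open>Coefficient measures, mass and trivial extension\<close>

definition radon_on :: "(real ^ 'n::finite) set \<Rightarrow> (real ^ 'n) measure \<Rightarrow> bool" where
  "radon_on U \<mu> \<longleftrightarrow>
     sets \<mu> = sets borel \<and> (\<forall>C. compact C \<and> C \<subseteq> U \<longrightarrow> emeasure \<mu> C < \<infinity>)"

definition is_measure_on ::
  "(real ^ 'n::finite) set \<Rightarrow> ((real ^ 'n \<Rightarrow> real) \<Rightarrow> real) \<Rightarrow> (real ^ 'n) measure \<Rightarrow> bool" where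
  "is_measure_on U S \<mu> \<longleftrightarrow>
     radon_on U \<mu> \<and> (\<forall>f \<in> test_functions U. S f = integral\<^sup>L \<mu> f)"

(* The distribution S is the signed measure \<mu> - \<nu> on U. *)
definition is_signed_measure_on ::
  "(real ^ 'n::finite) set \<Rightarrow> ((real ^ 'n \<Rightarrow> real) \<Rightarrow> real) \<Rightarrow>
   (real ^ 'n) measure \<Rightarrow> (real ^ 'n) measure \<Rightarrow> bool" where
  "is_signed_measure_on U S \<mu> \<nu> \<longleftrightarrow>
     radon_on U \<mu> \<and> radon_on U \<nu> \<and>
     (\<forall>f \<in> test_functions U. S f = integral\<^sup>L \<mu> f - integral\<^sup>L \<nu> f)"

(* The measure identified with T \<and> \<beta>^m has finite total mass on U. *)
definition finite_mass ::
  "(real ^ 'n::{finite,linorder}) set \<Rightarrow> nat \<Rightarrow> 'n::{finite,linorder} supercurrent \<Rightarrow> bool" where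
  "finite_mass U m T \<longleftrightarrow>
     (\<exists>\<mu>. is_measure_on U (top_coeff (current_wedge T (beta_pow m))) \<mu> \<and> emeasure \<mu> U < \<infinity>)"

(* T' on V is the trivial extension of T on U \<subseteq> V: the coefficients of T are signed measures
   \<mu> - \<nu> on U, and the coefficients of T' are these measures, extended by zero to V - U.
   This presupposes that the extended measures are locally finite in V; on test_functions V
   the coefficients of T' are then determined by T. *)
definition trivial_extension ::
  "(real ^ 'n::{finite,linorder}) set \<Rightarrow> (real ^ 'n::{finite,linorder}) set \<Rightarrow>
   'n::{finite,linorder} supercurrent \<Rightarrow> 'n supercurrent \<Rightarrow> bool" where
  "trivial_extension U V T T' \<longleftrightarrow>
     (\<forall>I J. \<exists>\<mu> \<nu>.
        is_signed_measure_on U (T I J) \<mu> \<nu> \<and>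
        is_signed_measure_on V (T' I J) \<mu> \<nu> \<and>
        emeasure \<mu> (V - U) = 0 \<and> emeasure \<nu> (V - U) = 0)"

section \<open>Hausdorff measure\<close>

(* The exponent is a natural number, and 0 ^ 0 = 1, so that nonempty sets of diameter 0 have
   size 1 in dimension 0 and the 0-dimensional measure is counting measure. *)
definition hausdorff_size :: "nat \<Rightarrow> 'a::metric_space set \<Rightarrow> ennreal" where
  "hausdorff_size s C = (if C = {} then 0 else ennreal (diameter C ^ s))"

definition hausdorff_content :: "nat \<Rightarrow> real \<Rightarrow> 'a::metric_space set \<Rightarrow> ennreal" where
  "hausdorff_content s \<delta> A =
     (INF C \<in> {C :: nat \<Rightarrow> 'a set. A \<subseteq> (\<Union>i. C i) \<and> (\<forall>i. bounded (C i) \<and> diameter (C i) \<le> \<delta>)}.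
        \<Sum>i. hausdorff_size s (C i))"

(* Without the dimensional normalising constant, which is irrelevant for sigma-finiteness. *)
definition hausdorff_measure :: "nat \<Rightarrow> 'a::metric_space set \<Rightarrow> ennreal" where
  "hausdorff_measure s A = (SUP \<delta> \<in> {0<..}. hausdorff_content s \<delta> A)"

definition sigma_finite_hausdorff :: "nat \<Rightarrow> 'a::metric_space set \<Rightarrow> bool" where
  "sigma_finite_hausdorff s K \<longleftrightarrow>
     (\<exists>A :: nat \<Rightarrow> 'a set. (\<forall>i. A i \<in> sets borel \<and> hausdorff_measure s (A i) < \<infinity>) \<and> K = (\<Union>i. A i))"

end

theory Submission
  imports Defs "HOL-Computational_Algebra.Polynomial"
begin

text \<open>The coefficients of \<open>S = T \<and> \<beta>^(m - 1)\<close> form a symmetric positive semidefinite matrix of measures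
  that is divergence free off \<open>K\<close>, and minimality across \<open>K\<close> means that it is divergence free there
  as well. Expanding the power of the form \<open>|a|\<^sup>2 \<beta> - a \<and> a\<^sup>#\<close>, a sum of squares by Lagrange's identity, shows
  that the eigenvalues of \<open>S\<close> are at most \<open>1 / m\<close> times its trace, so the kernel \<open>|x|^(2 - m)\<close> (the logarithm if
  \<open>m = 2\<close>) is superharmonic with respect to \<open>S\<close>. A set of \<open>\<sigma>\<close>-finite \<open>(m - 2)\<close>-dimensional Hausdorff measure
  has capacity zero: there are such potentials \<open>u\<close> with \<open>u > 1\<close> on \<open>K\<close> that tend to \<open>0\<close> off \<open>K\<close>. The cutoffs
  \<open>w = G(u)\<close>, \<open>G\<close> convex and decreasing with \<open>G = 0\<close> on \<open>[1, \<infinity>)\<close>, are subharmonic and have bounded energy by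
  Caccioppoli's inequality. Testing with \<open>(2 w - w\<^sup>2) f\<close>, whose gradient carries the factor \<open>1 - w\<close>, and the
  Cauchy--Schwarz inequality give the divergence equation across \<open>K\<close> in the limit.\<close>

section \<open>Smooth functions\<close>

text \<open>The hypothesis on \<open>K\<close> is borderline. A set of finite positive (m -
  2)-dimensional measure has covers whose potential is at least 1 on it, but their mass is
  comparable to the measure and does not become small. Smallness comes from many scales at once:
  each scale contributes about equally to the potential of one fine cover, which is therefore of the
  order of the number \<open>N\<close> of scales. The energies of the cutoffs \<open>w\<close> are
  only shown to be bounded, and testing with \<open>w f\<close> would leave an error that need not
  vanish. With \<open>2 w - w^2\<close> the gradient of \<open>w\<close> is paired with
  \<open>(1 - w) f\<close>, whose square tends to 0 in the mean because the extended coefficients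
  carry no mass on \<open>K\<close>. The exponent \<open>2 - m\<close> is the one for which the
  Hessian of the kernel is a negative multiple of \<open>|x|^2 \<delta>_kl - m x_k x_l\<close>, the
  matrix governed by the eigenvalue bound. Replacing \<open>|x|^2\<close> by
  \<open>|x|^2 + \<eta>\<close> makes the potentials smooth across \<open>K\<close> and only adds a
  positive multiple of \<open>\<beta>\<close> to the form in Lagrange's identity.\<close>

lemma partial_deriv_eq:
  assumes "(f has_derivative f') (at x)"
  shows "partial_deriv k f x = f' (axis k 1)"
  unfolding partial_deriv_def using frechet_derivative_at[OF assms] by simp

lemma smooth_differentiable: "smooth f \<Longrightarrow> f differentiable (at x)"
  unfolding smooth_def by (drule spec[of _ "[]"]) (simp add: differentiable_on_def)

lemma smooth_partial_deriv: "smooth f \<Longrightarrow> smooth (partial_deriv k f)"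
  unfolding smooth_def
proof safe
  fix ks assume "\<forall>ks. fold partial_deriv ks f differentiable_on UNIV"
  then show "fold partial_deriv ks (partial_deriv k f) differentiable_on UNIV"
    by (drule_tac spec[of _ "k # ks"]) simp
qed

lemma smooth_continuous_on: "smooth f \<Longrightarrow> continuous_on X f"
  by (meson continuous_on_eq_continuous_at differentiable_imp_continuous_within
      smooth_differentiable continuous_at_imp_continuous_on)

lemma partial_deriv_const: "partial_deriv k (\<lambda>x. c) = (\<lambda>x. 0)"
  by (rule ext, subst partial_deriv_eq) (auto intro!: derivative_eq_intros)

lemma partial_deriv_add:
  assumes "f differentiable (at x)" "g differentiable (at x)"
  shows "partial_deriv k (\<lambda>x. f x + g x) x = partial_deriv k f x + partial_deriv k g x"
proof -
  obtain f' g' where d: "(f has_derivative f') (at x)" "(g has_derivative g') (at x)"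
    using assms unfolding differentiable_def by blast
  show ?thesis
    using partial_deriv_eq[OF has_derivative_add[OF d], of k] partial_deriv_eq[OF d(1), of k]
      partial_deriv_eq[OF d(2), of k] by simp
qed

lemma partial_deriv_mult:
  assumes "f differentiable (at x)" "g differentiable (at x)"
  shows "partial_deriv k (\<lambda>x. f x * g x) x
    = partial_deriv k f x * g x + f x * partial_deriv k g x"
proof -
  obtain f' g' where d: "(f has_derivative f') (at x)" "(g has_derivative g') (at x)"
    using assms unfolding differentiable_def by blast
  show ?thesis
    using partial_deriv_eq[OF has_derivative_mult[OF d], of k] partial_deriv_eq[OF d(1), of k]
      partial_deriv_eq[OF d(2), of k] by simp
qed

lemma partial_deriv_compose:
  assumes "(F has_real_derivative D) (at (h x))" "h differentiable (at x)"
  shows "partial_deriv k (\<lambda>x. F (h x)) x = D * partial_deriv k h x"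
    and "(\<lambda>x. F (h x)) differentiable (at x)"
proof -
  obtain h' where d: "(h has_derivative h') (at x)"
    using assms(2) unfolding differentiable_def by blast
  have F: "((\<lambda>x. F (h x)) has_derivative (\<lambda>v. D * h' v)) (at x)"
    using has_derivative_compose[OF d assms(1)[unfolded has_field_derivative_def]] by simp
  then show "partial_deriv k (\<lambda>x. F (h x)) x = D * partial_deriv k h x"
    "(\<lambda>x. F (h x)) differentiable (at x)"
    using partial_deriv_eq[OF d, of k] partial_deriv_eq[OF F, of k] differentiableI[OF F] by simp_all
qed

text \<open>Carries a function together with all its derivatives, so that differentiating a
  composition \<open>F i (h x)\<close> stays in the family: the new factor is
  \<open>F (Suc i) (h x)\<close>.\<close>

definition derivative_chain :: "real set \<Rightarrow> (nat \<Rightarrow> real \<Rightarrow> real) \<Rightarrow> bool" where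
  "derivative_chain X F \<longleftrightarrow> (\<forall>i. \<forall>x\<in>X. (F i has_real_derivative F (Suc i) x) (at x))"

text \<open>Smoothness is coinductive: it suffices to exhibit a family of differentiable functions that
  is closed under partial derivatives.\<close>

inductive smooth_closure :: "(real ^ 'n::finite \<Rightarrow> real) \<Rightarrow> bool" where
  base: "smooth f \<Longrightarrow> smooth_closure f"
| compose: "derivative_chain X F \<Longrightarrow> smooth h \<Longrightarrow> range h \<subseteq> X \<Longrightarrow> smooth_closure (\<lambda>x. F i (h x))"
| add: "smooth_closure f \<Longrightarrow> smooth_closure g \<Longrightarrow> smooth_closure (\<lambda>x. f x + g x)"
| mult: "smooth_closure f \<Longrightarrow> smooth_closure g \<Longrightarrow> smooth_closure (\<lambda>x. f x * g x)"

lemma smooth_closure_deriv: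
  "smooth_closure f \<Longrightarrow> (\<forall>x. f differentiable (at x)) \<and> (\<forall>k. smooth_closure (partial_deriv k f))"
proof (induction rule: smooth_closure.induct)
  case (base f)
  then show ?case
    by (simp add: smooth_differentiable smooth_partial_deriv smooth_closure.base)
next
  case (compose X F h i)
  have d: "(F i has_real_derivative F (Suc i) (h x)) (at (h x))" for x
    using compose(1,3) unfolding derivative_chain_def by (auto simp: subset_eq)
  have "partial_deriv k (\<lambda>x. F i (h x)) = (\<lambda>x. F (Suc i) (h x) * partial_deriv k h x)" for k
    by (rule ext, rule partial_deriv_compose[OF d smooth_differentiable[OF compose(2)]])
  then show ?case
    using partial_deriv_compose(2)[OF d smooth_differentiable[OF compose(2)]] compose
    by (simp add: smooth_closure.mult smooth_closure.compose[OF compose] smooth_closure.base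
        smooth_partial_deriv)
next
  case (add f g)
  then have "partial_deriv k (\<lambda>x. f x + g x) = (\<lambda>x. partial_deriv k f x + partial_deriv k g x)" for k
    by (intro ext partial_deriv_add) auto
  with add show ?case by (auto intro!: smooth_closure.add)
next
  case (mult f g)
  then have "partial_deriv k (\<lambda>x. f x * g x)
      = (\<lambda>x. partial_deriv k f x * g x + f x * partial_deriv k g x)" for k
    by (intro ext partial_deriv_mult) auto
  with mult show ?case by (auto intro!: smooth_closure.add smooth_closure.mult)
qed

lemma smooth_closure_smooth: "smooth_closure f \<Longrightarrow> smooth f"
proof -
  have "smooth_closure f \<Longrightarrow> fold partial_deriv ks f differentiable_on UNIV" for ks
    by (induction ks arbitrary: f) (use smooth_closure_deriv in \<open>auto simp: differentiable_on_def\<close>)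
  then show "smooth_closure f \<Longrightarrow> smooth f"
    unfolding smooth_def by blast
qed

lemma smooth_add: "smooth f \<Longrightarrow> smooth g \<Longrightarrow> smooth (\<lambda>x. f x + g x)"
  by (rule smooth_closure_smooth) (simp add: smooth_closure.add smooth_closure.base)

lemma smooth_mult: "smooth f \<Longrightarrow> smooth g \<Longrightarrow> smooth (\<lambda>x. f x * g x)"
  by (rule smooth_closure_smooth) (simp add: smooth_closure.mult smooth_closure.base)

lemma smooth_compose:
  "derivative_chain X F \<Longrightarrow> smooth h \<Longrightarrow> (\<And>x. h x \<in> X) \<Longrightarrow> smooth (\<lambda>x. F i (h x))"
  by (rule smooth_closure_smooth, rule smooth_closure.compose[of X F h i]) auto

lemma smooth_const: "smooth (\<lambda>x. c)"
proof -
  have "fold partial_deriv ks (\<lambda>x. c) differentiable_on UNIV" for ks and c :: real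
    by (induction ks arbitrary: c) (simp_all add: partial_deriv_const)
  then show ?thesis unfolding smooth_def by blast
qed

lemma partial_deriv_coord: "partial_deriv k (\<lambda>x. x $ i) = (\<lambda>x. if i = k then 1 else 0)"
  by (rule ext, subst partial_deriv_eq[OF bounded_linear.has_derivative[OF bounded_linear_vec_nth has_derivative_ident]])
    (auto simp: axis_def)

lemma smooth_coord:
  fixes i :: "'n::finite"
  shows "smooth (\<lambda>x. x $ i)"
proof -
  have *: "(\<lambda>x::real^'n. x $ i) differentiable_on UNIV"
    using bounded_linear_imp_differentiable_on bounded_linear_vec_nth by blast
  have "fold partial_deriv ks (\<lambda>x::real^'n. x $ i) differentiable_on UNIV" for ks
  proof (cases ks)
    case (Cons k ks')
    have "smooth (\<lambda>x::real^'n. if i = k then 1 else (0::real))"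
      using smooth_const[of "if i = k then 1 else 0"] .
    then show ?thesis unfolding Cons fold_Cons o_apply partial_deriv_coord smooth_def by blast
  qed (use * in simp)
  then show ?thesis unfolding smooth_def by blast
qed

lemma smooth_minus: "smooth f \<Longrightarrow> smooth (\<lambda>x. - f x)"
  using smooth_mult[OF smooth_const[of "-1"]] by simp

lemma smooth_diff: "smooth f \<Longrightarrow> smooth g \<Longrightarrow> smooth (\<lambda>x. f x - g x)"
  using smooth_add[of f, OF _ smooth_minus[of g]] by simp

lemma smooth_sum: "(\<And>i. i \<in> I \<Longrightarrow> smooth (f i)) \<Longrightarrow> smooth (\<lambda>x. \<Sum>i\<in>I. f i x)"
  by (induction I rule: infinite_finite_induct) (auto intro!: smooth_const smooth_add)

lemma smooth_power: "smooth f \<Longrightarrow> smooth (\<lambda>x. f x ^ i)"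
  by (induction i) (auto intro!: smooth_const smooth_mult)

lemma partial_deriv_diff:
  assumes "f differentiable (at x)" "g differentiable (at x)"
  shows "partial_deriv k (\<lambda>x. f x - g x) x = partial_deriv k f x - partial_deriv k g x"
  using partial_deriv_add[of f x "\<lambda>x. - 1 * g x" k] partial_deriv_mult[of "\<lambda>x. - 1" x g k] assms
  by (simp add: partial_deriv_const)

lemma partial_deriv_sum:
  assumes "\<And>i. i \<in> I \<Longrightarrow> smooth (f i)"
  shows "partial_deriv k (\<lambda>x. \<Sum>i\<in>I. f i x) = (\<lambda>x. \<Sum>i\<in>I. partial_deriv k (f i) x)"
  using assms
proof (induction I rule: infinite_finite_induct)
  case (insert i I)
  have "partial_deriv k (\<lambda>x. \<Sum>i\<in>insert i I. f i x) = partial_deriv k (\<lambda>x. f i x + (\<Sum>i\<in>I. f i x))"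
    using insert by simp
  also have "\<dots> = (\<lambda>x. partial_deriv k (f i) x + partial_deriv k (\<lambda>x. \<Sum>i\<in>I. f i x) x)"
    by (intro ext partial_deriv_add smooth_differentiable smooth_sum) (use insert in auto)
  finally show ?case using insert by simp
qed (simp_all add: partial_deriv_const)

lemma partial_deriv_cmult:
  "f differentiable (at x) \<Longrightarrow> partial_deriv k (\<lambda>x. c * f x) x = c * partial_deriv k f x"
  using partial_deriv_mult[of "\<lambda>x. c" x f k] by (simp add: partial_deriv_const)

section \<open>Supports and test functions\<close>

lemma supp_zero: "x \<notin> supp f \<Longrightarrow> f x = 0"
  unfolding supp_def using closure_subset[of "{x. f x \<noteq> 0}"] by auto

lemma supp_subset: "(\<And>x. f x \<noteq> 0 \<Longrightarrow> g x \<noteq> 0) \<Longrightarrow> supp f \<subseteq> supp g"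
  unfolding supp_def by (intro closure_mono) auto

lemma supp_subset_closed: "closed C \<Longrightarrow> (\<And>x. x \<notin> C \<Longrightarrow> f x = 0) \<Longrightarrow> supp f \<subseteq> C"
  unfolding supp_def by (intro closure_minimal) auto

lemma closed_supp: "closed (supp f)"
  unfolding supp_def by simp

lemma supp_partial_deriv: "supp (partial_deriv k f) \<subseteq> supp f"
proof (rule supp_subset_closed[OF closed_supp])
  fix x assume "x \<notin> supp f"
  then have x: "x \<in> - supp f" "open (- supp f)" using closed_supp[of f] by auto
  have "(f has_derivative (\<lambda>v. 0)) (at x)"
    by (rule has_derivative_transform_within_open[OF has_derivative_const[of 0] x(2) x(1)])
      (simp add: supp_zero)
  then show "partial_deriv k f x = 0" using partial_deriv_eq by fastforce
qed

lemma test_functionsI: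
  assumes "smooth f" "compact C" "C \<subseteq> U" "\<And>x. x \<notin> C \<Longrightarrow> f x = 0"
  shows "f \<in> test_functions U"
proof -
  have "supp f \<subseteq> C" using supp_subset_closed[OF compact_imp_closed] assms by blast
  moreover from this have "compact (supp f)"
    using compact_Int_closed[OF assms(2) closed_supp[of f]] by (simp add: Int_absorb1)
  ultimately show ?thesis
    using assms(1,3) unfolding test_functions_def by blast
qed

lemma test_functionsD:
  assumes "f \<in> test_functions U"
  shows "smooth f" "compact (supp f)" "supp f \<subseteq> U"
  using assms unfolding test_functions_def by auto

lemma test_mult:
  assumes "f \<in> test_functions U" "smooth g"
  shows "(\<lambda>x. f x * g x) \<in> test_functions U" "(\<lambda>x. g x * f x) \<in> test_functions U"
  using test_functionsD[OF assms(1)] assms(2)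
  by (auto intro!: test_functionsI[of _ "supp f"] smooth_mult simp: supp_zero)

lemma test_add:
  assumes "f \<in> test_functions U" "g \<in> test_functions U"
  shows "(\<lambda>x. f x + g x) \<in> test_functions U"
proof (rule test_functionsI[of _ "supp f \<union> supp g"])
  show "f x + g x = 0" if "x \<notin> supp f \<union> supp g" for x
    using that supp_zero[of x f] supp_zero[of x g] by simp
qed (use test_functionsD[OF assms(1)] test_functionsD[OF assms(2)] in \<open>auto intro: smooth_add\<close>)

lemma test_zero: "(\<lambda>x. 0) \<in> test_functions U"
  by (rule test_functionsI[of _ "{}"]) (auto intro: smooth_const)

lemma test_cmult: "f \<in> test_functions U \<Longrightarrow> (\<lambda>x. c * f x) \<in> test_functions U"
  by (rule test_mult(2)[OF _ smooth_const])

lemma test_sum: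
  "(\<And>i. i \<in> I \<Longrightarrow> f i \<in> test_functions U) \<Longrightarrow> (\<lambda>x. \<Sum>i\<in>I. f i x) \<in> test_functions U"
  by (induction I rule: infinite_finite_induct) (auto intro!: test_zero test_add)

lemma test_partial_deriv: "f \<in> test_functions U \<Longrightarrow> partial_deriv k f \<in> test_functions U"
proof (rule test_functionsI[of _ "supp f"])
  show "partial_deriv k f x = 0" if "x \<notin> supp f" for x
    using that supp_partial_deriv[of k f] supp_zero[of x "partial_deriv k f"] by blast
qed (auto dest: test_functionsD intro: smooth_partial_deriv)

lemma test_bounded:
  assumes "f \<in> test_functions U"
  obtains B where "0 \<le> B" "\<And>x. \<bar>f x\<bar> \<le> B"
proof -
  have "compact (f ` supp f)"
    by (intro compact_continuous_image smooth_continuous_on test_functionsD[OF assms])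
  then obtain B where B: "\<And>x. x \<in> supp f \<Longrightarrow> \<bar>f x\<bar> \<le> B"
    using compact_imp_bounded bounded_real by (metis image_eqI)
  show ?thesis
  proof (rule that[of "max 0 B"])
    show "\<bar>f x\<bar> \<le> max 0 B" for x
      using B[of x] supp_zero[of x f] by (cases "x \<in> supp f") auto
  qed simp
qed

lemma test_mono: "f \<in> test_functions U \<Longrightarrow> U \<subseteq> V \<Longrightarrow> f \<in> test_functions V"
  unfolding test_functions_def by auto

section \<open>The flat function \<open>exp (-1/t)\<close>, bumps and powers\<close>

text \<open>The polynomial factor in \<open>1 / t\<close> makes the family closed under
  differentiation; \<open>flat 1\<close> is the flat function \<open>exp (- 1 / t)\<close>
  itself.\<close>

definition flat :: "real poly \<Rightarrow> real \<Rightarrow> real" where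
  "flat p t = (if t > 0 then poly p (1 / t) * exp (- (1 / t)) else 0)"

text \<open>With \<open>s = 1 / t\<close> one has \<open>d/dt = - s^2 d/ds\<close>, which sends
  \<open>p(s) exp (- s)\<close> to \<open>s^2 (p - p')(s) exp (- s)\<close>.\<close>

definition flat_deriv :: "real poly \<Rightarrow> real poly" where
  "flat_deriv p = [:0, 0, 1:] * (p - pderiv p)"

lemma poly_exp_tendsto_0: "((\<lambda>s. s ^ k * poly p s * exp (- s)) \<longlongrightarrow> 0) (at_top :: real filter)"
proof (induction p arbitrary: k)
  case 0
  show ?case by simp
next
  case (pCons a p)
  have "((\<lambda>s. a * (s ^ k / exp s) + s ^ Suc k * poly p s * exp (- s)) \<longlongrightarrow> a * 0 + 0) at_top"
    by (intro tendsto_intros tendsto_power_div_exp_0 pCons)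
  moreover have "a * (s ^ k / exp s) + s ^ Suc k * poly p s * exp (- s)
      = s ^ k * poly (pCons a p) s * exp (- s)" for s
    by (simp add: exp_minus field_simps)
  ultimately show ?case by simp
qed

lemma flat_has_derivative: "(flat p has_real_derivative flat (flat_deriv p) t) (at t)"
proof -
  consider "t > 0" | "t < 0" | "t = 0" by linarith
  then show ?thesis
  proof cases
    case 1
    have d: "((\<lambda>t. 1 / t) has_real_derivative - (1 / t\<^sup>2)) (at t)"
      using 1 by (auto intro!: derivative_eq_intros simp: power2_eq_square)
    have "((\<lambda>t. poly p (1 / t) * exp (- (1 / t))) has_real_derivative
        poly (pderiv p) (1 / t) * - (1 / t\<^sup>2) * exp (- (1 / t))
        + exp (- (1 / t)) * - (- (1 / t\<^sup>2)) * poly p (1 / t)) (at t)"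
      by (intro DERIV_mult DERIV_chain2[OF poly_DERIV d] DERIV_chain2[OF DERIV_exp] DERIV_minus d)
    also have "poly (pderiv p) (1 / t) * - (1 / t\<^sup>2) * exp (- (1 / t))
        + exp (- (1 / t)) * - (- (1 / t\<^sup>2)) * poly p (1 / t) = flat (flat_deriv p) t"
      using 1 by (simp add: flat_def flat_deriv_def power2_eq_square algebra_simps)
    finally show ?thesis
      by (rule has_field_derivative_transform_within_open[of _ _ _ "{0<..}"])
        (use 1 in \<open>auto simp: flat_def\<close>)
  next
    case 2
    have "((\<lambda>t. 0) has_real_derivative flat (flat_deriv p) t) (at t)"
      using 2 by (simp add: flat_def)
    then show ?thesis
      by (rule has_field_derivative_transform_within_open[of _ _ _ "{..<0}"])
        (use 2 in \<open>auto simp: flat_def\<close>)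
  next
    case 3
    \<comment> \<open>At the origin the difference quotient from the right is
      \<open>s * p(s) * exp (- s)\<close> with \<open>s = 1 / h\<close>, which decays as
      \<open>s\<close> tends to infinity.\<close>
    have "((\<lambda>h. inverse h ^ 1 * poly p (inverse h) * exp (- inverse h)) \<longlongrightarrow> 0) (at_right 0)"
      by (rule filterlim_compose[OF poly_exp_tendsto_0 filterlim_inverse_at_top_right])
    moreover have "\<forall>\<^sub>F h in at_right 0. inverse h ^ 1 * poly p (inverse h) * exp (- inverse h) = flat p h / h"
      unfolding eventually_at_right_field
      by (rule exI[of _ 1]) (simp add: flat_def divide_inverse)
    ultimately have "((\<lambda>h. flat p h / h) \<longlongrightarrow> 0) (at_right 0)"
      by (rule Lim_transform_eventually)
    moreover have "((\<lambda>h. flat p h / h) \<longlongrightarrow> 0) (at_left 0)"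
      by (rule Lim_transform_eventually[OF tendsto_const])
        (auto simp: eventually_at_left_field flat_def intro: exI[of _ "-1"])
    ultimately have "((\<lambda>h. flat p h / h) \<longlongrightarrow> 0) (at 0)"
      by (simp add: filterlim_split_at)
    then show ?thesis
      using 3 by (simp add: DERIV_def flat_def)
  qed
qed

lemma flat_chain: "derivative_chain UNIV (\<lambda>i. flat ((flat_deriv ^^ i) p))"
  unfolding derivative_chain_def using flat_has_derivative by auto

lemma powr_chain: "derivative_chain {0<..} (\<lambda>i t. (\<Prod>j<i. a - real j) * t powr (a - real i))"
  unfolding derivative_chain_def
  by (auto intro!: derivative_eq_intros simp: algebra_simps)

text \<open>From the first derivative on, this is the chain of \<open>t powr - 1\<close>, hence the
  shift of the index by one.\<close>

lemma ln_chain: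
  "derivative_chain {0<..} (\<lambda>i t. if i = 0 then ln t else (\<Prod>j<i - 1. - 1 - real j) * t powr (- 1 - real (i - 1)))"
  unfolding derivative_chain_def
proof (intro allI ballI)
  fix i :: nat and x :: real assume x: "x \<in> {0<..}"
  show "((\<lambda>t. if i = 0 then ln t else (\<Prod>j<i - 1. - 1 - real j) * t powr (- 1 - real (i - 1)))
     has_real_derivative (if Suc i = 0 then ln x else (\<Prod>j<Suc i - 1. - 1 - real j) * x powr (- 1 - real (Suc i - 1)))) (at x)"
  proof (cases i)
    case 0
    then show ?thesis using x by (auto intro!: derivative_eq_intros simp: powr_minus divide_simps)
  next
    case (Suc j)
    then show ?thesis
      using powr_chain[of "-1"] x unfolding derivative_chain_def by auto
  qed
qed

lemma smooth_powr:
  assumes "smooth h" "\<And>x. h x > 0"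
  shows "smooth (\<lambda>x. h x powr a)"
  using smooth_compose[OF powr_chain[of a] assms(1), of 0] assms(2) by simp

lemma smooth_ln:
  assumes "smooth h" "\<And>x. h x > 0"
  shows "smooth (\<lambda>x. ln (h x))"
  using smooth_compose[OF ln_chain assms(1), of 0] assms(2) by simp

lemma smooth_inverse:
  assumes "smooth h" "\<And>x. h x > 0"
  shows "smooth (\<lambda>x. inverse (h x))"
  using smooth_powr[OF assms, of "-1"] assms(2)
  by (simp add: powr_minus abs_of_pos)

lemma smooth_flat: "smooth h \<Longrightarrow> smooth (\<lambda>x. flat p (h x))"
  using smooth_compose[OF flat_chain[of p], of h 0] by simp

lemma flat_1_nonneg: "flat 1 t \<ge> 0" and flat_1_pos: "t > 0 \<Longrightarrow> flat 1 t > 0"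
  and flat_nonpos: "t \<le> 0 \<Longrightarrow> flat p t = 0"
  by (auto simp: flat_def)

definition sqdist :: "real ^ 'n::finite \<Rightarrow> real ^ 'n \<Rightarrow> real" where
  "sqdist y x = (\<Sum>i\<in>UNIV. (x $ i - y $ i)\<^sup>2)"

lemma sqdist_dist: "sqdist y x = (dist x y)\<^sup>2"
  unfolding sqdist_def dist_vec_def L2_set_def
  by (simp add: dist_real_def sum_nonneg)

lemma smooth_sqdist: "smooth (sqdist y)"
  unfolding sqdist_def
  by (intro smooth_sum smooth_power smooth_diff smooth_coord smooth_const)

lemma partial_deriv_sqdist:
  fixes y :: "real ^ 'n::finite"
  shows "partial_deriv k (sqdist y) = (\<lambda>x. 2 * (x $ k - y $ k))"
proof
  fix x
  have "(sqdist y has_derivative (\<lambda>v. \<Sum>i\<in>UNIV. 2 * (x $ i - y $ i) * v $ i)) (at x)"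
    unfolding sqdist_def
    by (auto intro!: derivative_eq_intros bounded_linear.has_derivative[OF bounded_linear_vec_nth]
        simp: algebra_simps)
  then have "partial_deriv k (sqdist y) x = (\<Sum>i\<in>UNIV. 2 * (x $ i - y $ i) * (axis k 1 :: real^'n) $ i)"
    by (rule partial_deriv_eq)
  also have "\<dots> = (\<Sum>i\<in>UNIV. if i = k then 2 * (x $ i - y $ i) else 0)"
    by (intro sum.cong) (auto simp: axis_def)
  finally show "partial_deriv k (sqdist y) x = 2 * (x $ k - y $ k)" by simp
qed

lemma bump_exists:
  assumes "compact C" "C \<subseteq> ball c r"
  obtains \<psi> where "\<psi> \<in> test_functions (ball c r)" "\<And>x. \<psi> x \<ge> 0" "\<And>x. x \<in> C \<Longrightarrow> \<psi> x = 1"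
proof (cases "C = {}")
  case True
  show ?thesis by (rule that[OF test_zero]) (use True in auto)
next
  case False
  have "compact ((\<lambda>x. dist x c) ` C)"
    by (intro compact_continuous_image continuous_intros assms)
  then obtain a where a: "a \<in> C" "\<And>x. x \<in> C \<Longrightarrow> dist x c \<le> dist a c"
    using compact_attains_sup[of "(\<lambda>x. dist x c) ` C"] False by blast
  \<comment> \<open>The farthest point of \<open>C\<close> lies strictly inside the ball, which
    leaves room for two radii: \<open>\<psi>\<close> will be 1 up to \<open>s\<close> and vanish
    beyond \<open>t\<close>.\<close>
  obtain s t where st: "dist a c < s" "s < t" "t < r"
    using a(1) assms(2) dense by (metis dist_commute mem_ball subsetD)
  have "0 < s" using st(1) zero_le_dist[of a c] by linarith
  then have s0: "0 < s" "0 < t" using st(2) by auto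
  have st2: "s\<^sup>2 < t\<^sup>2" using st s0 by (simp add: power_strict_mono)
  \<comment> \<open>As \<open>s < t\<close>, at least one summand is positive at every point, so
    dividing by \<open>d\<close> keeps \<open>\<psi>\<close> smooth.\<close>
  define d where "d x = flat 1 (t\<^sup>2 - sqdist c x) + flat 1 (sqdist c x - s\<^sup>2)" for x
  define \<psi> where "\<psi> x = flat 1 (t\<^sup>2 - sqdist c x) * inverse (d x)" for x
  have d: "d x > 0" for x
    using flat_1_pos[of "t\<^sup>2 - sqdist c x"] flat_1_pos[of "sqdist c x - s\<^sup>2"]
      flat_1_nonneg[of "t\<^sup>2 - sqdist c x"] flat_1_nonneg[of "sqdist c x - s\<^sup>2"] st2
    unfolding d_def by (cases "sqdist c x < t\<^sup>2") auto
  have sm: "smooth \<psi>" unfolding \<psi>_def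
    by (intro smooth_mult smooth_inverse d, unfold d_def)
      (intro smooth_flat smooth_diff smooth_const smooth_sqdist smooth_add)+
  show ?thesis
  proof (rule that[of \<psi>])
    show "\<psi> \<in> test_functions (ball c r)"
    proof (rule test_functionsI[OF sm, of "cball c t"])
      fix x assume "x \<notin> cball c t"
      then have "t\<^sup>2 < sqdist c x" using s0
        by (simp add: sqdist_dist dist_commute power_strict_mono)
      then show "\<psi> x = 0" by (simp add: \<psi>_def flat_nonpos)
    qed (use st in auto)
    show "\<psi> x \<ge> 0" for x
      using flat_1_nonneg d[of x] by (simp add: \<psi>_def)
    fix x assume "x \<in> C"
    then have "sqdist c x \<le> s\<^sup>2"
      unfolding sqdist_dist using a(2)[of x] st(1) by (intro power_mono) auto
    then have "flat 1 (sqdist c x - s\<^sup>2) = 0" by (simp add: flat_nonpos)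
    then show "\<psi> x = 1" using d[of x] by (simp add: \<psi>_def d_def)
  qed
qed

text \<open>\<open>cutoff i\<close> is the \<open>i\<close>-th derivative of the profile
  \<open>G(u) = exp (4 - 4 / (1 - u))\<close>, extended by 0 to \<open>u \<ge> 1\<close> and
  normalised by \<open>G(0) = 1\<close>. The scale 4 keeps the argument
  \<open>t = (1 - u) / 4\<close> of the flat function at most \<open>1 / 4\<close> for
  \<open>u \<ge> 0\<close>, where \<open>exp (- 1 / t)\<close> is convex with a margin.\<close>

definition cutoff :: "nat \<Rightarrow> real \<Rightarrow> real" where
  "cutoff i u = (- 1 / 4) ^ i * flat ((flat_deriv ^^ i) 1) ((1 - u) / 4) / flat 1 (1 / 4)"

lemma cutoff_chain: "derivative_chain UNIV cutoff"
  unfolding derivative_chain_def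
proof (intro allI ballI)
  fix i and u :: real
  let ?F = "flat ((flat_deriv ^^ i) 1)" and ?F' = "flat ((flat_deriv ^^ Suc i) 1)"
  have "((\<lambda>u. ?F ((1 - u) / 4)) has_real_derivative ?F' ((1 - u) / 4) * (- 1 / 4)) (at u)"
    using flat_has_derivative[of "(flat_deriv ^^ i) 1" "(1 - u) / 4"]
    by (intro DERIV_chain2[of "?F"]) (auto intro!: derivative_eq_intros)
  then have "((\<lambda>u. (- 1 / 4) ^ i * ?F ((1 - u) / 4) / flat 1 (1 / 4)) has_real_derivative
      (- 1 / 4) ^ i * (?F' ((1 - u) / 4) * (- 1 / 4)) / flat 1 (1 / 4)) (at u)"
    by (intro DERIV_cdivide DERIV_cmult)
  then show "(cutoff i has_real_derivative cutoff (Suc i) u) (at u)"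
    unfolding cutoff_def by (simp add: ac_simps)
qed

lemma cutoff_zero: "u \<ge> 1 \<Longrightarrow> cutoff i u = 0"
  by (simp add: cutoff_def flat_nonpos)

lemma cutoff_0_0: "cutoff 0 0 = 1"
proof -
  have "flat 1 (1 / 4) \<noteq> 0" using flat_1_pos[of "1 / 4"] by force
  then show ?thesis by (simp add: cutoff_def)
qed

lemma cutoff_nonneg: "0 \<le> cutoff 0 u"
  using flat_1_nonneg by (simp add: cutoff_def)

lemma flat_deriv_1: "flat_deriv 1 = [:0, 0, 1:]"
  by (simp add: flat_deriv_def one_pCons pderiv_pCons)

lemma flat_deriv_2: "flat_deriv (flat_deriv 1) = [:0, 0, 0, - 2, 1:]"
  unfolding flat_deriv_1 by (simp add: flat_deriv_def pderiv_pCons)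

lemma cutoff_le_1: "0 \<le> u \<Longrightarrow> cutoff 0 u \<le> 1"
proof -
  assume u: "0 \<le> u"
  have "flat 1 ((1 - u) / 4) \<le> flat 1 (1 / 4)"
  proof (cases "u < 1")
    case True
    then have "1 / (1 / 4) \<le> 1 / ((1 - u) / 4)"
      using u by (intro divide_left_mono) auto
    then show ?thesis using True by (simp add: flat_def)
  qed (simp add: flat_def)
  then show ?thesis using flat_1_pos[of "1/4"] by (simp add: cutoff_def)
qed

lemma cutoff_1_nonpos: "cutoff 1 u \<le> 0"
proof -
  have "0 \<le> flat (flat_deriv 1) ((1 - u) / 4)"
    unfolding flat_deriv_1 by (simp add: flat_def)
  then show ?thesis using flat_1_pos[of "1/4"]
    by (simp add: cutoff_def divide_nonpos_pos del: flat_deriv_1)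
qed

text \<open>The inequality \<open>(G')^2 \<le> 2 G''\<close> lets the energy of \<open>G(u)\<close>
  be absorbed by its Laplacian. With \<open>e = exp (- 1 / t)\<close> and
  \<open>f = exp (- 4)\<close> the two sides are \<open>e / (16 f t^4)\<close> times
  \<open>e / f\<close> and times \<open>2 (1 - 2 t)\<close>; the first of these is at most 1 and,
  because \<open>t \<le> 1 / 4\<close>, the second is at least 1.\<close>

lemma cutoff_gradient:
  assumes "0 \<le> u"
  shows "(cutoff 1 u)\<^sup>2 \<le> 2 * cutoff 2 u"
proof (cases "u < 1")
  case True
  define t where "t = (1 - u) / 4"
  define e where "e = exp (- (1 / t))"
  define f where "f = flat 1 (1/4)"
  have t: "0 < t" "t \<le> 1 / 4" using True assms by (auto simp: t_def)
  have "1 / (1 / 4) \<le> 1 / t" using t by (intro divide_left_mono) auto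
  then have e: "0 < e" "e \<le> f"
    by (auto simp: e_def f_def flat_def)
  have f: "f > 0" unfolding f_def by (rule flat_1_pos) simp
  have c1: "cutoff 1 u = - (e / t\<^sup>2) / (4 * f)"
    using t unfolding cutoff_def t_def[symmetric] f_def[symmetric]
    by (simp add: flat_def flat_deriv_1 e_def power2_eq_square)
  have c2: "cutoff 2 u = (e / t ^ 4) * (1 - 2 * t) / (16 * f)"
  proof -
    have "flat (flat_deriv (flat_deriv 1)) t = (e / t ^ 4) * (1 - 2 * t)"
      using t unfolding flat_deriv_2
      by (simp add: flat_def e_def) (simp add: field_simps power4_eq_xxxx)
    then show ?thesis unfolding cutoff_def t_def[symmetric] f_def[symmetric]
      by (simp add: numeral_2_eq_2)
  qed
  have p: "0 \<le> e / t ^ 4" using e t by simp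
  have "(cutoff 1 u)\<^sup>2 = (e / t ^ 4) * (e / f) / (16 * f)"
    unfolding c1 using t f by (simp add: power2_eq_square power4_eq_xxxx)
  also have "\<dots> \<le> (e / t ^ 4) * 1 / (16 * f)"
    using e f by (intro divide_right_mono mult_left_mono p) auto
  also have "\<dots> \<le> (e / t ^ 4) * (2 * (1 - 2 * t)) / (16 * f)"
    using f t by (intro divide_right_mono mult_left_mono p) auto
  also have "\<dots> = 2 * cutoff 2 u" unfolding c2 by (simp add: field_simps)
  finally show ?thesis .
next
  case False
  then show ?thesis by (simp add: cutoff_zero)
qed

section \<open>The algebra of superforms\<close>

lemma shuffle_sign_square: "shuffle_sign I J * shuffle_sign I J = 1"
  unfolding shuffle_sign_def by (simp flip: power_mult_distrib)

lemma shuffle_sign_Un_left: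
  assumes "I \<inter> I' = {}"
  shows "shuffle_sign (I \<union> I') J = shuffle_sign I J * shuffle_sign I' J"
proof -
  have "{(i, j). i \<in> I \<union> I' \<and> j \<in> J \<and> j < i}
      = {(i, j). i \<in> I \<and> j \<in> J \<and> j < i} \<union> {(i, j). i \<in> I' \<and> j \<in> J \<and> j < i}"
    by auto
  moreover have "{(i, j). i \<in> I \<and> j \<in> J \<and> j < i} \<inter> {(i, j). i \<in> I' \<and> j \<in> J \<and> j < i} = {}"
    using assms by auto
  ultimately show ?thesis
    unfolding shuffle_sign_def by (simp add: card_Un_disjoint power_add)
qed

lemma shuffle_sign_Un_right:
  assumes "J \<inter> J' = {}"
  shows "shuffle_sign I (J \<union> J') = shuffle_sign I J * shuffle_sign I J'"
proof -
  have "{(i, j). i \<in> I \<and> j \<in> J \<union> J' \<and> j < i}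
      = {(i, j). i \<in> I \<and> j \<in> J \<and> j < i} \<union> {(i, j). i \<in> I \<and> j \<in> J' \<and> j < i}"
    by auto
  moreover have "{(i, j). i \<in> I \<and> j \<in> J \<and> j < i} \<inter> {(i, j). i \<in> I \<and> j \<in> J' \<and> j < i} = {}"
    using assms by auto
  ultimately show ?thesis
    unfolding shuffle_sign_def by (simp add: card_Un_disjoint power_add)
qed

text \<open>Each pair in \<open>I \<times> J\<close> is an inversion for exactly one of the two
  orders, so the two inversion counts add up to \<open>card I * card J\<close>.\<close>

lemma shuffle_sign_swap:
  assumes "I \<inter> J = {}"
  shows "shuffle_sign J I = (- 1) ^ (card I * card J) * shuffle_sign I J"
proof -
  let ?A = "{(i, j). i \<in> I \<and> j \<in> J \<and> j < i}" and ?B = "{(j, i). j \<in> J \<and> i \<in> I \<and> i < j}"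
  have u: "?A \<union> prod.swap ` ?B = I \<times> J"
    using assms by (auto simp: image_iff)
  have "?A \<inter> prod.swap ` ?B = {}" by auto
  then have "card (I \<times> J) = card ?A + card (prod.swap ` ?B)"
    unfolding u[symmetric] by (intro card_Un_disjoint finite)
  moreover have "card (prod.swap ` ?B) = card ?B"
    by (intro card_image inj_on_subset[OF inj_swap]) auto
  ultimately have "card ?A + card ?B = card I * card J"
    by (simp add: card_cartesian_product)
  then have "(- 1) ^ (card I * card J) = ((- 1) ^ card ?A * (- 1) ^ card ?B :: real)"
    by (simp flip: power_add)
  then show ?thesis
    unfolding shuffle_sign_def by (simp add: mult.left_commute flip: power_mult_distrib)
qed

lemma shuffle_sign_empty [simp]: "shuffle_sign {} J = 1" "shuffle_sign I {} = 1"
  by (simp_all add: shuffle_sign_def)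

lemma super_sign_empty [simp]: "super_sign {} {} K L = 1" "super_sign I J {} {} = 1"
  by (simp_all add: super_sign_def)

lemma super_sign_swap:
  assumes "I \<inter> K = {}" "J \<inter> L = {}"
  shows "super_sign K L I J = (- 1) ^ ((card I + card J) * (card K + card L)) * super_sign I J K L"
proof -
  have e: "(- 1) ^ (n * 2) = (1 :: real)" for n :: nat by simp
  show ?thesis
    unfolding super_sign_def shuffle_sign_swap[OF assms(1)] shuffle_sign_swap[OF assms(2)]
    by (simp add: power_add algebra_simps mult.commute[of "card L"] mult.commute[of "card K"])
qed

text \<open>The cocycle identity of the signs: both sides are the sign of sorting a product of three
  disjoint blocks, bracketed in the two ways.\<close>

lemma super_sign_assoc:
  assumes "I \<inter> K = {}" "J \<inter> L = {}" "I \<inter> M = {}" "J \<inter> N = {}" "K \<inter> M = {}" "L \<inter> N = {}"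
  shows "super_sign (I \<union> K) (J \<union> L) M N * super_sign I J K L
    = super_sign I J (K \<union> M) (L \<union> N) * super_sign K L M N"
  unfolding super_sign_def using assms
  by (simp add: shuffle_sign_Un_left shuffle_sign_Un_right card_Un_disjoint power_add algebra_simps)

lemma sum_Pow_Pow:
  fixes I :: "'a::finite set" and f :: "'a set \<Rightarrow> 'a set \<Rightarrow> 'b::comm_monoid_add"
  shows "(\<Sum>I1\<in>Pow I. \<Sum>I2\<in>Pow I1. f I1 I2) = (\<Sum>I2\<in>Pow I. \<Sum>K\<in>Pow (I - I2). f (I2 \<union> K) I2)"
  by (subst (1 2) sum.Sigma, simp, simp, simp, simp) (rule sum.reindex_bij_witness[of _ "\<lambda>(I2, K). (I2 \<union> K, I2)" "\<lambda>(I1, I2). (I2, I1 - I2)"],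
    auto simp: Un_absorb1)

lemma sum_Pow_compl: "(\<Sum>I'\<in>Pow I. f (I - I')) = (\<Sum>I'\<in>Pow I. f I')"
  by (rule sum.reindex_bij_witness[of _ "\<lambda>I'. I - I'" "\<lambda>I'. I - I'"]) auto

lemma sum_Pow_compl2:
  "(\<Sum>I'\<in>Pow I. \<Sum>J'\<in>Pow J. f (I - I') (J - J')) = (\<Sum>I'\<in>Pow I. \<Sum>J'\<in>Pow J. f I' J')"
  using sum_Pow_compl[of "\<lambda>I'. \<Sum>J'\<in>Pow J. f I' (J - J')" I] by (simp add: sum_Pow_compl)

text \<open>Nested splittings of an index set are reparametrised by their three disjoint pieces; the
  signs then agree termwise by \<open>super_sign_assoc\<close>.\<close>

lemma wedge_assoc: "wedge (wedge a b) c = wedge a (wedge b c)"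
proof (intro ext)
  fix I J :: "'a set" and x
  let ?s = super_sign
  have "wedge (wedge a b) c I J x = (\<Sum>I1\<in>Pow I. \<Sum>J1\<in>Pow J. \<Sum>I2\<in>Pow I1. \<Sum>J2\<in>Pow J1.
      ?s I1 J1 (I - I1) (J - J1) * ?s I2 J2 (I1 - I2) (J1 - J2) * (a I2 J2 x * b (I1 - I2) (J1 - J2) x
        * c (I - I1) (J - J1) x))"
    unfolding wedge_def by (simp add: sum_distrib_left sum_distrib_right mult_ac)
  also have "\<dots> = (\<Sum>I1\<in>Pow I. \<Sum>I2\<in>Pow I1. \<Sum>J1\<in>Pow J. \<Sum>J2\<in>Pow J1.
      ?s I1 J1 (I - I1) (J - J1) * ?s I2 J2 (I1 - I2) (J1 - J2) * (a I2 J2 x * b (I1 - I2) (J1 - J2) x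
        * c (I - I1) (J - J1) x))"
    by (intro sum.cong sum.swap refl)
  also have "\<dots> = (\<Sum>I2\<in>Pow I. \<Sum>K\<in>Pow (I - I2). \<Sum>J2\<in>Pow J. \<Sum>L\<in>Pow (J - J2).
      ?s (I2 \<union> K) (J2 \<union> L) (I - (I2 \<union> K)) (J - (J2 \<union> L)) * ?s I2 J2 (I2 \<union> K - I2) (J2 \<union> L - J2)
       * (a I2 J2 x * b (I2 \<union> K - I2) (J2 \<union> L - J2) x * c (I - (I2 \<union> K)) (J - (J2 \<union> L)) x))"
    unfolding sum_Pow_Pow ..
  also have "\<dots> = (\<Sum>I2\<in>Pow I. \<Sum>K\<in>Pow (I - I2). \<Sum>J2\<in>Pow J. \<Sum>L\<in>Pow (J - J2).
      ?s I2 J2 (I - I2) (J - J2) * ?s K L (I - I2 - K) (J - J2 - L)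
       * (a I2 J2 x * b K L x * c (I - I2 - K) (J - J2 - L) x))"
  proof (intro sum.cong refl)
    fix I2 K J2 L assume *: "I2 \<in> Pow I" "K \<in> Pow (I - I2)" "J2 \<in> Pow J" "L \<in> Pow (J - J2)"
    then have e: "I2 \<union> K - I2 = K" "J2 \<union> L - J2 = L" "I - (I2 \<union> K) = I - I2 - K"
      "J - (J2 \<union> L) = J - J2 - L" "K \<union> (I - I2 - K) = I - I2" "L \<union> (J - J2 - L) = J - J2"
      by auto
    have "?s (I2 \<union> K) (J2 \<union> L) (I - I2 - K) (J - J2 - L) * ?s I2 J2 K L
      = ?s I2 J2 (K \<union> (I - I2 - K)) (L \<union> (J - J2 - L)) * ?s K L (I - I2 - K) (J - J2 - L)"
      by (rule super_sign_assoc) (use * in auto)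
    then show "?s (I2 \<union> K) (J2 \<union> L) (I - (I2 \<union> K)) (J - (J2 \<union> L)) * ?s I2 J2 (I2 \<union> K - I2) (J2 \<union> L - J2)
       * (a I2 J2 x * b (I2 \<union> K - I2) (J2 \<union> L - J2) x * c (I - (I2 \<union> K)) (J - (J2 \<union> L)) x)
      = ?s I2 J2 (I - I2) (J - J2) * ?s K L (I - I2 - K) (J - J2 - L)
       * (a I2 J2 x * b K L x * c (I - I2 - K) (J - J2 - L) x)"
      unfolding e by simp
  qed
  also have "\<dots> = (\<Sum>I2\<in>Pow I. \<Sum>J2\<in>Pow J. \<Sum>K\<in>Pow (I - I2). \<Sum>L\<in>Pow (J - J2).
      ?s I2 J2 (I - I2) (J - J2) * ?s K L (I - I2 - K) (J - J2 - L)
       * (a I2 J2 x * b K L x * c (I - I2 - K) (J - J2 - L) x))"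
    by (intro sum.cong sum.swap refl)
  also have "\<dots> = wedge a (wedge b c) I J x"
    unfolding wedge_def by (simp add: sum_distrib_left sum_distrib_right mult_ac)
  finally show "wedge (wedge a b) c I J x = wedge a (wedge b c) I J x" .
qed

text \<open>The sign is demanded only where both coefficients are nonzero, so one rule covers
  anticommuting 1-forms, with \<open>e = - 1\<close>, and commuting forms of even degree, with
  \<open>e = 1\<close>.\<close>

lemma wedge_commute_parity:
  assumes "\<And>I J K L x. a I J x \<noteq> 0 \<Longrightarrow> b K L x \<noteq> 0 \<Longrightarrow>
    (- 1) ^ ((card I + card J) * (card K + card L)) = e"
  shows "wedge a b = (\<lambda>I J x. e * wedge b a I J x)"
proof (intro ext)
  fix I J :: "'a set" and x
  let ?s = super_sign
  have "wedge a b I J x = (\<Sum>I'\<in>Pow I. \<Sum>J'\<in>Pow J.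
     ?s (I - I') (J - J') (I - (I - I')) (J - (J - J'))
      * (a (I - I') (J - J') x * b (I - (I - I')) (J - (J - J')) x))"
    unfolding wedge_def by (rule sum_Pow_compl2[symmetric])
  also have "\<dots> = (\<Sum>I'\<in>Pow I. \<Sum>J'\<in>Pow J.
     e * (?s I' J' (I - I') (J - J') * (b I' J' x * a (I - I') (J - J') x)))"
  proof (intro sum.cong refl)
    fix I' J' assume *: "I' \<in> Pow I" "J' \<in> Pow J"
    then have [simp]: "I - (I - I') = I'" "J - (J - J') = J'" by auto
    have s: "?s (I - I') (J - J') I' J'
       = (- 1) ^ ((card I' + card J') * (card (I - I') + card (J - J'))) * ?s I' J' (I - I') (J - J')"
      by (rule super_sign_swap) auto
    show "?s (I - I') (J - J') (I - (I - I')) (J - (J - J'))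
      * (a (I - I') (J - J') x * b (I - (I - I')) (J - (J - J')) x)
      = e * (?s I' J' (I - I') (J - J') * (b I' J' x * a (I - I') (J - J') x))"
    proof (cases "a (I - I') (J - J') x = 0 \<or> b I' J' x = 0")
      case False
      then have "(- 1) ^ ((card I' + card J') * (card (I - I') + card (J - J'))) = e"
        using assms[of "I - I'" "J - J'" x I' J'] by (simp add: mult.commute)
      then show ?thesis using s by simp
    qed auto
  qed
  also have "\<dots> = e * wedge b a I J x"
    unfolding wedge_def by (simp add: sum_distrib_left)
  finally show "wedge a b I J x = e * wedge b a I J x" .
qed

lemma wedge_zero_left: "(\<And>I J. a I J x = 0) \<Longrightarrow> wedge a b I J x = 0"
  and wedge_zero_right: "(\<And>I J. b I J x = 0) \<Longrightarrow> wedge a b I J x = 0"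
  unfolding wedge_def by simp_all

lemma wedge_add_left: "wedge (\<lambda>I J x. a I J x + b I J x) c = (\<lambda>I J x. wedge a c I J x + wedge b c I J x)"
  and wedge_add_right: "wedge c (\<lambda>I J x. a I J x + b I J x) = (\<lambda>I J x. wedge c a I J x + wedge c b I J x)"
  unfolding wedge_def by (simp_all add: algebra_simps sum.distrib)

lemma wedge_scale_left: "wedge (\<lambda>I J x. f x * a I J x) c = (\<lambda>I J x. f x * wedge a c I J x)"
  and wedge_scale_right: "wedge c (\<lambda>I J x. f x * a I J x) = (\<lambda>I J x. f x * wedge c a I J x)"
  unfolding wedge_def by (simp_all add: sum_distrib_left mult_ac)

lemma wedge_sum_left:
  "wedge (\<lambda>I J x. \<Sum>i\<in>S. a i I J x) c = (\<lambda>I J x. \<Sum>i\<in>S. wedge (a i) c I J x)"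
proof (intro ext)
  fix I J x
  show "wedge (\<lambda>I J x. \<Sum>i\<in>S. a i I J x) c I J x = (\<Sum>i\<in>S. wedge (a i) c I J x)"
    by (induction S rule: infinite_finite_induct) (simp_all add: wedge_zero_left wedge_add_left)
qed

lemma wedge_sum_right:
  "wedge c (\<lambda>I J x. \<Sum>i\<in>S. a i I J x) = (\<lambda>I J x. \<Sum>i\<in>S. wedge c (a i) I J x)"
proof (intro ext)
  fix I J x
  show "wedge c (\<lambda>I J x. \<Sum>i\<in>S. a i I J x) I J x = (\<Sum>i\<in>S. wedge c (a i) I J x)"
    by (induction S rule: infinite_finite_induct) (simp_all add: wedge_zero_right wedge_add_right)
qed

lemma wedge_one_left: "wedge one_form a = a"
proof (intro ext)
  fix I J x
  have "wedge one_form a I J x = (\<Sum>I'\<in>{{}}. \<Sum>J'\<in>{{}}.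
     super_sign I' J' (I - I') (J - J') * (one_form I' J' x * a (I - I') (J - J') x))"
    unfolding wedge_def
    by (intro sum.mono_neutral_cong_right sum.neutral) (auto simp: one_form_def)
  then show "wedge one_form a I J x = a I J x" by (simp add: one_form_def)
qed

lemma wedge_one_right: "wedge a one_form = a"
proof -
  have "wedge a one_form = (\<lambda>I J x. 1 * wedge one_form a I J x)"
    by (rule wedge_commute_parity) (simp add: one_form_def split: if_splits)
  then show ?thesis by (simp add: wedge_one_left)
qed

lemma wedge_degree:
  assumes "\<And>I J. a I J x \<noteq> 0 \<Longrightarrow> card I = p \<and> card J = q"
    and "\<And>I J. b I J x \<noteq> 0 \<Longrightarrow> card I = p' \<and> card J = q'"
    and "wedge a b I J x \<noteq> 0"
  shows "card I = p + p' \<and> card J = q + q'"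
proof -
  obtain I' where I': "I' \<in> Pow I" "(\<Sum>J'\<in>Pow J.
      super_sign I' J' (I - I') (J - J') * (a I' J' x * b (I - I') (J - J') x)) \<noteq> 0"
    using assms(3) unfolding wedge_def by (rule sum.not_neutral_contains_not_neutral)
  obtain J' where "J' \<in> Pow J"
      "super_sign I' J' (I - I') (J - J') * (a I' J' x * b (I - I') (J - J') x) \<noteq> 0"
    using I'(2) by (rule sum.not_neutral_contains_not_neutral)
  with I' have "I' \<in> Pow I" "J' \<in> Pow J" "a I' J' x \<noteq> 0" "b (I - I') (J - J') x \<noteq> 0"
    by auto
  then show ?thesis
    using assms(1)[of I' J'] assms(2)[of "I - I'" "J - J'"] card_mono[of I I'] card_mono[of J J']
    by (auto simp: card_Diff_subset)
qed

text \<open>Exchanging the roles of \<open>dx\<close> and \<open>d\<xi>\<close> respects the product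
  when both factors have balanced degrees, because then the sign of moving \<open>dx\<close> past
  \<open>d\<xi>\<close> is unchanged.\<close>

lemma wedge_transpose:
  assumes "\<And>I J. a I J x \<noteq> 0 \<Longrightarrow> card I = card J" "\<And>I J. b I J x \<noteq> 0 \<Longrightarrow> card I = card J"
  shows "wedge a b J I x = wedge (\<lambda>I J. a J I) (\<lambda>I J. b J I) I J x"
proof -
  have "wedge a b J I x = (\<Sum>I'\<in>Pow I. \<Sum>J'\<in>Pow J.
      super_sign J' I' (J - J') (I - I') * (a J' I' x * b (J - J') (I - I') x))"
    unfolding wedge_def by (rule sum.swap)
  also have "\<dots> = wedge (\<lambda>I J. a J I) (\<lambda>I J. b J I) I J x"
    unfolding wedge_def
  proof (intro sum.cong refl)
    fix I' J'
    show "super_sign J' I' (J - J') (I - I') * (a J' I' x * b (J - J') (I - I') x)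
      = super_sign I' J' (I - I') (J - J') * (a J' I' x * b (J - J') (I - I') x)"
    proof (cases "a J' I' x = 0 \<or> b (J - J') (I - I') x = 0")
      case False
      then have "card J' = card I'" "card (J - J') = card (I - I')" using assms by auto
      then show ?thesis unfolding super_sign_def by simp
    qed auto
  qed
  finally show ?thesis .
qed

section \<open>Basis forms and powers of \<open>beta\<close>\<close>

lemma wedge_dx_dxi: "wedge (dx k) (dxi l) I J x = (if I = {k} \<and> J = {l} then 1 else 0)"
proof -
  have "wedge (dx k) (dxi l) I J x = (\<Sum>I'\<in>Pow I. \<Sum>J'\<in>Pow J.
      if J' = {} then (if I' = {k} \<and> I = {k} \<and> J = {l} then 1 else 0) else 0)"
    unfolding wedge_def
    by (intro sum.cong refl) (auto simp: dx_def dxi_def super_sign_def)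
  also have "\<dots> = (\<Sum>I'\<in>Pow I. if I' = {k} then (if I = {k} \<and> J = {l} then 1 else 0) else 0)"
    by (intro sum.cong refl) (simp add: sum.delta)
  also have "\<dots> = (if I = {k} \<and> J = {l} then 1 else 0)"
    by (simp add: sum.delta)
  finally show ?thesis .
qed

lemma wedge_basis_right:
  "wedge b (wedge (dx k) (dxi l)) P Q x
    = (if k \<in> P \<and> l \<in> Q then super_sign (P - {k}) (Q - {l}) {k} {l} * b (P - {k}) (Q - {l}) x else 0)"
proof -
  have "wedge b (wedge (dx k) (dxi l)) P Q x = (\<Sum>P'\<in>Pow P. \<Sum>Q'\<in>Pow Q.
      if Q' = Q - {l} then (if P' = P - {k} then
        (if k \<in> P \<and> l \<in> Q then super_sign (P - {k}) (Q - {l}) {k} {l} * b (P - {k}) (Q - {l}) x else 0) else 0)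
      else 0)"
    unfolding wedge_def[of b] wedge_dx_dxi
  proof (intro sum.cong refl)
    fix P' Q' assume "P' \<in> Pow P" "Q' \<in> Pow Q"
    then have "(P - P' = {k}) = (P' = P - {k} \<and> k \<in> P)" "(Q - Q' = {l}) = (Q' = Q - {l} \<and> l \<in> Q)"
      by auto
    then show "super_sign P' Q' (P - P') (Q - Q') * (b P' Q' x * (if P - P' = {k} \<and> Q - Q' = {l} then 1 else 0)) =
       (if Q' = Q - {l} then (if P' = P - {k} then
        (if k \<in> P \<and> l \<in> Q then super_sign (P - {k}) (Q - {l}) {k} {l} * b (P - {k}) (Q - {l}) x else 0) else 0)
      else 0)"
      by (auto simp: double_diff)
  qed
  also have "\<dots> = (\<Sum>P'\<in>Pow P. if P' = P - {k} then
        (if k \<in> P \<and> l \<in> Q then super_sign (P - {k}) (Q - {l}) {k} {l} * b (P - {k}) (Q - {l}) x else 0) else 0)"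
    by (intro sum.cong refl) (simp add: sum.delta Diff_subset)
  finally show ?thesis by (simp add: sum.delta Diff_subset)
qed

lemma beta_eq: "beta = (\<lambda>I J x. \<Sum>j\<in>UNIV. wedge (dx j) (dxi j) I J x)"
  by (intro ext) (simp add: beta_def)

lemma sum_nonzeroD: "sum f A \<noteq> 0 \<Longrightarrow> \<exists>i\<in>A. f i \<noteq> 0"
  by (rule ccontr) (simp add: sum.neutral)

lemma beta_degree: "beta I J x \<noteq> 0 \<Longrightarrow> card I = 1 \<and> card J = 1"
  unfolding beta_def wedge_dx_dxi by (auto dest!: sum_nonzeroD split: if_splits)

lemma beta_pow_0: "beta_pow 0 = one_form"
  and beta_pow_Suc: "beta_pow (Suc k) = wedge beta (beta_pow k)"
  by (simp_all add: beta_pow_def wedge_list_def)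

lemma beta_pow_degree: "beta_pow k I J x \<noteq> 0 \<Longrightarrow> card I = k \<and> card J = k"
proof (induction k arbitrary: I J)
  case 0
  then show ?case by (simp add: beta_pow_0 one_form_def split: if_splits)
next
  case (Suc k)
  have "card I = 1 + k \<and> card J = 1 + k"
    by (rule wedge_degree[of beta x 1 1 "beta_pow k" k k I J])
      (use Suc in \<open>auto simp: beta_pow_Suc dest: beta_degree\<close>)
  then show ?case by simp
qed

lemma beta_pow_const: "beta_pow k I J x = beta_pow k I J y"
proof (induction k arbitrary: I J)
  case 0
  show ?case by (simp add: beta_pow_0 one_form_def)
next
  case (Suc k)
  have "beta I J x = beta I J y" for I J unfolding beta_def wedge_dx_dxi ..
  then show ?case unfolding beta_pow_Suc wedge_def using Suc by simp
qed

lemma beta_pow_transpose: "beta_pow k J I x = beta_pow k I J x"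
proof (induction k arbitrary: I J)
  case 0
  show ?case by (auto simp add: beta_pow_0 one_form_def)
next
  case (Suc k)
  have b: "beta J I x = beta I J x" for I J
    unfolding beta_def wedge_dx_dxi by (intro sum.cong) auto
  have "beta_pow (Suc k) J I x = wedge (\<lambda>I J. beta J I) (\<lambda>I J. beta_pow k J I) I J x"
    unfolding beta_pow_Suc
    by (rule wedge_transpose) (use beta_degree beta_pow_degree in fastforce)+
  also have "\<dots> = beta_pow (Suc k) I J x"
    unfolding beta_pow_Suc wedge_def Suc b ..
  finally show ?case .
qed

text \<open>For \<open>k = m - 1\<close> these are the constant forms against which a current of
  bidimension \<open>(m, m)\<close> is paired to read off the coefficients of its product with
  \<open>\<beta>^(m - 1)\<close>.\<close>

definition basis_form :: "nat \<Rightarrow> 'n::{finite,linorder} \<Rightarrow> 'n \<Rightarrow> 'n superform" where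
  "basis_form k i j = wedge (beta_pow k) (wedge (dx i) (dxi j))"

lemma basis_form_const: "basis_form k i j I J x = basis_form k i j I J y"
  unfolding basis_form_def wedge_basis_right using beta_pow_const[of k _ _ x y] by simp

lemma basis_form_transpose: "basis_form k j i J I x = basis_form k i j I J x"
proof -
  have "basis_form k j i J I x
      = wedge (\<lambda>I J. beta_pow k J I) (\<lambda>I J. wedge (dx j) (dxi i) J I) I J x"
    unfolding basis_form_def
    by (rule wedge_transpose) (use beta_pow_degree in \<open>fastforce simp: wedge_dx_dxi split: if_splits\<close>)+
  also have "(\<lambda>I J. wedge (dx j) (dxi i) J I) = wedge (dx i) (dxi j)"
    by (intro ext) (auto simp: wedge_dx_dxi)
  also have "(\<lambda>I J. beta_pow k J I) = beta_pow k"
    by (intro ext) (rule beta_pow_transpose)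
  finally show ?thesis unfolding basis_form_def .
qed

lemma beta_pow_basis: "beta_pow (Suc k) = (\<lambda>I J x. \<Sum>i\<in>UNIV. basis_form k i i I J x)"
proof -
  have "beta_pow (Suc k) = (\<lambda>I J x. 1 * wedge (beta_pow k) beta I J x)"
    unfolding beta_pow_Suc by (rule wedge_commute_parity) (auto dest!: beta_degree)
  then show ?thesis unfolding basis_form_def beta_eq by (simp add: wedge_sum_right)
qed

text \<open>Two routes to the top degree are compared: on the left \<open>dx_k\<close> is put in
  front by \<open>d\<close> and the rest is filled up by a power of \<open>\<beta>\<close>; on the
  right \<open>dx_k \<and> d\<xi>_l\<close> stands last in a basis form. The discrepancy depends on
  \<open>l\<close> alone, so it can be pulled out of the sums over \<open>k\<close>,
  \<open>I\<close> and \<open>J\<close>.\<close>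

lemma exterior_sign:
  assumes "k \<notin> I" "l \<notin> J" "card I = card J"
    and P: "P = - insert k I" and Q: "Q = - insert l J"
  shows "super_sign (insert k I) J P Q * shuffle_sign {k} I
    = shuffle_sign (- {l}) {l} * (super_sign I J (- I) (- J) * super_sign P Q {k} {l})"
proof -
  have c: "- I = P \<union> {k}" "- J = Q \<union> {l}" "insert k I = I \<union> {k}" "- {l} = J \<union> Q"
    using assms by auto
  have d: "I \<inter> {k} = {}" "P \<inter> {k} = {}" "Q \<inter> {l} = {}" "J \<inter> Q = {}"
    using assms by auto
  have card: "card P = card Q" "card (P \<union> {k}) = Suc (card P)"
    unfolding P Q using assms(1-3) by (auto simp: Compl_eq_Diff_UNIV card_Diff_subset)
  note un = shuffle_sign_Un_left[OF d(1)] shuffle_sign_Un_right[OF d(2)]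
    shuffle_sign_Un_right[OF d(3)] shuffle_sign_Un_left[OF d(4)]
  have "(- 1 :: real) ^ card Q * (- 1) ^ card Q = 1"
    by (simp flip: power_mult_distrib)
  moreover have "shuffle_sign J {l} * (shuffle_sign Q {l} * (shuffle_sign J {l} * shuffle_sign Q {l})) = 1"
    using shuffle_sign_square[of J "{l}"] shuffle_sign_square[of Q "{l}"]
    by (simp add: mult.left_commute)
  ultimately show ?thesis
    unfolding c super_sign_def un card
    using shuffle_sign_swap[OF d(1)] shuffle_sign_swap[OF d(2)] assms(3) card(1)
    by (simp add: power_add)
qed

section \<open>Squares of (1,0)-forms and Lagrange's identity\<close>

definition oneform :: "('n::{finite,linorder} \<Rightarrow> real ^ 'n::{finite,linorder} \<Rightarrow> real) \<Rightarrow> 'n superform" where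
  "oneform a = (\<lambda>I J x. \<Sum>k\<in>UNIV. a k x * dx k I J x)"

definition square_form :: "('n::{finite,linorder} \<Rightarrow> real ^ 'n::{finite,linorder} \<Rightarrow> real) \<Rightarrow> 'n superform" where
  "square_form a = wedge (oneform a) (J_op (oneform a))"

lemma J_oneform: "J_op (oneform a) = (\<lambda>I J x. \<Sum>k\<in>UNIV. a k x * dxi k I J x)"
  by (intro ext) (auto simp: J_op_def oneform_def dx_def dxi_def sum_distrib_left intro!: sum.cong)

lemma oneform_degree: "oneform a I J x \<noteq> 0 \<Longrightarrow> card I = 1 \<and> card J = 0"
  unfolding oneform_def dx_def by (auto dest!: sum_nonzeroD split: if_splits)

lemma J_oneform_degree: "J_op (oneform a) I J x \<noteq> 0 \<Longrightarrow> card I = 0 \<and> card J = 1"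
  unfolding J_oneform dxi_def by (auto dest!: sum_nonzeroD split: if_splits)

lemma square_form_degree: "square_form a I J x \<noteq> 0 \<Longrightarrow> card I = 1 \<and> card J = 1"
  using wedge_degree[of "oneform a" x 1 0 "J_op (oneform a)" 0 1 I J,
      OF oneform_degree J_oneform_degree]
  unfolding square_form_def by simp

lemma square_form_eq:
  "square_form a = (\<lambda>I J x. \<Sum>k\<in>UNIV. \<Sum>l\<in>UNIV. a k x * a l x * wedge (dx k) (dxi l) I J x)"
  unfolding square_form_def J_oneform unfolding oneform_def
  by (simp add: wedge_sum_left wedge_sum_right wedge_scale_left wedge_scale_right sum_distrib_left mult_ac)

lemma square_form_commute: "wedge (square_form a) b = wedge b (square_form a)"
proof -
  have "wedge (square_form a) b = (\<lambda>I J x. 1 * wedge b (square_form a) I J x)"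
    by (rule wedge_commute_parity) (auto dest!: square_form_degree)
  then show ?thesis by simp
qed

text \<open>The two factors \<open>a\<close> can be moved next to each other at the cost of a sign,
  and a form of degree 1 has square zero.\<close>

lemma square_form_square: "wedge (square_form a) (square_form a) = (\<lambda>I J x. 0)"
proof -
  let ?a = "oneform a" and ?b = "J_op (oneform a)"
  have "wedge ?a ?a = (\<lambda>I J x. - 1 * wedge ?a ?a I J x)"
    by (rule wedge_commute_parity) (auto dest!: oneform_degree)
  then have aa: "wedge ?a ?a I J x = 0" for I J x
    by (metis (no_types) add.inverse_unique mult_minus1 neg_equal_zero)
  have ba: "wedge ?b ?a = (\<lambda>I J x. - 1 * wedge ?a ?b I J x)"
    by (rule wedge_commute_parity) (auto dest!: oneform_degree J_oneform_degree)
  have "wedge (square_form a) (square_form a) = wedge ?a (wedge (wedge ?b ?a) ?b)"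
    unfolding square_form_def by (simp add: wedge_assoc)
  also have "\<dots> = (\<lambda>I J x. - 1 * wedge ?a (wedge (wedge ?a ?b) ?b) I J x)"
    unfolding ba by (simp only: wedge_scale_left wedge_scale_right)
  also have "wedge ?a (wedge (wedge ?a ?b) ?b) = wedge (wedge ?a ?a) (wedge ?b ?b)"
    by (simp add: wedge_assoc)
  finally show ?thesis by (simp add: wedge_zero_left aa)
qed

definition lagrange_form :: "(real ^ 'n::{finite,linorder} \<Rightarrow> real) \<Rightarrow> ('n::{finite,linorder} \<Rightarrow> real ^ 'n::{finite,linorder} \<Rightarrow> real) \<Rightarrow> 'n superform" where
  "lagrange_form b a = (\<lambda>I J x. b x * beta I J x + - 1 * square_form a I J x)"

text \<open>The binomial expansion of \<open>(b \<beta> - a \<and> a#)^(k + 1)\<close> stops after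
  its linear term, since the square form commutes with every form and has square zero. For
  \<open>k + 1 = m\<close> the coefficient of that term is the \<open>m\<close> of the eigenvalue
  bound.\<close>

lemma lagrange_form_power:
  "wedge_list (replicate (Suc k) (lagrange_form b a)) = (\<lambda>I J x. b x ^ Suc k * beta_pow (Suc k) I J x
      - real (Suc k) * b x ^ k * wedge (beta_pow k) (square_form a) I J x)"
proof (induction k)
  case 0
  show ?case
    by (simp add: wedge_list_def wedge_one_right beta_pow_0 beta_pow_Suc wedge_one_left lagrange_form_def)
next
  case (Suc k)
  let ?A = "square_form a"
  have 1: "wedge beta (wedge (beta_pow k) ?A) = wedge (beta_pow (Suc k)) ?A"
    by (simp add: beta_pow_Suc wedge_assoc)
  have 2: "wedge ?A (wedge (beta_pow k) ?A) = (\<lambda>I J x. 0)"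
    by (metis wedge_assoc square_form_commute square_form_square wedge_zero_right ext)
  have "wedge_list (replicate (Suc (Suc k)) (lagrange_form b a))
      = wedge (lagrange_form b a) (wedge_list (replicate (Suc k) (lagrange_form b a)))"
    by (simp add: wedge_list_def)
  also have "\<dots> = wedge (\<lambda>I J x. b x * beta I J x + - 1 * ?A I J x)
      (\<lambda>I J x. b x ^ Suc k * beta_pow (Suc k) I J x
        + (- real (Suc k) * b x ^ k) * wedge (beta_pow k) ?A I J x)"
    unfolding Suc unfolding lagrange_form_def
    by (intro arg_cong2[where f = wedge] ext refl) (simp add: algebra_simps)
  also have "\<dots> = (\<lambda>I J x. b x * (b x ^ Suc k * wedge beta (beta_pow (Suc k)) I J x
          + (- real (Suc k) * b x ^ k) * wedge beta (wedge (beta_pow k) ?A) I J x)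
        + - 1 * (b x ^ Suc k * wedge ?A (beta_pow (Suc k)) I J x
          + (- real (Suc k) * b x ^ k) * wedge ?A (wedge (beta_pow k) ?A) I J x))"
    by (simp only: wedge_add_left wedge_add_right wedge_scale_left wedge_scale_right distrib_left)
  also have "\<dots> = (\<lambda>I J x. b x ^ Suc (Suc k) * beta_pow (Suc (Suc k)) I J x
      - real (Suc (Suc k)) * b x ^ Suc k * wedge (beta_pow (Suc k)) ?A I J x)"
    unfolding 1 2 square_form_commute[of a "beta_pow (Suc k)"]
    by (intro ext) (simp add: beta_pow_Suc[of "Suc k"] algebra_simps)
  finally show ?case .
qed

lemma sum_rotate:
  "(\<Sum>p\<in>A. \<Sum>k\<in>B. \<Sum>l\<in>C. h k l p) = (\<Sum>k\<in>B. \<Sum>l\<in>C. \<Sum>p\<in>A. h k l p)"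
proof -
  have "(\<Sum>k\<in>B. \<Sum>l\<in>C. \<Sum>p\<in>A. h k l p) = (\<Sum>k\<in>B. \<Sum>p\<in>A. \<Sum>l\<in>C. h k l p)"
    by (intro sum.cong refl sum.swap)
  also have "\<dots> = (\<Sum>p\<in>A. \<Sum>k\<in>B. \<Sum>l\<in>C. h k l p)"
    by (rule sum.swap)
  finally show ?thesis ..
qed

lemma sum_square_form:
  "(\<Sum>p\<in>A. square_form (a p) I J x)
    = (\<Sum>k\<in>UNIV. \<Sum>l\<in>UNIV. (\<Sum>p\<in>A. a p k x * a p l x) * wedge (dx k) (dxi l) I J x)"
  unfolding square_form_eq by (subst sum_rotate) (simp only: sum_distrib_right)

text \<open>The coefficient matrix of \<open>|a|^2 \<beta> - a \<and> a#\<close> is half the sum,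
  over all ordered pairs \<open>(i, j)\<close>, of the squares of \<open>a_i e_j - a_j e_i\<close>;
  hence the factor \<open>1 / sqrt 2\<close>. The remainder \<open>\<rho>^2 \<beta>\<close> splits
  into the squares of \<open>\<rho> dx_j\<close>; it keeps \<open>b\<close> positive where
  \<open>a\<close> vanishes.\<close>

lemma lagrange_identity:
  fixes a :: "'n::{finite,linorder} \<Rightarrow> real ^ 'n::{finite,linorder} \<Rightarrow> real"
  assumes "\<And>x. b x = (\<Sum>k\<in>UNIV. (a k x)\<^sup>2) + \<rho>\<^sup>2"
  shows "lagrange_form b a = (\<lambda>I J x. (\<Sum>p\<in>UNIV. square_form (\<lambda>k x.
        (a (fst p) x * (if k = snd p then 1 else 0) - a (snd p) x * (if k = fst p then 1 else 0)) / sqrt 2) I J x)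
      + (\<Sum>j\<in>UNIV. square_form (\<lambda>k x. \<rho> * (if k = j then 1 else 0)) I J x))"
proof (intro ext)
  fix I J and x :: "real ^ 'n::{finite,linorder}"
  define d :: "'n \<Rightarrow> 'n \<Rightarrow> real" where "d k j = (if k = j then 1 else 0)" for k j
  have dd: "(\<Sum>j\<in>UNIV. d k j * f j) = f k" "(\<Sum>j\<in>UNIV. f j * d k j) = f k" for f k
    unfolding d_def by (auto simp: sum.delta if_distrib if_distribR cong: if_cong)
  let ?e = "\<lambda>k l. wedge (dx k) (dxi l) I J x"
  let ?a = "\<lambda>k. a k x"
  have sym: "d k l = d l k" for k l by (simp add: d_def)
  have 1: "(\<Sum>p\<in>UNIV. (?a (fst p) * d k (snd p) - ?a (snd p) * d k (fst p)) / sqrt 2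
        * ((?a (fst p) * d l (snd p) - ?a (snd p) * d l (fst p)) / sqrt 2))
      = (\<Sum>i\<in>UNIV. (?a i)\<^sup>2) * d k l - ?a k * ?a l" for k l
  proof -
    have "(\<Sum>p\<in>UNIV. (?a (fst p) * d k (snd p) - ?a (snd p) * d k (fst p)) / sqrt 2
        * ((?a (fst p) * d l (snd p) - ?a (snd p) * d l (fst p)) / sqrt 2))
      = (\<Sum>i\<in>UNIV. \<Sum>j\<in>UNIV. (?a i * d k j - ?a j * d k i) / sqrt 2 * ((?a i * d l j - ?a j * d l i) / sqrt 2))"
      by (simp add: UNIV_Times_UNIV[symmetric] sum.cartesian_product split_def del: UNIV_Times_UNIV)
    also have "\<dots> = (\<Sum>i\<in>UNIV. \<Sum>j\<in>UNIV. ((?a i)\<^sup>2 * (d k j * d l j) - (?a i * d l i) * (?a j * d k j)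
        - (?a i * d k i) * (?a j * d l j) + (?a j)\<^sup>2 * (d k i * d l i)) / 2)"
      by (intro sum.cong refl) (simp add: field_simps power2_eq_square)
    also have "\<dots> = ((\<Sum>i\<in>UNIV. (?a i)\<^sup>2) * d k l - ?a l * ?a k - ?a k * ?a l + (\<Sum>j\<in>UNIV. (?a j)\<^sup>2) * d k l) / 2"
      by (simp add: sum_divide_distrib[symmetric] sum.distrib sum_subtractf sum_distrib_left[symmetric]
          sum_distrib_right[symmetric] dd) (simp add: d_def)
    finally show ?thesis by (simp add: field_simps)
  qed
  have "lagrange_form b a I J x = (\<Sum>k\<in>UNIV. \<Sum>l\<in>UNIV. (b x * d k l - ?a k * ?a l) * ?e k l)"
    unfolding lagrange_form_def beta_def square_form_eq
    by (simp add: left_diff_distrib sum_subtractf mult.assoc sum_distrib_left[symmetric] dd)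
  also have "\<dots> = (\<Sum>k\<in>UNIV. \<Sum>l\<in>UNIV. ((\<Sum>p\<in>UNIV. (?a (fst p) * d k (snd p) - ?a (snd p) * d k (fst p)) / sqrt 2
        * ((?a (fst p) * d l (snd p) - ?a (snd p) * d l (fst p)) / sqrt 2)) + (\<Sum>j\<in>UNIV. (\<rho> * d k j) * (\<rho> * d l j))) * ?e k l)"
    unfolding 1 assms
    by (intro sum.cong refl arg_cong2[where f = "(*)"])
      (simp add: algebra_simps power2_eq_square sum_distrib_left[symmetric] dd sym)
  also have "\<dots> = (\<Sum>p\<in>UNIV. square_form (\<lambda>k x.
        (a (fst p) x * d k (snd p) - a (snd p) x * d k (fst p)) / sqrt 2) I J x)
      + (\<Sum>j\<in>UNIV. square_form (\<lambda>k x. \<rho> * d k j) I J x)"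
    unfolding sum_square_form by (simp only: distrib_right sum.distrib)
  finally show "lagrange_form b a I J x = (\<Sum>p\<in>UNIV. square_form (\<lambda>k x.
        (a (fst p) x * (if k = snd p then 1 else 0) - a (snd p) x * (if k = fst p then 1 else 0)) / sqrt 2) I J x)
      + (\<Sum>j\<in>UNIV. square_form (\<lambda>k x. \<rho> * (if k = j then 1 else 0)) I J x)"
    unfolding d_def .
qed

section \<open>Sets of finite Hausdorff measure have capacity zero\<close>

lemma suminf_swap_ennreal:
  fixes f :: "nat \<Rightarrow> nat \<Rightarrow> ennreal"
  shows "(\<Sum>i. \<Sum>j. f i j) = (\<Sum>j. \<Sum>i. f i j)"
  using nn_integral_suminf[of f "count_space UNIV"]
  by (simp add: nn_integral_count_space_nat)

lemma suminf_ge_term_ennreal: "f i \<le> (\<Sum>i. f i :: ennreal)"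
  using sum_le_suminf[OF summableI, of "{i}" f] by simp

lemma suminf_geometric_ennreal: "(\<Sum>i. ennreal (e * (1 / 2) ^ Suc i)) = ennreal e" if "0 \<le> e"
proof -
  have "(\<lambda>i. e * (1 / 2) ^ Suc i) sums e"
    using sums_mult[OF power_half_series, of e] by simp
  then show ?thesis using that by (intro suminf_ennreal_eq) auto
qed

text \<open>Capacity at most \<open>e\<close>, witnessed by a discrete measure with mass
  \<open>W i\<close> at \<open>x i\<close>. Values in \<open>ennreal\<close> admit an infinite
  kernel on the diagonal. The masses sit on \<open>K\<close>, so that their potentials stay under
  control away from \<open>K\<close>; where \<open>W i = 0\<close> the point is arbitrary.\<close>

definition small_potential :: "(real \<Rightarrow> ennreal) \<Rightarrow> 'a::metric_space set \<Rightarrow> 'a set \<Rightarrow> ennreal \<Rightarrow> bool" where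
  "small_potential k K A e \<longleftrightarrow> (\<exists>(x :: nat \<Rightarrow> 'a) (W :: nat \<Rightarrow> ennreal).
     (\<forall>i. W i \<noteq> 0 \<longrightarrow> x i \<in> K) \<and> (\<Sum>i. W i) \<le> e \<and>
     (\<forall>y\<in>A. 1 \<le> (\<Sum>i. W i * k (dist y (x i)))))"

lemma small_potential_empty: "small_potential k K {} e"
  unfolding small_potential_def by (intro exI[of _ undefined] exI[of _ "\<lambda>i. 0"]) simp

lemma small_potential_mono:
  assumes "small_potential k K A e" "A' \<subseteq> A" "e \<le> e'" "\<And>d. 0 \<le> d \<Longrightarrow> k d \<le> k' d"
  shows "small_potential k' K A' e'"
proof -
  obtain x W where xW: "\<forall>i. W i \<noteq> 0 \<longrightarrow> x i \<in> K" "(\<Sum>i. W i) \<le> e"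
      "\<forall>y\<in>A. 1 \<le> (\<Sum>i. W i * k (dist y (x i)))"
    using assms(1) unfolding small_potential_def by blast
  have le: "(\<Sum>i. W i * k (dist y (x i))) \<le> (\<Sum>i. W i * k' (dist y (x i)))" for y
    by (intro suminf_le summableI mult_left_mono assms(4)) auto
  have "1 \<le> (\<Sum>i. W i * k' (dist y (x i)))" if "y \<in> A'" for y
    using xW(3) assms(2) that order_trans[OF _ le] by blast
  then show ?thesis
    unfolding small_potential_def using xW(1) order_trans[OF xW(2) assms(3)]
    by (intro exI[of _ x] exI[of _ W]) auto
qed

text \<open>Countable subadditivity: the discrete measures are superposed, and the pairing function
  turns the double sequence of masses into one sequence.\<close>

lemma small_potential_UN:
  assumes "\<And>j. small_potential k K (A j) (e j)" "(\<Sum>j. e j) \<le> e'"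
  shows "small_potential k K (\<Union>j::nat. A j) e'"
proof -
  have "\<forall>j. \<exists>(x :: nat \<Rightarrow> 'a) (W :: nat \<Rightarrow> ennreal).
     (\<forall>i. W i \<noteq> 0 \<longrightarrow> x i \<in> K) \<and> (\<Sum>i. W i) \<le> e j \<and>
     (\<forall>y\<in>A j. 1 \<le> (\<Sum>i. W i * k (dist y (x i))))"
    using assms(1) unfolding small_potential_def by blast
  then obtain x :: "nat \<Rightarrow> nat \<Rightarrow> 'a" and W where
    xW: "\<And>j i. W j i \<noteq> 0 \<Longrightarrow> x j i \<in> K" "\<And>j. (\<Sum>i. W j i) \<le> e j"
      "\<And>j y. y \<in> A j \<Longrightarrow> 1 \<le> (\<Sum>i. W j i * k (dist y (x j i)))"
    by metis
  define X where "X p = (case prod_decode p of (j, i) \<Rightarrow> x j i)" for p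
  define V where "V p = (case prod_decode p of (j, i) \<Rightarrow> W j i)" for p
  have "(\<Sum>p. V p) = (\<Sum>j. \<Sum>i. W j i)"
    unfolding V_def by (rule suminf_ennreal_2dimen) simp
  also have "\<dots> \<le> (\<Sum>j. e j)" by (intro suminf_le summableI xW)
  finally have mass: "(\<Sum>p. V p) \<le> e'" using assms(2) by simp
  have "1 \<le> (\<Sum>p. V p * k (dist y (X p)))" if "y \<in> A j" for y j
  proof -
    have "1 \<le> (\<Sum>i. W j i * k (dist y (x j i)))" using xW(3) that .
    also have "\<dots> \<le> (\<Sum>j. \<Sum>i. W j i * k (dist y (x j i)))"
      by (rule suminf_ge_term_ennreal)
    also have "\<dots> = (\<Sum>p. case prod_decode p of (j, i) \<Rightarrow> W j i * k (dist y (x j i)))"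
      by (rule suminf_ennreal_2dimen[symmetric]) simp
    also have "\<dots> = (\<Sum>p. V p * k (dist y (X p)))"
      by (intro suminf_cong) (simp add: V_def X_def split: prod.split)
    finally show ?thesis .
  qed
  moreover have "\<forall>p. V p \<noteq> 0 \<longrightarrow> X p \<in> K"
    using xW(1) by (auto simp: V_def X_def split: prod.splits)
  ultimately show ?thesis
    unfolding small_potential_def using mass by (intro exI[of _ X] exI[of _ V]) auto
qed

text \<open>Inversion in \<open>ennreal\<close> gives the value \<open>\<infinity>\<close> at
  distance 0 for \<open>s \<ge> 1\<close>, so a positive mass has infinite potential at its own
  place.\<close>

definition riesz :: "nat \<Rightarrow> real \<Rightarrow> ennreal" where
  "riesz s d = inverse (ennreal d ^ s)"

lemma riesz_0: "s \<ge> 1 \<Longrightarrow> riesz s 0 = \<infinity>"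
  by (simp add: riesz_def)

lemma riesz_pos: "d > 0 \<Longrightarrow> riesz s d = ennreal (1 / d ^ s)"
  by (simp add: riesz_def ennreal_power inverse_ennreal inverse_eq_divide)

text \<open>A mass \<open>r i ^ s\<close> is placed at a point of \<open>C i \<inter> A\<close>. Any
  \<open>y\<close> in \<open>A\<close> lies in some \<open>C i\<close> with
  \<open>i \<in> I\<close>, within distance \<open>r i\<close> of that point, so this single mass
  already has potential at least 1 at \<open>y\<close>.\<close>

lemma small_potential_balls:
  fixes C :: "nat \<Rightarrow> 'a::metric_space set"
  assumes s: "s \<ge> 1" and C: "\<And>i. bounded (C i)" "\<And>i. diameter (C i) \<le> r i" "\<And>i. 0 < r i"
    and A: "A \<subseteq> K" "A \<subseteq> (\<Union>i\<in>I. C i)"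
    and e: "(\<Sum>i. if i \<in> I then ennreal (r i ^ s) else 0) \<le> e"
  shows "small_potential (riesz s) K A e"
proof -
  define W where "W i = (if i \<in> I \<and> C i \<inter> A \<noteq> {} then ennreal (r i ^ s) else 0)" for i
  define x where "x i = (SOME x. x \<in> C i \<inter> A)" for i
  have x: "x i \<in> C i \<inter> A" if "C i \<inter> A \<noteq> {}" for i
    unfolding x_def using that by (metis ex_in_conv someI_ex)
  show ?thesis unfolding small_potential_def
  proof (intro exI[of _ x] exI[of _ W] conjI allI impI ballI)
    show "x i \<in> K" if "W i \<noteq> 0" for i using that x[of i] A(1) by (auto simp: W_def split: if_splits)
    have "(\<Sum>i. W i) \<le> (\<Sum>i. if i \<in> I then ennreal (r i ^ s) else 0)"
      by (intro suminf_le summableI) (simp add: W_def)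
    then show "(\<Sum>i. W i) \<le> e" using e by simp
    fix y assume y: "y \<in> A"
    then obtain i where i: "i \<in> I" "y \<in> C i" using A(2) by auto
    then have xi: "x i \<in> C i" and Wi: "W i = ennreal (r i ^ s)" using x[of i] y by (auto simp: W_def)
    have d: "dist y (x i) \<le> r i"
      using diameter_bounded_bound[OF C(1) i(2) xi] C(2)[of i] by simp
    have "1 \<le> W i * riesz s (dist y (x i))"
    proof (cases "dist y (x i) = 0")
      case True
      then show ?thesis
        using riesz_0[OF s] C(3)[of i] by (simp add: Wi ennreal_mult_top)
    next
      case False
      then have p: "0 < dist y (x i)" using zero_le_dist[of y "x i"] by linarith
      have "1 \<le> r i ^ s * (1 / dist y (x i) ^ s)"
        using power_mono[OF d, of s] p by (simp add: field_simps)
      then show ?thesis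
        unfolding Wi riesz_pos[OF p] using C(3)[of i] p
        by (simp add: ennreal_mult[symmetric] ennreal_1[symmetric] del: ennreal_1)
    qed
    also have "\<dots> \<le> (\<Sum>i. W i * riesz s (dist y (x i)))" by (rule suminf_ge_term_ennreal)
    finally show "1 \<le> (\<Sum>i. W i * riesz s (dist y (x i)))" .
  qed
qed

section \<open>Covers that nearly realise the Hausdorff content\<close>

lemma hausdorff_size_le:
  assumes "diameter C \<le> r" "0 \<le> r" "bounded C"
  shows "hausdorff_size s C \<le> ennreal (r ^ s)"
  unfolding hausdorff_size_def using assms diameter_ge_0[OF assms(3)]
  by (auto intro!: ennreal_leI power_mono)

lemma hausdorff_content_le_two:
  assumes "A \<subseteq> (\<Union>i. C i) \<union> (\<Union>i. C' i)" and "0 \<le> \<delta>"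
    and "\<And>i. bounded (C i) \<and> diameter (C i) \<le> \<delta>" "\<And>i. bounded (C' i) \<and> diameter (C' i) \<le> \<delta>"
  shows "hausdorff_content s \<delta> A \<le> (\<Sum>i. hausdorff_size s (C i)) + (\<Sum>i. hausdorff_size s (C' i))"
proof -
  \<comment> \<open>Row 0 is the first cover, row 1 the second, all other rows are empty; the
    pairing function merges them into a single cover.\<close>
  define E where "E j i = (if j = 0 then C i else if j = 1 then C' i else {})" for j i :: nat
  define D where "D p = (case prod_decode p of (j, i) \<Rightarrow> E j i)" for p
  have "A \<subseteq> (\<Union>p. D p)"
  proof
    fix a assume "a \<in> A"
    then obtain i where "a \<in> C i \<or> a \<in> C' i" using assms(1) by blast
    then have "a \<in> E 0 i \<or> a \<in> E 1 i" by (simp add: E_def)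
    then have "a \<in> D (prod_encode (0, i)) \<or> a \<in> D (prod_encode (1, i))" by (simp add: D_def)
    then show "a \<in> (\<Union>p. D p)" by blast
  qed
  moreover have "\<forall>p. bounded (D p) \<and> diameter (D p) \<le> \<delta>"
    using assms(2-4) by (auto simp: D_def E_def split: prod.split)
  ultimately have "hausdorff_content s \<delta> A \<le> (\<Sum>p. hausdorff_size s (D p))"
    unfolding hausdorff_content_def by (intro INF_lower) auto
  also have "\<dots> = (\<Sum>p. case prod_decode p of (j, i) \<Rightarrow> hausdorff_size s (E j i))"
    by (intro suminf_cong) (simp add: D_def split: prod.split)
  also have "\<dots> = (\<Sum>j. \<Sum>i. hausdorff_size s (E j i))"
    by (rule suminf_ennreal_2dimen) simp
  also have "\<dots> = (\<Sum>j\<in>{0, 1}. \<Sum>i. hausdorff_size s (E j i))"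
    by (rule suminf_finite) (auto simp: E_def hausdorff_size_def)
  finally show ?thesis by (simp add: E_def)
qed

text \<open>A cover that is optimal up to \<open>e\<close>. Its radii may exceed the diameters
  because they have to be positive: sets of diameter 0 may occur, and powers of \<open>r i\<close>
  will be divided by.\<close>

definition nice_cover ::
  "nat \<Rightarrow> 'a::metric_space set \<Rightarrow> real \<Rightarrow> real \<Rightarrow> (nat \<Rightarrow> 'a set) \<Rightarrow> (nat \<Rightarrow> real) \<Rightarrow> bool" where
  "nice_cover s A e \<delta> C r \<longleftrightarrow> A \<subseteq> (\<Union>i. C i) \<and>
     (\<forall>i. bounded (C i) \<and> diameter (C i) \<le> \<delta> \<and> diameter (C i) \<le> r i \<and> 0 < r i \<and> r i \<le> 2 * \<delta>) \<and>
     (\<Sum>i. ennreal (r i ^ s)) \<le> hausdorff_content s \<delta> A + ennreal e"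

lemma nice_cover_exists:
  assumes s: "s \<ge> 1" and \<delta>: "0 < \<delta>" and e: "0 < e" and fin: "hausdorff_content s \<delta> A < \<infinity>"
  shows "\<exists>C r. nice_cover s A e \<delta> C r"
proof -
  let ?h = "hausdorff_content s \<delta> A"
  have "?h < ?h + ennreal (e / 2)"
    using fin e by (cases ?h) (simp_all add: ennreal_less_iff flip: ennreal_plus)
  then obtain C where C: "A \<subseteq> (\<Union>i. C i)" "\<And>i. bounded (C i) \<and> diameter (C i) \<le> \<delta>"
    "(\<Sum>i. hausdorff_size s (C i)) < ?h + ennreal (e / 2)"
    unfolding hausdorff_content_def[of s \<delta> A] INF_less_iff by blast
  \<comment> \<open>By continuity of the power, each diameter can be raised to a positive radius at
    a cost of \<open>e / 2 * (1 / 2) ^ Suc i\<close>; these costs sum to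
    \<open>e / 2\<close>.\<close>
  have "\<exists>r. diameter (C i) < r \<and> r \<le> 2 * \<delta> \<and> r ^ s \<le> diameter (C i) ^ s + e / 2 * (1 / 2) ^ Suc i" for i
  proof -
    let ?d = "diameter (C i)"
    have d: "?d < 2 * \<delta>" using C(2)[of i] \<delta> by simp
    have "((\<lambda>r. r ^ s) \<longlongrightarrow> ?d ^ s) (at_right ?d)" by (intro tendsto_intros)
    then have "\<forall>\<^sub>F r in at_right ?d. r ^ s < ?d ^ s + e / 2 * (1 / 2) ^ Suc i"
      by (rule order_tendstoD) (use e in simp)
    moreover have "\<forall>\<^sub>F r in at_right ?d. ?d < r \<and> r < 2 * \<delta>"
      unfolding eventually_at_right_field using d by blast
    ultimately have "\<forall>\<^sub>F r in at_right ?d. r ^ s < ?d ^ s + e / 2 * (1 / 2) ^ Suc i \<and> ?d < r \<and> r < 2 * \<delta>"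
      by eventually_elim simp
    then obtain r where "r ^ s < ?d ^ s + e / 2 * (1 / 2) ^ Suc i \<and> ?d < r \<and> r < 2 * \<delta>"
      using eventually_happens[of _ "at_right ?d"] trivial_limit_at_right_real by blast
    then show ?thesis by (intro exI[of _ r]) auto
  qed
  then obtain r where r: "\<And>i. diameter (C i) < r i" "\<And>i. r i \<le> 2 * \<delta>"
    "\<And>i. r i ^ s \<le> diameter (C i) ^ s + e / 2 * (1 / 2) ^ Suc i" by metis
  have d0: "0 \<le> diameter (C i)" for i using C(2) diameter_ge_0 by blast
  have size: "hausdorff_size s (C i) = ennreal (diameter (C i) ^ s)" for i
    using s by (simp add: hausdorff_size_def)
  have "(\<Sum>i. ennreal (r i ^ s)) \<le> (\<Sum>i. hausdorff_size s (C i) + ennreal (e / 2 * (1 / 2) ^ Suc i))"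
    using r(3) d0 e by (intro suminf_le summableI) (simp add: size ennreal_plus[symmetric] del: ennreal_plus)
  also have "\<dots> = (\<Sum>i. hausdorff_size s (C i)) + (\<Sum>i. ennreal (e / 2 * (1 / 2) ^ Suc i))"
    by (rule suminf_add[symmetric]) (rule summableI)+
  also have "\<dots> = (\<Sum>i. hausdorff_size s (C i)) + ennreal (e / 2)"
    using e by (subst suminf_geometric_ennreal) auto
  also have "\<dots> \<le> ?h + ennreal (e / 2) + ennreal (e / 2)"
    using C(3) by (intro add_right_mono less_imp_le)
  also have "\<dots> = ?h + ennreal e"
    using e by (simp add: add.assoc flip: ennreal_plus)
  finally have "nice_cover s A e \<delta> C r"
    unfolding nice_cover_def using C r le_less_trans[OF d0 r(1)] by (auto intro: less_imp_le)
  then show ?thesis by blast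
qed

text \<open>Replacing the sets of a near-optimal cover around which a finer cover is too thin gives a
  competing cover, so these bad sets carry little content.\<close>

lemma bad_sets_small:
  fixes A :: "'a::metric_space set"
  assumes C: "nice_cover s A e \<delta> C r" and C': "nice_cover s A e' \<delta>' C' r'" and \<delta>: "\<delta>' \<le> \<delta>"
    and fin: "hausdorff_content s \<delta> A < \<infinity>" and e: "0 < e"
    and B: "B = {i. (\<Sum>i'. if C' i' \<inter> C i \<inter> A \<noteq> {} then ennreal (r' i' ^ s) else 0) < ennreal (r i ^ s / 2)}"
  shows "(\<Sum>i. if i \<in> B then ennreal (r i ^ s) else 0) \<le> ennreal (2 * e)"
proof -
  note C = C[unfolded nice_cover_def] and C' = C'[unfolded nice_cover_def]
  define X where "X = (\<Sum>i. if i \<in> B then 0 else ennreal (r i ^ s))"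
  define Y where "Y = (\<Sum>i. if i \<in> B then ennreal (r i ^ s) else 0)"
  have "X + Y = (\<Sum>i. (if i \<in> B then 0 else ennreal (r i ^ s)) + (if i \<in> B then ennreal (r i ^ s) else 0))"
    unfolding X_def Y_def by (rule suminf_add) (rule summableI)+
  also have "\<dots> = (\<Sum>i. ennreal (r i ^ s))" by (intro suminf_cong) simp
  finally have XY: "X + Y \<le> hausdorff_content s \<delta> A + ennreal e" using C by simp
  \<comment> \<open>The competing cover keeps the sets outside \<open>B\<close> and replaces each
    bad set by the finer sets that meet it inside \<open>A\<close>.\<close>
  define D where "D i = (if i \<in> B then {} else C i)" for i
  define D' where "D' i' = (if \<exists>i\<in>B. C' i' \<inter> C i \<inter> A \<noteq> {} then C' i' else {})" for i'
  have size_empty: "hausdorff_size s ({} :: 'a set) = 0" by (simp add: hausdorff_size_def)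
  have \<delta>0: "0 \<le> \<delta>" using C diameter_ge_0[of "C 0"] by (meson order_trans)
  have "hausdorff_content s \<delta> A \<le> (\<Sum>i. hausdorff_size s (D i)) + (\<Sum>i. hausdorff_size s (D' i))"
  proof (rule hausdorff_content_le_two[OF _ \<delta>0])
    show "A \<subseteq> (\<Union>i. D i) \<union> (\<Union>i. D' i)"
    proof
      fix a assume a: "a \<in> A"
      obtain i where i: "a \<in> C i" using C a by blast
      obtain i' where i': "a \<in> C' i'" using C' a by blast
      show "a \<in> (\<Union>i. D i) \<union> (\<Union>i. D' i)"
      proof (cases "i \<in> B")
        case True
        then have "a \<in> D' i'" using i i' a by (auto simp: D'_def)
        then show ?thesis by blast
      next
        case False
        then have "a \<in> D i" using i by (simp add: D_def)
        then show ?thesis by blast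
      qed
    qed
    show "bounded (D i) \<and> diameter (D i) \<le> \<delta>" for i using C \<delta>0 by (simp add: D_def)
    show "bounded (D' i) \<and> diameter (D' i) \<le> \<delta>" for i
      using C' \<delta> \<delta>0 by (auto simp: D'_def intro: order_trans)
  qed
  also have "(\<Sum>i. hausdorff_size s (D i)) \<le> X"
    unfolding X_def
  proof (intro suminf_le summableI)
    fix i
    show "hausdorff_size s (D i) \<le> (if i \<in> B then 0 else ennreal (r i ^ s))"
      using C hausdorff_size_le[of "C i" "r i" s] size_empty by (simp add: D_def less_imp_le)
  qed
  also have "(\<Sum>i'. hausdorff_size s (D' i')) \<le> Y / 2"
  proof -
    have "(\<Sum>i'. hausdorff_size s (D' i'))
      \<le> (\<Sum>i'. \<Sum>i. if i \<in> B \<and> C' i' \<inter> C i \<inter> A \<noteq> {} then ennreal (r' i' ^ s) else 0)"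
    proof (intro suminf_le summableI)
      fix i'
      show "hausdorff_size s (D' i')
        \<le> (\<Sum>i. if i \<in> B \<and> C' i' \<inter> C i \<inter> A \<noteq> {} then ennreal (r' i' ^ s) else 0)"
      proof (cases "\<exists>i\<in>B. C' i' \<inter> C i \<inter> A \<noteq> {}")
        case True
        then obtain i where i: "i \<in> B \<and> C' i' \<inter> C i \<inter> A \<noteq> {}" by blast
        have "hausdorff_size s (D' i') \<le> ennreal (r' i' ^ s)"
          using C' hausdorff_size_le[of "C' i'" "r' i'" s] True by (simp add: D'_def less_imp_le)
        then show ?thesis
          using i suminf_ge_term_ennreal[of "\<lambda>i. if i \<in> B \<and> C' i' \<inter> C i \<inter> A \<noteq> {} then ennreal (r' i' ^ s) else 0" i]
          by (auto intro: order_trans)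
      qed (simp add: D'_def hausdorff_size_def)
    qed
    also have "\<dots> = (\<Sum>i. \<Sum>i'. if i \<in> B \<and> C' i' \<inter> C i \<inter> A \<noteq> {} then ennreal (r' i' ^ s) else 0)"
      by (rule suminf_swap_ennreal)
    \<comment> \<open>By the definition of \<open>B\<close>, the finer sets around a bad set weigh
      less than half of it.\<close>
    also have "\<dots> \<le> (\<Sum>i. (if i \<in> B then ennreal (r i ^ s) else 0) / 2)"
    proof (intro suminf_le summableI)
      fix i
      show "(\<Sum>i'. if i \<in> B \<and> C' i' \<inter> C i \<inter> A \<noteq> {} then ennreal (r' i' ^ s) else 0)
        \<le> (if i \<in> B then ennreal (r i ^ s) else 0) / 2"
      proof (cases "i \<in> B")
        case True
        have "ennreal (r i ^ s / 2) = ennreal (r i ^ s) / 2"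
          using C by (simp add: divide_ennreal[symmetric] less_imp_le)
        then show ?thesis using True unfolding B by (simp add: less_imp_le)
      qed simp
    qed
    also have "\<dots> = Y / 2" unfolding Y_def by simp
    finally show ?thesis .
  qed
  finally have h: "hausdorff_content s \<delta> A \<le> X + Y / 2"
    by (simp add: add_mono)
  \<comment> \<open>\<open>X + Y \<le> content + e\<close> and
    \<open>content \<le> X + Y / 2\<close> give \<open>Y \<le> 2 e\<close>; finiteness allows
    \<open>X\<close> to be cancelled.\<close>
  have XYf: "X + Y < \<infinity>" using XY fin by (auto simp: less_top[symmetric] top_unique)
  then obtain x where x: "X = ennreal x" "0 \<le> x" by (cases X) auto
  from XYf obtain y where y: "Y = ennreal y" "0 \<le> y" by (cases Y) auto
  from XY h have "X + Y \<le> X + Y / 2 + ennreal e" by (meson add_right_mono order_trans)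
  then have "ennreal (x + y) \<le> ennreal (x + y / 2 + e)"
    using x y e by (simp add: divide_ennreal[symmetric])
  then have "y \<le> 2 * e" using x y e by (subst (asm) ennreal_le_iff) auto
  then show ?thesis using y by (simp add: Y_def[symmetric] ennreal_leI)
qed

text \<open>As the radii at least halve and \<open>s \<ge> 1\<close>, the terms
  \<open>1 / R j ^ s\<close> at least double, so the sum over the scales with
  \<open>R j \<ge> d / 2\<close> is at most twice its finest term. The bound does not involve
  \<open>N\<close>: a single kernel \<open>1 / d ^ s\<close> pays for all scales.\<close>

lemma dyadic_scale_sum:
  fixes R :: "nat \<Rightarrow> real"
  assumes s: "s \<ge> 1" and R: "\<And>j. j < N \<Longrightarrow> 0 < R j" "\<And>j. Suc j < N \<Longrightarrow> R (Suc j) \<le> R j / 2"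
    and d: "0 < d"
  shows "(\<Sum>j<N. if d \<le> 2 * R j then 1 / R j ^ s else 0) \<le> 2 ^ Suc s * (1 / d ^ s)"
  using R
proof (induction N)
  case 0
  then show ?case using d by simp
next
  case (Suc N)
  have geom: "j < Suc N \<Longrightarrow> (\<Sum>i\<le>j. 1 / R i ^ s) \<le> 2 * (1 / R j ^ s)" for j
  proof (induction j)
    case 0
    then show ?case using Suc.prems(1)[of 0] by (auto intro!: divide_right_mono)
  next
    case (Suc j)
    have p: "0 < R (Suc j)" "0 < R j" using Suc.prems Suc.prems(1) \<open>\<And>j. j < Suc N \<Longrightarrow> 0 < R j\<close> by auto
    have "2 * R (Suc j) ^ s \<le> 2 ^ s * R (Suc j) ^ s"
      using p power_increasing[OF s, of "2::real"] by (intro mult_right_mono) auto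
    also have "\<dots> = (2 * R (Suc j)) ^ s" by (simp add: power_mult_distrib)
    also have "\<dots> \<le> R j ^ s"
      using \<open>\<And>j. Suc j < Suc N \<Longrightarrow> R (Suc j) \<le> R j / 2\<close>[of j] Suc.prems p by (intro power_mono) auto
    finally have "2 * (1 / R j ^ s) \<le> 1 / R (Suc j) ^ s"
      using p by (simp add: field_simps)
    then show ?case using Suc by simp
  qed
  show ?case
  proof (cases "d \<le> 2 * R N")
    case True
    have p: "0 < R N" using Suc.prems by simp
    have "(\<Sum>j<Suc N. if d \<le> 2 * R j then 1 / R j ^ s else 0) \<le> (\<Sum>j\<le>N. 1 / R j ^ s)"
      unfolding lessThan_Suc_atMost using Suc.prems(1) by (intro sum_mono) (auto simp: less_imp_le)
    also have "\<dots> \<le> 2 * (1 / R N ^ s)" by (rule geom) simp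
    also have "1 / R N ^ s \<le> 2 ^ s * (1 / d ^ s)"
    proof -
      have "d ^ s \<le> (2 * R N) ^ s" using True d by (intro power_mono) auto
      then show ?thesis using p d by (simp add: power_mult_distrib field_simps)
    qed
    finally show ?thesis by simp
  next
    case False
    then show ?thesis using Suc by simp
  qed
qed

text \<open>Take successively finer covers. At a point outside the bad sets, each of
  \<open>N\<close> scales finds mass at least \<open>R j ^ s / 2\<close> of the finest cover within
  distance \<open>2 * R j\<close>, hence contributes \<open>1 / 2\<close>. By
  \<open>dyadic_scale_sum\<close> all contributions fit under the one kernel, so the potential of
  the finest cover is at least \<open>N / 2 ^ (s + 2)\<close>, while its mass is at most
  \<open>M + 1\<close>. Dividing by that factor makes the mass small; the bad sets are treated by
  \<open>small_potential_balls\<close>.\<close>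

lemma finite_hausdorff_small_potential:
  fixes A :: "'a::metric_space set"
  assumes s: "s \<ge> 1" and fin: "hausdorff_measure s A < \<infinity>" and AK: "A \<subseteq> K" and eps: "0 < \<epsilon>"
  shows "small_potential (riesz s) K A (ennreal \<epsilon>)"
proof -
  obtain M where M: "hausdorff_measure s A = ennreal M" "0 \<le> M" using fin by (cases "hausdorff_measure s A") auto
  have content: "hausdorff_content s \<delta> A \<le> ennreal M" if "0 < \<delta>" for \<delta>
    unfolding M(1)[symmetric] hausdorff_measure_def using that by (intro SUP_upper) simp
  have contentf: "hausdorff_content s \<delta> A < \<infinity>" if "0 < \<delta>" for \<delta>
    by (rule le_less_trans[OF content[OF that]]) simp
  \<comment> \<open>Large enough for the rescaled mass \<open>2 ^ (s + 2) * (M + 1) / N\<close> to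
    be at most \<open>\<epsilon> / 2\<close>.\<close>
  obtain N where N: "2 ^ (s + 2) * (M + 1) * 2 / \<epsilon> < real N" using reals_Archimedean2 by blast
  have N0: "0 < N"
  proof (rule ccontr)
    assume "\<not> 0 < N"
    then have "2 ^ (s + 2) * (M + 1) * 2 / \<epsilon> < 0" using N by simp
    moreover have "0 \<le> 2 ^ (s + 2) * (M + 1) * 2 / \<epsilon>" using M eps by simp
    ultimately show False by simp
  qed
  \<comment> \<open>The \<open>N\<close> bad sets cost \<open>3 * e\<close> each, together at most
    \<open>\<epsilon> / 2\<close>; the bound 1 keeps the mass of the finest cover at most
    \<open>M + 1\<close>.\<close>
  define e where "e = min 1 (\<epsilon> / (6 * real N))"
  have e: "0 < e" "e \<le> 1" using eps N0 by (auto simp: e_def)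
  have e': "real N * (3 * e) \<le> \<epsilon> / 2"
  proof -
    have "real N * (3 * e) \<le> real N * (3 * (\<epsilon> / (6 * real N)))"
      unfolding e_def by (intro mult_left_mono) auto
    then show ?thesis using N0 by simp
  qed
  \<comment> \<open>The number \<open>n\<close> cuts off a tail of total weight at most
    \<open>e\<close>. The tail is counted as bad, so only finitely many radii have to dominate the
    next scale.\<close>
  define good :: "real \<times> (nat \<Rightarrow> 'a set) \<times> (nat \<Rightarrow> real) \<times> nat \<Rightarrow> bool" where
    "good = (\<lambda>(\<delta>, C, r, n). 0 < \<delta> \<and> nice_cover s A e \<delta> C r
      \<and> (\<Sum>i. if i \<in> {n..} then ennreal (r i ^ s) else 0) \<le> ennreal e)" for C
  have ex: "\<exists>C r n. good (\<delta>, C, r, n)" if \<delta>: "0 < \<delta>" for \<delta>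
  proof -
    obtain C r where C: "nice_cover s A e \<delta> C r"
      using nice_cover_exists[OF s \<delta> e(1) contentf[OF \<delta>]] by blast
    have r0: "0 < r i" for i using C unfolding nice_cover_def by blast
    have "(\<Sum>i. ennreal (r i ^ s)) \<noteq> top"
      using C contentf[OF \<delta>] unfolding nice_cover_def
      by (metis ennreal_add_eq_top ennreal_neq_top infinity_ennreal_def less_irrefl top.extremum_unique)
    then have sm: "summable (\<lambda>i. r i ^ s)"
      using r0 by (intro summable_suminf_not_top) (auto simp: less_imp_le)
    obtain n where n: "norm (\<Sum>i. r (i + n) ^ s) < e"
      using suminf_exist_split[OF e(1) sm] by blast
    have "(\<Sum>i. if i \<in> {n..} then ennreal (r i ^ s) else 0)
      = (\<Sum>i. if i + n \<in> {n..} then ennreal (r (i + n) ^ s) else 0)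
        + (\<Sum>i<n. if i \<in> {n..} then ennreal (r i ^ s) else 0)"
      by (rule suminf_offset) (rule summableI)
    also have "\<dots> = (\<Sum>i. ennreal (r (i + n) ^ s))" by simp
    also have "\<dots> = ennreal (\<Sum>i. r (i + n) ^ s)"
      using r0 summable_ignore_initial_segment[OF sm, of n]
      by (intro suminf_ennreal2) (auto simp: less_imp_le)
    also have "\<dots> \<le> ennreal e" using n by (intro ennreal_leI) simp
    finally show ?thesis using C \<delta> unfolding good_def by auto
  qed
  define finer :: "real \<times> (nat \<Rightarrow> 'a set) \<times> (nat \<Rightarrow> real) \<times> nat \<Rightarrow> real \<times> (nat \<Rightarrow> 'a set) \<times> (nat \<Rightarrow> real) \<times> nat \<Rightarrow> bool"
    where "finer = (\<lambda>(\<delta>, C, r, n) (\<delta>', C', r', n'). \<delta>' \<le> \<delta> \<and> (\<forall>i<n. 4 * \<delta>' \<le> r i))"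
  have "\<exists>f. \<forall>n. good (f n) \<and> finer (f n) (f (Suc n))"
  proof (rule dependent_nat_choice)
    show "\<exists>x. good x" using ex[of 1] by auto
    fix x and k :: nat assume x: "good x"
    obtain \<delta> C r n where xx: "x = (\<delta>, C, r, n)" by (cases x) auto
    \<comment> \<open>The radii of the next cover are at most \<open>2 * \<delta>'\<close>, hence at
      most half of each \<open>r i\<close> with \<open>i < n\<close>.\<close>
    define \<delta>' where "\<delta>' = Min (insert \<delta> ((\<lambda>i. r i / 4) ` {..<n}))"
    have "0 < \<delta>'" using x unfolding \<delta>'_def xx good_def nice_cover_def by auto
    then obtain C' r' n' where "good (\<delta>', C', r', n')" using ex by blast
    moreover have "\<delta>' \<le> \<delta>" unfolding \<delta>'_def by (intro Min_le) auto
    moreover have "\<delta>' \<le> r i / 4" if "i < n" for i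
      unfolding \<delta>'_def using that by (intro Min_le) auto
    then have "\<forall>i<n. 4 * \<delta>' \<le> r i" by fastforce
    ultimately show "\<exists>y. good y \<and> finer x y"
      unfolding xx finer_def by (intro exI[of _ "(\<delta>', C', r', n')"]) simp
  qed
  then obtain f where f: "\<And>j. good (f j)" "\<And>j. finer (f j) (f (Suc j))" by blast
  define \<delta> where "\<delta> j = fst (f j)" for j
  define C where "C j = fst (snd (f j))" for j
  define r where "r j = fst (snd (snd (f j)))" for j
  define n where "n j = snd (snd (snd (f j)))" for j
  have fj: "f j = (\<delta> j, C j, r j, n j)" for j by (simp add: \<delta>_def C_def r_def n_def)
  have \<delta>0: "0 < \<delta> j" and cov: "nice_cover s A e (\<delta> j) (C j) (r j)"
    and tail: "(\<Sum>i. if i \<in> {n j..} then ennreal (r j i ^ s) else 0) \<le> ennreal e" for j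
    using f(1)[of j] unfolding fj good_def by auto
  have step: "\<delta> (Suc j) \<le> \<delta> j" "i < n j \<Longrightarrow> 4 * \<delta> (Suc j) \<le> r j i" for i j
    using f(2)[of j] unfolding fj finer_def by auto
  have dec: "\<delta> j' \<le> \<delta> j" if "j \<le> j'" for j j'
    using that by (induction rule: dec_induct) (use step(1) order_trans in blast)+
  note cov' = cov[unfolded nice_cover_def]
  have r0: "0 < r j i" and r2: "r j i \<le> 2 * \<delta> j" and bd: "bounded (C j i)"
    and dm: "diameter (C j i) \<le> r j i" for i j
    using cov'[of j] by auto
  \<comment> \<open>An index is bad if the finest cover is too thin around its set, which by
    \<open>bad_sets_small\<close> costs \<open>2 * e\<close>, or if it lies in the tail, which costs
    \<open>e\<close>.\<close>
  define B where "B j = {i. (\<Sum>i'. if C N i' \<inter> C j i \<inter> A \<noteq> {} then ennreal (r N i' ^ s) else 0)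
      < ennreal (r j i ^ s / 2)} \<union> {n j..}" for j
  define bad where "bad j = A \<inter> (\<Union>i\<in>B j. C j i)" for j
  have bad: "small_potential (riesz s) K (bad j) (ennreal (3 * e))" if j: "j < N" for j
  proof (rule small_potential_balls[OF s bd dm r0])
    show "bad j \<subseteq> K" "bad j \<subseteq> (\<Union>i\<in>B j. C j i)" using AK by (auto simp: bad_def)
    define B' where "B' = {i. (\<Sum>i'. if C N i' \<inter> C j i \<inter> A \<noteq> {} then ennreal (r N i' ^ s) else 0)
      < ennreal (r j i ^ s / 2)}"
    have "(\<Sum>i. if i \<in> B j then ennreal (r j i ^ s) else 0)
      \<le> (\<Sum>i. (if i \<in> B' then ennreal (r j i ^ s) else 0) + (if i \<in> {n j..} then ennreal (r j i ^ s) else 0))"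
      by (intro suminf_le summableI) (auto simp: B_def B'_def)
    also have "\<dots> = (\<Sum>i. if i \<in> B' then ennreal (r j i ^ s) else 0)
        + (\<Sum>i. if i \<in> {n j..} then ennreal (r j i ^ s) else 0)"
      by (rule suminf_add[symmetric]) (rule summableI)+
    also have "\<dots> \<le> ennreal (2 * e) + ennreal e"
      using bad_sets_small[OF cov cov dec contentf[OF \<delta>0] e(1) B'_def] j tail
      by (intro add_mono) auto
    also have "\<dots> = ennreal (3 * e)" using e by (simp flip: ennreal_plus)
    finally show "(\<Sum>i. if i \<in> B j then ennreal (r j i ^ s) else 0) \<le> ennreal (3 * e)" .
  qed
  have good: "small_potential (riesz s) K (A - (\<Union>j<N. bad j)) (ennreal (\<epsilon> / 2))"
  proof -
    \<comment> \<open>The inverse of the lower bound \<open>N / 2 ^ (s + 2)\<close> for the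
      potential of the unscaled masses.\<close>
    define c where "c = 2 ^ (s + 2) / real N"
    have c0: "0 < c" using N0 by (simp add: c_def)
    define w where "w i = (if C N i \<inter> A \<noteq> {} then r N i ^ s else 0)" for i
    have w0: "0 \<le> w i" for i using r0[of N i] by (simp add: w_def less_imp_le)
    define x where "x i = (SOME x. x \<in> C N i \<inter> A)" for i
    have x: "x i \<in> C N i \<inter> A" if "C N i \<inter> A \<noteq> {}" for i
      unfolding x_def using that by (metis ex_in_conv someI_ex)
    have mass: "(\<Sum>i. ennreal (c * w i)) \<le> ennreal (\<epsilon> / 2)"
    proof -
      have "(\<Sum>i. ennreal (c * w i)) = ennreal c * (\<Sum>i. ennreal (w i))"
        using c0 w0 by (simp add: ennreal_mult)
      also have "(\<Sum>i. ennreal (w i)) \<le> (\<Sum>i. ennreal (r N i ^ s))"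
        using r0[of N] by (intro suminf_le summableI ennreal_leI) (auto simp: w_def less_imp_le)
      also have "\<dots> \<le> hausdorff_content s (\<delta> N) A + ennreal e" using cov'[of N] by simp
      also have "\<dots> \<le> ennreal M + ennreal 1"
        using content[OF \<delta>0] e by (intro add_mono ennreal_leI) auto
      finally have "(\<Sum>i. ennreal (c * w i)) \<le> ennreal (c * (M + 1))"
        using c0 M by (simp add: mult_left_mono ennreal_mult ennreal_plus del: ennreal_1)
      moreover have "c * (M + 1) \<le> \<epsilon> / 2"
        using N eps N0 by (simp add: c_def field_simps)
      ultimately show ?thesis by (meson ennreal_leI order_trans)
    qed
    have pot: "1 \<le> (\<Sum>i. ennreal (c * w i) * riesz s (dist y (x i)))"
      if y: "y \<in> A - (\<Union>j<N. bad j)" for y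
    proof -
      have "\<exists>i. y \<in> C j i \<and> i \<notin> B j" if "j < N" for j
      proof -
        obtain i where i: "y \<in> C j i" using cov'[of j] y by blast
        then have "i \<notin> B j" using y that unfolding bad_def by blast
        then show ?thesis using i by blast
      qed
      then obtain p where p: "\<And>j. j < N \<Longrightarrow> y \<in> C j (p j)" "\<And>j. j < N \<Longrightarrow> p j \<notin> B j" by metis
      define R where "R j = r j (p j)" for j
      have R0: "0 < R j" for j using r0 by (simp add: R_def)
      have pn: "p j < n j" if "j < N" for j using p(2)[OF that] by (auto simp: B_def)
      have Rstep: "R (Suc j) \<le> R j / 2" if "Suc j < N" for j
        using step(2)[OF pn, of j] r2[of "Suc j" "p (Suc j)"] that by (simp add: R_def)
      \<comment> \<open>The finest sets meeting \<open>C j (p j)\<close> inside \<open>A\<close>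
        have their chosen points within \<open>2 * R j\<close> of \<open>y\<close>, because their
        own radii are at most \<open>R j\<close>.\<close>
      have near: "ennreal (1 / 2) \<le> (\<Sum>i. ennreal (w i * (if dist y (x i) \<le> 2 * R j then 1 / R j ^ s else 0)))"
        if j: "j < N" for j
      proof -
        have "ennreal (R j ^ s / 2) \<le> (\<Sum>i'. if C N i' \<inter> C j (p j) \<inter> A \<noteq> {} then ennreal (r N i' ^ s) else 0)"
          using p(2)[OF j] by (simp add: B_def R_def not_less)
        also have "\<dots> \<le> (\<Sum>i. ennreal (w i * (if dist y (x i) \<le> 2 * R j then 1 else 0)))"
        proof (intro suminf_le summableI)
          fix i
          show "(if C N i \<inter> C j (p j) \<inter> A \<noteq> {} then ennreal (r N i ^ s) else 0)
            \<le> ennreal (w i * (if dist y (x i) \<le> 2 * R j then 1 else 0))"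
          proof (cases "C N i \<inter> C j (p j) \<inter> A \<noteq> {}")
            case True
            then obtain z where z: "z \<in> C N i" "z \<in> C j (p j)" "z \<in> A" by blast
            then have xi: "x i \<in> C N i" and wi: "w i = r N i ^ s" using x[of i] by (auto simp: w_def)
            have "dist y z \<le> R j"
              using diameter_bounded_bound[OF bd p(1)[OF j] z(2)] dm[of j "p j"] by (simp add: R_def)
            moreover have "dist z (x i) \<le> r N i"
              using diameter_bounded_bound[OF bd z(1) xi] dm[of N i] by simp
            moreover have "r N i \<le> R j"
              using r2[of N i] dec[of "Suc j" N] j step(2)[OF pn[OF j]] \<delta>0[of "Suc j"]
              by (simp add: R_def)
            ultimately have "dist y (x i) \<le> 2 * R j"
              using dist_triangle[of y "x i" z] by simp
            then show ?thesis using wi by simp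
          qed simp
        qed
        finally have "ennreal (1 / R j ^ s) * ennreal (R j ^ s / 2)
          \<le> ennreal (1 / R j ^ s) * (\<Sum>i. ennreal (w i * (if dist y (x i) \<le> 2 * R j then 1 else 0)))"
          by (rule mult_left_mono) simp
        also have "ennreal (1 / R j ^ s) * ennreal (R j ^ s / 2) = ennreal (1 / 2)"
          using R0[of j] by (subst ennreal_mult[symmetric]) auto
        also have "ennreal (1 / R j ^ s) * (\<Sum>i. ennreal (w i * (if dist y (x i) \<le> 2 * R j then 1 else 0)))
          = (\<Sum>i. ennreal (w i * (if dist y (x i) \<le> 2 * R j then 1 / R j ^ s else 0)))"
          unfolding ennreal_suminf_cmult[symmetric] using R0[of j] w0
          by (intro suminf_cong) (simp add: ennreal_mult[symmetric] less_imp_le mult.commute)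
        finally show ?thesis .
      qed
      have "ennreal (real N / 2) = (\<Sum>j<N. ennreal (1 / 2))"
        by (subst sum_ennreal) auto
      also have "\<dots> \<le> (\<Sum>j<N. \<Sum>i. ennreal (w i * (if dist y (x i) \<le> 2 * R j then 1 / R j ^ s else 0)))"
        by (intro sum_mono near) simp
      also have "\<dots> = (\<Sum>i. \<Sum>j<N. ennreal (w i * (if dist y (x i) \<le> 2 * R j then 1 / R j ^ s else 0)))"
        by (rule suminf_sum[symmetric]) (rule summableI)
      also have "\<dots> \<le> (\<Sum>i. ennreal (2 ^ Suc s) * (ennreal (w i) * riesz s (dist y (x i))))"
      proof (intro suminf_le summableI)
        fix i
        let ?d = "dist y (x i)"
        show "(\<Sum>j<N. ennreal (w i * (if ?d \<le> 2 * R j then 1 / R j ^ s else 0)))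
          \<le> ennreal (2 ^ Suc s) * (ennreal (w i) * riesz s ?d)"
        proof (cases "?d = 0 \<or> w i = 0")
          case True
          then consider "w i = 0" | "w i > 0" "?d = 0" using w0[of i] by fastforce
          then show ?thesis
          proof cases
            case 2
            then show ?thesis using riesz_0[OF s] by (simp add: ennreal_mult_top)
          qed simp
        next
          case False
          then have d: "0 < ?d" by simp
          have "(\<Sum>j<N. ennreal (w i * (if ?d \<le> 2 * R j then 1 / R j ^ s else 0)))
            = ennreal (w i * (\<Sum>j<N. if ?d \<le> 2 * R j then 1 / R j ^ s else 0))"
            unfolding sum_distrib_left using w0[of i] R0 by (intro sum_ennreal) (simp add: less_imp_le)
          also have "\<dots> \<le> ennreal (w i * (2 ^ Suc s * (1 / ?d ^ s)))"
            by (intro ennreal_leI mult_left_mono w0 dyadic_scale_sum[where N = N])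
              (use s R0 Rstep d in auto)
          also have "\<dots> = ennreal (2 ^ Suc s) * (ennreal (w i) * riesz s ?d)"
            unfolding riesz_pos[OF d] using w0[of i]
            by (simp add: ennreal_mult[symmetric] mult.left_commute)
          finally show ?thesis .
        qed
      qed
      also have "\<dots> = ennreal (2 ^ Suc s) * (\<Sum>i. ennreal (w i) * riesz s (dist y (x i)))" by simp
      finally have "ennreal (2 / real N) * ennreal (real N / 2)
        \<le> ennreal (2 / real N) * (ennreal (2 ^ Suc s) * (\<Sum>i. ennreal (w i) * riesz s (dist y (x i))))"
        by (rule mult_left_mono) simp
      also have "ennreal (2 / real N) * ennreal (real N / 2) = 1"
        using N0 by (subst ennreal_mult[symmetric]) auto
      also have "ennreal (2 / real N) * (ennreal (2 ^ Suc s) * (\<Sum>i. ennreal (w i) * riesz s (dist y (x i))))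
        = ennreal c * (\<Sum>i. ennreal (w i) * riesz s (dist y (x i)))"
        unfolding c_def by (simp add: mult.assoc[symmetric] ennreal_mult[symmetric])
      also have "\<dots> = (\<Sum>i. ennreal (c * w i) * riesz s (dist y (x i)))"
        using c0 w0 by (simp add: ennreal_mult mult.assoc flip: ennreal_suminf_cmult)
      finally show ?thesis .
    qed
    have "x i \<in> K" if "ennreal (c * w i) \<noteq> 0" for i
      using that x[of i] AK by (auto simp: w_def split: if_splits)
    then show ?thesis
      unfolding small_potential_def using mass pot
      by (intro exI[of _ x] exI[of _ "\<lambda>i. ennreal (c * w i)"]) auto
  qed
  define E where "E j = (if j < N then bad j else if j = N then A - (\<Union>j<N. bad j) else {})" for j
  define m where "m j = (if j < N then ennreal (3 * e) else if j = N then ennreal (\<epsilon> / 2) else 0)" for j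
  have "small_potential (riesz s) K (\<Union>j. E j) (ennreal \<epsilon>)"
  proof (rule small_potential_UN)
    show "small_potential (riesz s) K (E j) (m j)" for j
      using bad good by (simp add: E_def m_def small_potential_empty)
    have "(\<Sum>j. m j) = (\<Sum>j\<le>N. m j)" by (rule suminf_finite) (auto simp: m_def)
    also have "\<dots> = (\<Sum>j<N. m j) + m N" by (simp flip: lessThan_Suc_atMost)
    also have "\<dots> = ennreal (real N * (3 * e)) + ennreal (\<epsilon> / 2)"
      using e by (simp add: m_def ennreal_of_nat_eq_real_of_nat ennreal_mult)
    also have "\<dots> \<le> ennreal (\<epsilon> / 2) + ennreal (\<epsilon> / 2)"
      using e' by (intro add_right_mono ennreal_leI)
    also have "\<dots> = ennreal \<epsilon>" using eps by (simp flip: ennreal_plus)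
    finally show "(\<Sum>j. m j) \<le> ennreal \<epsilon>" .
  qed
  moreover have "A \<subseteq> (\<Union>j. E j)"
  proof
    fix a assume a: "a \<in> A"
    show "a \<in> (\<Union>j. E j)"
    proof (cases "\<exists>j<N. a \<in> bad j")
      case True
      then obtain j where "j < N" "a \<in> bad j" by blast
      then have "a \<in> E j" by (simp add: E_def)
      then show ?thesis by blast
    next
      case False
      then have "a \<in> E N" using a by (simp add: E_def)
      then show ?thesis by blast
    qed
  qed
  ultimately show ?thesis by (rule small_potential_mono) auto
qed

lemma sigma_finite_hausdorff_small_potential:
  fixes K :: "'a::metric_space set"
  assumes "s \<ge> 1" "sigma_finite_hausdorff s K" "0 < \<epsilon>"
  shows "small_potential (riesz s) K K (ennreal \<epsilon>)"
proof -
  obtain A :: "nat \<Rightarrow> 'a set" where A: "\<And>i. hausdorff_measure s (A i) < \<infinity>" "K = (\<Union>i. A i)"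
    using assms(2) unfolding sigma_finite_hausdorff_def by metis
  have "small_potential (riesz s) K (A i) (ennreal (\<epsilon> * (1 / 2) ^ Suc i))" for i
    by (rule finite_hausdorff_small_potential[OF assms(1) A(1)]) (use A(2) assms(3) in auto)
  then have "small_potential (riesz s) K (\<Union>i. A i) (ennreal \<epsilon>)"
    by (rule small_potential_UN[OF _ eq_refl[OF suminf_geometric_ennreal]]) (use assms(3) in simp)
  then show ?thesis using A(2) by simp
qed

text \<open>In dimension 0 every nonempty set has size 1. A cover by sets of diameter less than the
  least distance of \<open>p\<close> given points needs a separate set for each of them, so the
  measure is at least \<open>p\<close>.\<close>

lemma finite_hausdorff_0_finite:
  fixes A :: "'a::metric_space set"
  assumes "hausdorff_measure 0 A < \<infinity>"
  shows "finite A"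
proof (rule ccontr)
  assume inf: "infinite A"
  obtain M where M: "hausdorff_measure 0 A = ennreal M" "0 \<le> M"
    using assms by (cases "hausdorff_measure 0 A") auto
  obtain p where p: "M < real p" using reals_Archimedean2 by blast
  obtain F where F: "finite F" "card F = p" "F \<subseteq> A" using infinite_arbitrarily_large[OF inf] by blast
  define \<delta> where "\<delta> = Min (insert 1 ((\<lambda>(x, y). dist x y / 2) ` {(x, y) \<in> F \<times> F. x \<noteq> y}))"
  have fin: "finite (insert 1 ((\<lambda>(x, y). dist x y / 2) ` {(x, y) \<in> F \<times> F. x \<noteq> y}))"
    using F(1) by (auto intro: finite_subset[of _ "F \<times> F"])
  have \<delta>0: "0 < \<delta>" unfolding \<delta>_def using fin by (subst Min_gr_iff) auto
  have \<delta>: "\<delta> < dist x y" if "x \<in> F" "y \<in> F" "x \<noteq> y" for x y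
  proof -
    have "\<delta> \<le> dist x y / 2" unfolding \<delta>_def using that by (intro Min_le[OF fin]) force
    moreover have "0 < dist x y" using that by simp
    ultimately show ?thesis by linarith
  qed
  have "hausdorff_content 0 \<delta> A \<le> ennreal M"
    unfolding M(1)[symmetric] hausdorff_measure_def using \<delta>0 by (intro SUP_upper) simp
  also have "\<dots> < ennreal (real p)" using p M by (intro ennreal_lessI) auto
  finally obtain C where C: "A \<subseteq> (\<Union>i. C i)" "\<And>i. bounded (C i) \<and> diameter (C i) \<le> \<delta>"
    "(\<Sum>i. hausdorff_size 0 (C i)) < ennreal (real p)"
    unfolding hausdorff_content_def INF_less_iff by blast
  have "\<forall>x\<in>F. \<exists>i. x \<in> C i" using F(3) C(1) by blast
  then obtain i where i: "\<And>x. x \<in> F \<Longrightarrow> x \<in> C (i x)" by metis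
  have inj: "inj_on i F"
  proof (rule inj_onI, rule ccontr)
    fix x y assume xy: "x \<in> F" "y \<in> F" "i x = i y" "x \<noteq> y"
    then have "dist x y \<le> diameter (C (i x))"
      using C(2)[of "i x"] i[OF xy(1)] i[OF xy(2)] by (intro diameter_bounded_bound) auto
    then show False using \<delta>[OF xy(1,2,4)] C(2)[of "i x"] by linarith
  qed
  have "ennreal (real p) = (\<Sum>j\<in>i ` F. 1)" using F(2) inj by (simp add: card_image ennreal_of_nat_eq_real_of_nat)
  also have "\<dots> \<le> (\<Sum>j\<in>i ` F. hausdorff_size 0 (C j))"
    using i by (intro sum_mono) (auto simp: hausdorff_size_def)
  also have "\<dots> \<le> (\<Sum>j. hausdorff_size 0 (C j))"
    using F(1) by (intro sum_le_suminf summableI) auto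
  finally show False using C(3) by simp
qed

text \<open>Where the kernel is infinite on the diagonal, a positive mass of any size at each point
  is enough.\<close>

lemma countable_small_potential:
  assumes "countable K" "k 0 = \<infinity>" "0 < \<epsilon>"
  shows "small_potential k K K (ennreal \<epsilon>)"
proof (cases "K = {}")
  case False
  define W where "W i = ennreal (\<epsilon> * (1 / 2) ^ Suc i)" for i
  show ?thesis unfolding small_potential_def
  proof (intro exI[of _ "from_nat_into K"] exI[of _ W] conjI allI impI ballI)
    show "from_nat_into K i \<in> K" for i using False by (rule from_nat_into)
    show "(\<Sum>i. W i) \<le> ennreal \<epsilon>" unfolding W_def
      by (rule eq_refl[OF suminf_geometric_ennreal]) (use assms(3) in simp)
    fix y assume "y \<in> K"
    then obtain i where i: "y = from_nat_into K i" using from_nat_into_surj[OF assms(1)] by metis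
    have "1 \<le> W i * k (dist y (from_nat_into K i))"
      using assms(2,3) by (simp add: i W_def ennreal_mult_top)
    also have "\<dots> \<le> (\<Sum>i. W i * k (dist y (from_nat_into K i)))" by (rule suminf_ge_term_ennreal)
    finally show "1 \<le> (\<Sum>i. W i * k (dist y (from_nat_into K i)))" .
  qed
qed (simp add: small_potential_empty)

section \<open>Smoothed Riesz potentials\<close>

text \<open>The argument is a squared distance, so \<open>t powr (1 - m / 2)\<close> is
  \<open>|x|^(2 - m)\<close>. For \<open>m = 2\<close> the constant \<open>ln R\<close> makes the
  logarithmic kernel nonnegative for \<open>t \<le> R\<close>.\<close>

definition riesz_kernel :: "nat \<Rightarrow> real \<Rightarrow> real \<Rightarrow> real" where
  "riesz_kernel m R t = (if m = 2 then ln R - ln t else t powr (1 - real m / 2))"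

text \<open>Normalisation under which both kernels have derivative
  \<open>- kernel_const m * t powr (- m / 2)\<close>.\<close>

definition kernel_const :: "nat \<Rightarrow> real" where
  "kernel_const m = (if m = 2 then 1 else real m / 2 - 1)"

lemma kernel_const_pos: "2 \<le> m \<Longrightarrow> 0 < kernel_const m"
  by (simp add: kernel_const_def)

lemma kernel_deriv:
  assumes "0 < t"
  shows "(riesz_kernel m R has_real_derivative - kernel_const m * t powr (- real m / 2)) (at t)"
proof (cases "m = 2")
  case True
  have "((\<lambda>t. ln R - ln t) has_real_derivative - (1 / t)) (at t)"
    using assms by (auto intro!: derivative_eq_intros simp: field_simps)
  moreover have "t powr - 1 = 1 / t" using assms by (simp add: powr_minus_divide)
  ultimately show ?thesis using True by (simp add: riesz_kernel_def[abs_def] kernel_const_def)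
next
  case False
  have "((\<lambda>t. t powr (1 - real m / 2)) has_real_derivative (1 - real m / 2) * t powr (1 - real m / 2 - 1)) (at t)"
    using has_real_derivative_powr[OF assms, of "1 - real m / 2"] .
  then show ?thesis using False by (simp add: riesz_kernel_def[abs_def] kernel_const_def)
qed

lemma smooth_kernel: "smooth h \<Longrightarrow> (\<And>x. 0 < h x) \<Longrightarrow> smooth (\<lambda>x. riesz_kernel m R (h x))"
  unfolding riesz_kernel_def by (cases "m = 2") (simp_all add: smooth_diff smooth_const smooth_ln smooth_powr)

lemma kernel_antimono: "2 \<le> m \<Longrightarrow> 0 < s \<Longrightarrow> s \<le> t \<Longrightarrow> riesz_kernel m R t \<le> riesz_kernel m R s"
  unfolding riesz_kernel_def by (auto intro!: powr_mono2')

lemma kernel_nonneg: "0 < t \<Longrightarrow> t \<le> R \<Longrightarrow> 0 \<le> riesz_kernel m R t"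
  unfolding riesz_kernel_def by auto

lemma continuous_kernel:
  "continuous_on X h \<Longrightarrow> (\<And>x. x \<in> X \<Longrightarrow> 0 < h x) \<Longrightarrow> continuous_on X (\<lambda>x. riesz_kernel m R (h x))"
  unfolding riesz_kernel_def by (cases "m = 2") (auto intro!: continuous_intros simp: less_imp_neq[THEN not_sym])

text \<open>The unregularised kernel, written as the limit of the increasing kernels with
  \<open>\<eta> = 1 / (n + 1)\<close>, so that potentials with \<open>\<eta> > 0\<close> can be
  reached by monotone convergence. Negative values count as 0.\<close>

definition limit_kernel :: "nat \<Rightarrow> real \<Rightarrow> real \<Rightarrow> ennreal" where
  "limit_kernel m R d = (SUP n. ennreal (riesz_kernel m R (d\<^sup>2 + 1 / real (Suc n))))"

lemma limit_kernel_0: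
  assumes "2 \<le> m"
  shows "limit_kernel m R 0 = \<infinity>"
  unfolding limit_kernel_def infinity_ennreal_def
proof (rule ennreal_SUP_eq_top)
  fix k :: nat
  have "\<exists>n. real k \<le> riesz_kernel m R (1 / real (Suc n))"
  proof (cases "m = 2")
    case True
    obtain n where n: "exp (real k - ln R) \<le> real n" using real_arch_simple by blast
    have "real k - ln R \<le> ln (real (Suc n))"
      using n by (subst ln_ge_iff) auto
    then show ?thesis using True by (intro exI[of _ n]) (simp add: riesz_kernel_def ln_div)
  next
    case False
    define a where "a = real m / 2 - 1"
    have a: "0 < a" using False assms by (simp add: a_def)
    obtain n where n: "real k powr (1 / a) \<le> real n" using real_arch_simple by blast
    have "real k = (real k powr (1 / a)) powr a"
      using a by (cases "k = 0") (simp_all add: powr_powr)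
    also have "\<dots> \<le> real (Suc n) powr a"
      using n a by (intro powr_mono2) auto
    also have "\<dots> = (1 / real (Suc n)) powr (1 - real m / 2)"
      by (simp add: a_def powr_divide powr_diff)
    finally show ?thesis using False by (intro exI[of _ n]) (simp add: riesz_kernel_def)
  qed
  then obtain n where "real k \<le> riesz_kernel m R (1 / real (Suc n))" by blast
  then have "of_nat k \<le> ennreal (riesz_kernel m R (0\<^sup>2 + 1 / real (Suc n)))"
    by (simp add: ennreal_of_nat_eq_real_of_nat ennreal_leI)
  then show "\<exists>i\<in>UNIV. of_nat k \<le> ennreal (riesz_kernel m R (0\<^sup>2 + 1 / real (Suc i)))" by blast
qed

lemma riesz_le_limit_kernel:
  assumes "3 \<le> m" "0 \<le> d"
  shows "riesz (m - 2) d \<le> limit_kernel m R d"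
proof (cases "d = 0")
  case True
  then show ?thesis using limit_kernel_0[of m R] assms by simp
next
  case False
  then have d: "0 < d" using assms by simp
  have "(\<lambda>n. d\<^sup>2 + 1 / real (Suc n)) \<longlonglongrightarrow> d\<^sup>2 + 0"
    by (intro tendsto_intros lim_1_over_real_power filterlim_compose[OF lim_1_over_n filterlim_Suc])
  then have "(\<lambda>n. (d\<^sup>2 + 1 / real (Suc n)) powr (1 - real m / 2)) \<longlonglongrightarrow> (d\<^sup>2) powr (1 - real m / 2)"
    using d by (intro tendsto_powr tendsto_const) auto
  then have "(\<lambda>n. riesz_kernel m R (d\<^sup>2 + 1 / real (Suc n))) \<longlonglongrightarrow> (d\<^sup>2) powr (1 - real m / 2)"
    using assms by (simp add: riesz_kernel_def)
  then have lim: "(\<lambda>n. ennreal (riesz_kernel m R (d\<^sup>2 + 1 / real (Suc n)))) \<longlonglongrightarrow> ennreal ((d\<^sup>2) powr (1 - real m / 2))"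
    by (rule tendsto_ennrealI)
  have "(d\<^sup>2) powr (1 - real m / 2) = d powr (- real (m - 2))"
    using d assms by (simp add: powr_powr powr_numeral[symmetric] of_nat_diff right_diff_distrib del: powr_numeral)
  also have "\<dots> = 1 / d ^ (m - 2)"
    using d by (simp add: powr_minus_divide powr_realpow)
  finally have "riesz (m - 2) d = ennreal ((d\<^sup>2) powr (1 - real m / 2))"
    using riesz_pos[OF d] by simp
  also have "\<dots> \<le> limit_kernel m R d"
    unfolding limit_kernel_def by (rule LIMSEQ_le_const2[OF lim]) (auto intro!: SUP_upper)
  finally show ?thesis .
qed

text \<open>For \<open>m = 2\<close> the set \<open>K\<close> is a countable union of finite sets
  and point masses suffice; for \<open>m \<ge> 3\<close> the limit kernel dominates
  \<open>riesz (m - 2)\<close>.\<close>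

lemma limit_kernel_small_potential:
  fixes K :: "'a::metric_space set"
  assumes "2 \<le> m" "sigma_finite_hausdorff (m - 2) K" "0 < \<epsilon>"
  shows "small_potential (limit_kernel m R) K K (ennreal \<epsilon>)"
proof (cases "m = 2")
  case True
  then have "sigma_finite_hausdorff 0 K" using assms(2) by simp
  then obtain A :: "nat \<Rightarrow> 'a set" where A: "\<And>i. hausdorff_measure 0 (A i) < \<infinity>" "K = (\<Union>i. A i)"
    unfolding sigma_finite_hausdorff_def by metis
  have "countable (A i)" for i by (intro countable_finite finite_hausdorff_0_finite A(1))
  then have "countable K" unfolding A(2) by (intro countable_UN) auto
  then show ?thesis
    by (rule countable_small_potential) (use limit_kernel_0[OF assms(1)] assms(3) in auto)
next
  case False
  then have m: "3 \<le> m" using assms by simp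
  have "small_potential (riesz (m - 2)) K K (ennreal \<epsilon>)"
    using assms m by (intro sigma_finite_hausdorff_small_potential) auto
  then show ?thesis
    by (rule small_potential_mono) (use riesz_le_limit_kernel[OF m] in auto)
qed

text \<open>Finitely many masses and one common \<open>\<eta> > 0\<close>: such functions are smooth
  on the whole space, also on \<open>K\<close>.\<close>

definition riesz_potential :: "nat \<Rightarrow> real \<Rightarrow> (real ^ 'n::finite \<Rightarrow> real) \<Rightarrow> bool" where
  "riesz_potential m R u \<longleftrightarrow> (\<exists>N x W \<eta>. 0 < \<eta> \<and> (\<forall>i<N. 0 \<le> W i) \<and>
     u = (\<lambda>y. \<Sum>i<(N::nat). W i * riesz_kernel m R (sqdist (x i) y + \<eta>)))"

lemma sqdist_nonneg: "0 \<le> sqdist y x"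
  by (simp add: sqdist_dist)

text \<open>Partial sums with regularised kernels increase to a potential that is at least 1 on
  \<open>K\<close>, so the open sets where they exceed \<open>1 / 2\<close> cover \<open>K\<close>;
  by compactness one of them does, and doubling the masses restores 1. The bound on \<open>R\<close>
  makes the summands nonnegative on \<open>K\<close>, which gives the monotonicity.\<close>

lemma potential_large_on_K:
  fixes K :: "(real ^ 'n::finite) set"
  assumes m: "2 \<le> m" and K: "compact K" "sigma_finite_hausdorff (m - 2) K" and e: "0 < \<epsilon>"
    and R: "\<And>x y. x \<in> K \<Longrightarrow> y \<in> K \<Longrightarrow> sqdist x y + 1 \<le> R"
  obtains N x W \<eta> where "0 < \<eta>" "\<eta> \<le> 1" "\<And>i. 0 \<le> W i" "\<And>i. W i \<noteq> 0 \<Longrightarrow> x i \<in> K"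
    "(\<Sum>i<N::nat. W i) \<le> \<epsilon>"
    "\<And>y. y \<in> K \<Longrightarrow> 1 < (\<Sum>i<N. W i * riesz_kernel m R (sqdist (x i) y + \<eta>))"
proof -
  obtain x :: "nat \<Rightarrow> real ^ 'n" and V where xV: "\<And>i. V i \<noteq> 0 \<Longrightarrow> x i \<in> K"
    "(\<Sum>i. V i) \<le> ennreal (\<epsilon> / 2)" "\<And>y. y \<in> K \<Longrightarrow> 1 \<le> (\<Sum>i. V i * limit_kernel m R (dist y (x i)))"
    using limit_kernel_small_potential[OF m K(2), of "\<epsilon> / 2" R] e unfolding small_potential_def by auto
  have Vfin: "V i < \<infinity>" for i
    using suminf_ge_term_ennreal[of V i] xV(2) by (auto intro: le_less_trans[of _ "ennreal (\<epsilon> / 2)"])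
  define W where "W i = enn2real (V i)" for i
  have VW: "V i = ennreal (W i)" and W0: "0 \<le> W i" for i
    using Vfin[of i] by (auto simp: W_def)
  have xW: "W i \<noteq> 0 \<Longrightarrow> x i \<in> K" for i using xV(1)[of i] by (cases "V i = 0") (auto simp: W_def)
  define g where "g n i y = riesz_kernel m R (sqdist (x i) y + 1 / real (Suc n))" for n i y
  have pos: "0 < sqdist (x i) y + 1 / real (Suc n)" for i n y
    using sqdist_nonneg[of "x i" y] by (simp add: add_nonneg_pos)
  have gmono: "g n i y \<le> g n' i y" if "n \<le> n'" for n n' i y
    unfolding g_def using that by (intro kernel_antimono[OF m pos]) (simp add: frac_le)
  have g0: "0 \<le> g n i y" if "y \<in> K" "W i \<noteq> 0" for n i y
  proof -
    have "sqdist (x i) y + 1 / real (Suc n) \<le> R"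
      using R[OF xW[OF that(2)] that(1)] by (smt (verit) divide_le_eq_1 of_nat_0_le_iff of_nat_Suc)
    then show ?thesis unfolding g_def by (intro kernel_nonneg pos)
  qed
  have Wg0: "0 \<le> W i * g n i y" if "y \<in> K" for n i y
    using W0[of i] g0[OF that, of i n] by (cases "W i = 0") auto
  define f where "f n y = (\<Sum>i<n. W i * g n i y)" for n y
  have fmono: "f n y \<le> f n' y" if "n \<le> n'" "y \<in> K" for n n' y
  proof -
    have "f n y \<le> (\<Sum>i<n. W i * g n' i y)"
      unfolding f_def using gmono[OF that(1)] W0 by (intro sum_mono mult_left_mono)
    also have "\<dots> \<le> f n' y"
      unfolding f_def using that Wg0[OF that(2)] by (intro sum_mono2) auto
    finally show ?thesis .
  qed
  have ex: "\<exists>n. 1 / 2 < f n y" if y: "y \<in> K" for y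
  proof -
    have "ennreal (1 / 2) < 1" by (subst ennreal_1[symmetric], subst ennreal_less_iff) auto
    also have "1 \<le> (\<Sum>i. V i * limit_kernel m R (dist y (x i)))" by (rule xV(3)[OF y])
    also have "\<dots> = (\<Sum>i. SUP n. V i * ennreal (g n i y))"
      unfolding limit_kernel_def g_def sqdist_dist by (simp add: SUP_mult_left_ennreal)
    also have "\<dots> = (SUP n. \<Sum>i. V i * ennreal (g n i y))"
      using gmono by (intro ennreal_suminf_SUP_eq) (auto intro!: incseq_SucI mult_left_mono ennreal_leI)
    finally obtain n where "ennreal (1 / 2) < (\<Sum>i. V i * ennreal (g n i y))"
      unfolding less_SUP_iff by blast
    then obtain N where N: "ennreal (1 / 2) < (\<Sum>i<N. V i * ennreal (g n i y))"
      unfolding suminf_eq_SUP less_SUP_iff by blast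
    have "(\<Sum>i<N. V i * ennreal (g n i y)) = (\<Sum>i<N. ennreal (W i * g n i y))"
    proof (intro sum.cong refl)
      fix i show "V i * ennreal (g n i y) = ennreal (W i * g n i y)"
        using W0[of i] g0[OF y, of i n] by (cases "W i = 0") (auto simp: VW ennreal_mult)
    qed
    also have "\<dots> = ennreal (\<Sum>i<N. W i * g n i y)"
      by (intro sum_ennreal Wg0 y)
    finally have "1 / 2 < (\<Sum>i<N. W i * g n i y)"
      using N by (simp add: ennreal_less_iff del: ennreal_half)
    also have "\<dots> \<le> (\<Sum>i<N. W i * g (max n N) i y)"
      using gmono[of n "max n N"] W0 by (intro sum_mono mult_left_mono) auto
    also have "\<dots> \<le> f (max n N) y"
      unfolding f_def using Wg0[OF y] by (intro sum_mono2) auto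
    finally show ?thesis by blast
  qed
  have cont: "continuous_on UNIV (f n)" for n
    unfolding f_def g_def
    by (intro continuous_intros continuous_kernel smooth_continuous_on[OF smooth_sqdist] pos)
  have op: "open {y. 1 / 2 < f n y}" for n
    using open_Collect_less[OF continuous_on_const cont] .
  have "K \<subseteq> (\<Union>n\<in>UNIV. {y. 1 / 2 < f n y})" using ex by blast
  then obtain D where D: "finite D" "K \<subseteq> (\<Union>n\<in>D. {y. 1 / 2 < f n y})"
    by (rule compactE_image[OF K(1) op])
  define n where "n = Max (insert 0 D)"
  show ?thesis
  proof (rule that[of "1 / real (Suc n)" "\<lambda>i. 2 * W i" x n])
    show "0 \<le> 2 * W i" for i using W0 by simp
    show "2 * W i \<noteq> 0 \<Longrightarrow> x i \<in> K" for i using xW by simp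
    have "ennreal (\<Sum>i<n. W i) = (\<Sum>i<n. V i)" using W0 by (simp add: VW)
    also have "\<dots> \<le> (\<Sum>i. V i)" by (intro sum_le_suminf summableI) auto
    finally have "(\<Sum>i<n. W i) \<le> \<epsilon> / 2" using xV(2) e by (auto dest: order_trans simp: ennreal_le_iff)
    then show "(\<Sum>i<n. 2 * W i) \<le> \<epsilon>" by (simp flip: sum_distrib_left)
    fix y assume y: "y \<in> K"
    then obtain n' where n': "n' \<in> D" "1 / 2 < f n' y" using D(2) by blast
    have "n' \<le> n" unfolding n_def using D(1) n'(1) by (intro Max_ge) auto
    then have "1 / 2 < f n y" using fmono[OF _ y] n'(2) by (meson less_le_trans)
    then show "1 < (\<Sum>i<n. 2 * W i * riesz_kernel m R (sqdist (x i) y + 1 / real (Suc n)))"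
      by (simp add: f_def g_def mult.assoc flip: sum_distrib_left)
  qed auto
qed

text \<open>The total masses are at most \<open>1 / (j + 1)\<close> and sit on \<open>K\<close>, so
  at each point off \<open>K\<close> the kernels are bounded and the potentials tend to 0.
  \<open>R\<close> is chosen from a bound for the distances in \<open>K \<union> V\<close>, so that
  the logarithm causes no negative values on \<open>V\<close>.\<close>

lemma potential_sequence:
  fixes K V :: "(real ^ 'n::finite) set"
  assumes m: "2 \<le> m" and K: "compact K" "sigma_finite_hausdorff (m - 2) K" and V: "bounded V"
  obtains R u where "\<And>j. riesz_potential m R (u j)" "\<And>j y. y \<in> K \<Longrightarrow> 1 < u j y"
    "\<And>j y. y \<in> V \<Longrightarrow> 0 \<le> u j y" "\<And>y. y \<notin> K \<Longrightarrow> (\<lambda>j::nat. u j y) \<longlonglongrightarrow> 0"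
proof -
  have "bounded (K \<union> V)" using compact_imp_bounded[OF K(1)] V by simp
  then obtain D where D: "\<And>x y. x \<in> K \<union> V \<Longrightarrow> y \<in> K \<union> V \<Longrightarrow> dist x y \<le> D"
    unfolding bounded_two_points by blast
  define R where "R = D\<^sup>2 + 1"
  have R: "sqdist x y + 1 \<le> R" if "x \<in> K" "y \<in> K \<union> V" for x y
    unfolding R_def sqdist_dist using D[of y x] that by (simp add: power_mono)
  define good :: "nat \<Rightarrow> nat \<times> (nat \<Rightarrow> real ^ 'n) \<times> (nat \<Rightarrow> real) \<times> real \<Rightarrow> bool" where
    "good j = (\<lambda>(N, x, W, \<eta>). 0 < \<eta> \<and> \<eta> \<le> 1 \<and> (\<forall>i. 0 \<le> W i) \<and> (\<forall>i. W i \<noteq> 0 \<longrightarrow> x i \<in> K) \<and>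
    (\<Sum>i<N. W i) \<le> 1 / real (Suc j) \<and>
    (\<forall>y\<in>K. 1 < (\<Sum>i<N. W i * riesz_kernel m R (sqdist (x i) y + \<eta>))))" for j
  have "\<exists>t. good j t" for j
  proof -
    have e: "0 < 1 / real (Suc j)" by simp
    have RK: "sqdist x y + 1 \<le> R" if "x \<in> K" "y \<in> K" for x y using R that by simp
    obtain N and x :: "nat \<Rightarrow> real ^ 'n" and W \<eta> where "0 < \<eta>" "\<eta> \<le> 1" "\<And>i. 0 \<le> W i" "\<And>i. W i \<noteq> 0 \<Longrightarrow> x i \<in> K"
      "(\<Sum>i<N. W i) \<le> 1 / real (Suc j)"
      "\<And>y. y \<in> K \<Longrightarrow> 1 < (\<Sum>i<N. W i * riesz_kernel m R (sqdist (x i) y + \<eta>))"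
      by (rule potential_large_on_K[OF m K e, of R]) (erule (1) RK, rule that)
    then show ?thesis by (intro exI[of _ "(N, x, W, \<eta>)"]) (simp add: good_def)
  qed
  then obtain t where t: "\<And>j. good j (t j)" by metis
  define N where "N j = fst (t j)" for j
  define x where "x j = fst (snd (t j))" for j
  define W where "W j = fst (snd (snd (t j)))" for j
  define \<eta> where "\<eta> j = snd (snd (snd (t j)))" for j
  have tj: "t j = (N j, x j, W j, \<eta> j)" for j by (simp add: N_def x_def W_def \<eta>_def)
  have 1: "0 < \<eta> j" "\<eta> j \<le> 1" "0 \<le> W j i" "W j i \<noteq> 0 \<Longrightarrow> x j i \<in> K"
    "(\<Sum>i<N j. W j i) \<le> 1 / real (Suc j)"
    "y \<in> K \<Longrightarrow> 1 < (\<Sum>i<N j. W j i * riesz_kernel m R (sqdist (x j i) y + \<eta> j))" for j i y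
    using t[of j] unfolding tj good_def by auto
  define u where "u j y = (\<Sum>i<N j. W j i * riesz_kernel m R (sqdist (x j i) y + \<eta> j))" for j y
  have pos: "0 < sqdist (x j i) y + \<eta> j" for i j y
    using sqdist_nonneg[of "x j i" y] 1(1)[of j] by simp
  show ?thesis
  proof (rule that[of R u])
    show "riesz_potential m R (u j)" for j
      unfolding riesz_potential_def using 1(1,3)
      by (intro exI[of _ "N j"] exI[of _ "x j"] exI[of _ "W j"] exI[of _ "\<eta> j"]) (auto simp: u_def)
    show "1 < u j y" if "y \<in> K" for j y using 1(6)[OF that] by (simp add: u_def)
    show "0 \<le> u j y" if y: "y \<in> V" for j y
      unfolding u_def
    proof (intro sum_nonneg)
      fix i
      show "0 \<le> W j i * riesz_kernel m R (sqdist (x j i) y + \<eta> j)"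
      proof (cases "W j i = 0")
        case False
        have "sqdist (x j i) y + \<eta> j \<le> R" using R[OF 1(4)[OF False], of y] y 1(2)[of j] by simp
        then show ?thesis using kernel_nonneg[OF pos] 1(3) by (intro mult_nonneg_nonneg) auto
      qed simp
    qed
    fix y assume y: "y \<notin> K"
    obtain d where d: "0 < d" "\<And>z. z \<in> K \<Longrightarrow> d \<le> dist y z"
      using separate_point_closed[OF compact_imp_closed[OF K(1)] y] by blast
    \<comment> \<open>At \<open>y\<close> the arguments of the kernel lie between \<open>d^2\<close>
      and \<open>D' + 1\<close>; as the kernel is monotone, its values at these two ends control
      it.\<close>
    have bound: "\<bar>u j y\<bar> \<le> 1 / real (Suc j) * (\<bar>riesz_kernel m R (d\<^sup>2)\<bar> + \<bar>riesz_kernel m R (D' + 1)\<bar>)"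
      if D': "\<And>i. W j i \<noteq> 0 \<Longrightarrow> sqdist (x j i) y \<le> D'" "0 \<le> D'" for j D'
    proof -
      let ?B = "\<bar>riesz_kernel m R (d\<^sup>2)\<bar> + \<bar>riesz_kernel m R (D' + 1)\<bar>"
      have "\<bar>u j y\<bar> \<le> (\<Sum>i<N j. W j i * ?B)"
        unfolding u_def
      proof (rule order_trans[OF sum_abs], intro sum_mono)
        fix i
        show "\<bar>W j i * riesz_kernel m R (sqdist (x j i) y + \<eta> j)\<bar> \<le> W j i * ?B"
        proof (cases "W j i = 0")
          case False
          have "d\<^sup>2 \<le> sqdist (x j i) y"
            unfolding sqdist_dist using d(2)[OF 1(4)[OF False]] d(1) by (intro power_mono) auto
          then have "riesz_kernel m R (sqdist (x j i) y + \<eta> j) \<le> riesz_kernel m R (d\<^sup>2)"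
            using d(1) 1(1)[of j] by (intro kernel_antimono[OF m]) auto
          moreover have "riesz_kernel m R (D' + 1) \<le> riesz_kernel m R (sqdist (x j i) y + \<eta> j)"
            using D'(1)[OF False] 1(2)[of j] by (intro kernel_antimono[OF m pos]) auto
          ultimately have "\<bar>riesz_kernel m R (sqdist (x j i) y + \<eta> j)\<bar> \<le> ?B" by linarith
          then show ?thesis using 1(3)[of j i] by (simp add: abs_mult mult_left_mono)
        qed simp
      qed
      also have "\<dots> = (\<Sum>i<N j. W j i) * ?B" by (simp add: sum_distrib_right)
      also have "\<dots> \<le> 1 / real (Suc j) * ?B" by (intro mult_right_mono 1(5)) simp
      finally show ?thesis .
    qed
    obtain D' where D': "\<And>z. z \<in> K \<Longrightarrow> dist y z \<le> D'"
    proof -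
      have "bounded (insert y K)" using K(1) compact_imp_bounded by (simp add: bounded_insert)
      then obtain D' where "\<And>z z'. z \<in> insert y K \<Longrightarrow> z' \<in> insert y K \<Longrightarrow> dist z z' \<le> D'"
        unfolding bounded_two_points by blast
      then show ?thesis using that by blast
    qed
    have *: "\<bar>u j y\<bar> \<le> 1 / real (Suc j) * (\<bar>riesz_kernel m R (d\<^sup>2)\<bar> + \<bar>riesz_kernel m R (D'\<^sup>2 + 1)\<bar>)" for j
    proof (rule bound)
      show "sqdist (x j i) y \<le> D'\<^sup>2" if "W j i \<noteq> 0" for i
        unfolding sqdist_dist using D'[OF 1(4)[OF that]] by (intro power_mono) auto
    qed simp
    have "(\<lambda>j. 1 / real (Suc j) * (\<bar>riesz_kernel m R (d\<^sup>2)\<bar> + \<bar>riesz_kernel m R (D'\<^sup>2 + 1)\<bar>)) \<longlonglongrightarrow> 0 * (\<bar>riesz_kernel m R (d\<^sup>2)\<bar> + \<bar>riesz_kernel m R (D'\<^sup>2 + 1)\<bar>)"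
      by (intro tendsto_mult tendsto_const filterlim_compose[OF lim_1_over_n filterlim_Suc])
    then show "(\<lambda>j. u j y) \<longlonglongrightarrow> 0"
      using * by (intro Lim_null_comparison[of "\<lambda>j. u j y"]) (auto intro!: always_eventually)
  qed
qed

lemma riesz_potential_smooth:
  assumes "riesz_potential m R u"
  shows "smooth u"
proof -
  obtain N and x :: "nat \<Rightarrow> real ^ 'a" and W \<eta> where u: "0 < \<eta>"
    "u = (\<lambda>y. \<Sum>i<N. W i * riesz_kernel m R (sqdist (x i) y + \<eta>))"
    using assms unfolding riesz_potential_def by auto
  have "0 < sqdist (x i) y + \<eta>" for i y using sqdist_nonneg[of "x i" y] u(1) by simp
  then show ?thesis unfolding u(2)
    by (intro smooth_sum smooth_mult smooth_const smooth_kernel smooth_add smooth_sqdist)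
qed

text \<open>With \<open>b = |y - x|^2 + \<eta>\<close>, the first derivative of the kernel is
  proportional to \<open>- b^(- m / 2)\<close>. Differentiating once more and extracting
  \<open>b^(- m / 2 - 1)\<close> leaves the matrix \<open>b \<delta>_kl - m a_k a_l\<close> with
  \<open>a = y - x\<close>, whose pairing with a positive current has a sign.\<close>

lemma riesz_potential_hessian:
  fixes u :: "real ^ 'n::finite \<Rightarrow> real"
  assumes m: "2 \<le> m" and u: "riesz_potential m R u"
  obtains N x W \<eta> where "0 < \<eta>" "\<And>i. i < N \<Longrightarrow> 0 \<le> W i"
    "\<And>k l. partial_deriv k (partial_deriv l u) = (\<lambda>y. \<Sum>i<(N::nat).
        - (W i * (sqdist (x i) y + \<eta>) powr (- real m / 2 - 1)
          * ((sqdist (x i) y + \<eta>) * (if k = l then 1 else 0) - real m * ((y $ k - x i $ k) * (y $ l - x i $ l)))))"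
proof -
  obtain N and x :: "nat \<Rightarrow> real ^ 'n" and W \<eta> where u: "0 < \<eta>" "\<And>i. i < N \<Longrightarrow> 0 \<le> W i"
    "u = (\<lambda>y. \<Sum>i<N. W i * riesz_kernel m R (sqdist (x i) y + \<eta>))"
    using u unfolding riesz_potential_def by auto
  define b where "b i y = sqdist (x i) y + \<eta>" for i y
  have b0: "0 < b i y" for i y using sqdist_nonneg[of "x i" y] u(1) by (simp add: b_def)
  have bs: "smooth (b i)" for i unfolding b_def by (intro smooth_add smooth_sqdist smooth_const)
  have bd: "partial_deriv k (b i) = (\<lambda>y. 2 * (y $ k - x i $ k))" for k i
    unfolding b_def
    by (rule ext, subst partial_deriv_add)
      (auto intro!: smooth_differentiable smooth_sqdist smooth_const simp: partial_deriv_sqdist partial_deriv_const)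
  let ?c = "kernel_const m"
  have gen: "w * (- c * 2 * (p * q * e + - r / 2 * p * (2 * a) * d)) = - (2 * c * w * p * (q * e - r * (a * d)))"
    for w c p q e r a d :: real
    by (simp add: field_simps)
  have ks: "smooth (\<lambda>y. riesz_kernel m R (b i y))" for i by (intro smooth_kernel bs b0)
  have ps: "smooth (\<lambda>y. b i y powr a)" for i a by (intro smooth_powr bs b0)
  have cs: "smooth (\<lambda>y. y $ l - x i $ l)" for i l by (intro smooth_diff smooth_coord smooth_const)
  have d1: "partial_deriv l u = (\<lambda>y. \<Sum>i<N. W i * (- ?c * b i y powr (- real m / 2) * (2 * (y $ l - x i $ l))))" for l
  proof -
    have "partial_deriv l u = (\<lambda>y. \<Sum>i<N. partial_deriv l (\<lambda>y. W i * riesz_kernel m R (b i y)) y)"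
      unfolding u(3) b_def[symmetric] by (rule partial_deriv_sum) (intro smooth_mult smooth_const ks)
    moreover have "partial_deriv l (\<lambda>y. W i * riesz_kernel m R (b i y)) y
      = W i * (- ?c * b i y powr (- real m / 2) * (2 * (y $ l - x i $ l)))" for i y
    proof -
      have "partial_deriv l (\<lambda>y. W i * riesz_kernel m R (b i y)) y = W i * partial_deriv l (\<lambda>y. riesz_kernel m R (b i y)) y"
        by (rule partial_deriv_cmult[OF smooth_differentiable[OF ks]])
      moreover have "partial_deriv l (\<lambda>y. riesz_kernel m R (b i y)) y
          = - ?c * b i y powr (- real m / 2) * partial_deriv l (b i) y"
        by (rule partial_deriv_compose(1)[OF kernel_deriv[OF b0] smooth_differentiable[OF bs]])
      ultimately show ?thesis by (simp add: bd)
    qed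
    ultimately show ?thesis by simp
  qed
  have d2: "partial_deriv k (partial_deriv l u) y = (\<Sum>i<N. W i * (- ?c * 2 * (b i y powr (- real m / 2) * (if k = l then 1 else 0)
      + - real m / 2 * b i y powr (- real m / 2 - 1) * (2 * (y $ k - x i $ k)) * (y $ l - x i $ l))))" for k l y
  proof -
    have eq: "partial_deriv l u = (\<lambda>y. \<Sum>i<N. (W i * (- ?c * 2)) * (b i y powr (- real m / 2) * (y $ l - x i $ l)))"
      unfolding d1 by (intro ext sum.cong) auto
    have D: "partial_deriv k (partial_deriv l u)
      = (\<lambda>y. \<Sum>i<N. partial_deriv k (\<lambda>y. (W i * (- ?c * 2)) * (b i y powr (- real m / 2) * (y $ l - x i $ l))) y)"
      unfolding eq by (rule partial_deriv_sum) (intro smooth_mult smooth_const ps cs)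
    have E: "partial_deriv k (\<lambda>y. (W i * (- ?c * 2)) * (b i y powr (- real m / 2) * (y $ l - x i $ l))) y
      = (W i * (- ?c * 2)) * ((- real m / 2 * b i y powr (- real m / 2 - 1) * (2 * (y $ k - x i $ k))) * (y $ l - x i $ l)
          + b i y powr (- real m / 2) * (if k = l then 1 else 0))" for i
    proof -
      have "partial_deriv k (\<lambda>y. y $ l - x i $ l) y = (if k = l then 1 else 0)"
        using partial_deriv_diff[OF smooth_differentiable[OF smooth_coord] smooth_differentiable[OF smooth_const], of k l "x i $ l" y]
        by (auto simp: partial_deriv_coord partial_deriv_const)
      moreover have "partial_deriv k (\<lambda>y. b i y powr (- real m / 2)) y
          = - real m / 2 * b i y powr (- real m / 2 - 1) * (2 * (y $ k - x i $ k))"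
      proof -
        have "partial_deriv k (\<lambda>y. b i y powr (- real m / 2)) y
            = - real m / 2 * b i y powr (- real m / 2 - 1) * partial_deriv k (b i) y"
          by (rule partial_deriv_compose(1)[OF has_real_derivative_powr[OF b0] smooth_differentiable[OF bs]])
        then show ?thesis by (simp add: bd)
      qed
      moreover have "partial_deriv k (\<lambda>y. b i y powr (- real m / 2) * (y $ l - x i $ l)) y
          = partial_deriv k (\<lambda>y. b i y powr (- real m / 2)) y * (y $ l - x i $ l)
            + b i y powr (- real m / 2) * partial_deriv k (\<lambda>y. y $ l - x i $ l) y"
        by (rule partial_deriv_mult[OF smooth_differentiable[OF ps] smooth_differentiable[OF cs]])
      moreover have "partial_deriv k (\<lambda>y. (W i * (- ?c * 2)) * (b i y powr (- real m / 2) * (y $ l - x i $ l))) y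
          = (W i * (- ?c * 2)) * partial_deriv k (\<lambda>y. b i y powr (- real m / 2) * (y $ l - x i $ l)) y"
        by (rule partial_deriv_cmult[OF smooth_differentiable[OF smooth_mult[OF ps cs]]])
      ultimately show ?thesis by simp
    qed
    show ?thesis unfolding D E by (intro sum.cong refl) (simp add: algebra_simps)
  qed
  show ?thesis
  proof (rule that[of \<eta> N "\<lambda>i. 2 * ?c * W i" x])
    show "0 \<le> 2 * ?c * W i" if "i < N" for i using u(2)[OF that] kernel_const_pos[OF m] by simp
    show "partial_deriv k (partial_deriv l u) = (\<lambda>y. \<Sum>i<N.
        - (2 * ?c * W i * (sqdist (x i) y + \<eta>) powr (- real m / 2 - 1)
          * ((sqdist (x i) y + \<eta>) * (if k = l then 1 else 0) - real m * ((y $ k - x i $ k) * (y $ l - x i $ l)))))" for k l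
      unfolding b_def[symmetric]
    proof (rule ext, unfold d2, intro sum.cong refl)
      fix y i
      have "b i y powr (- real m / 2) = b i y powr (- real m / 2 - 1) * b i y"
        using b0[of i y] powr_add[of "b i y" "- real m / 2 - 1" 1] by simp
      then show "W i * (- ?c * 2 * (b i y powr (- real m / 2) * (if k = l then 1 else 0)
        + - real m / 2 * b i y powr (- real m / 2 - 1) * (2 * (y $ k - x i $ k)) * (y $ l - x i $ l)))
        = - (2 * ?c * W i * b i y powr (- real m / 2 - 1)
          * (b i y * (if k = l then 1 else 0) - real m * ((y $ k - x i $ k) * (y $ l - x i $ l))))"
        by (simp only: gen)
    qed
  qed (use u in auto)
qed

section \<open>Removable singularities of divergence-free positive matrices\<close>

text \<open>As \<open>u > 1\<close> on \<open>K\<close>, the closed set \<open>u \<le> 1\<close>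
  misses \<open>K\<close>; outside it \<open>g\<close> vanishes, so the support of the product is a
  compact subset of the ball without \<open>K\<close>.\<close>

lemma vanishing_test:
  fixes f :: "real ^ 'n::finite \<Rightarrow> real"
  assumes f: "f \<in> test_functions (ball c r)" and u: "smooth u" "\<And>y. y \<in> K \<Longrightarrow> 1 < u y"
    and g: "smooth g" "\<And>y. 1 \<le> u y \<Longrightarrow> g y = 0"
  shows "(\<lambda>y. g y * f y) \<in> test_functions (ball c r - K)"
proof (rule test_functionsI[of _ "supp f \<inter> {y. u y \<le> 1}"])
  have "closed {y. u y \<le> 1}"
    by (intro closed_Collect_le smooth_continuous_on u continuous_on_const)
  then show "compact (supp f \<inter> {y. u y \<le> 1})"
    using test_functionsD(2)[OF f] by (intro compact_Int_closed)
  show "supp f \<inter> {y. u y \<le> 1} \<subseteq> ball c r - K"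
    using test_functionsD(3)[OF f] u(2) by fastforce
  show "g y * f y = 0" if "y \<notin> supp f \<inter> {y. u y \<le> 1}" for y
    using that supp_zero[of y f] g(2)[of y] by force
qed (intro smooth_mult g test_functionsD(1)[OF f])

text \<open>Serves to pass from \<open>T\<close> to its extension: \<open>w j * f\<close> is
  admissible for \<open>T\<close> and converges boundedly to \<open>f\<close> off
  \<open>K\<close>.\<close>

lemma cutoff_sequence:
  fixes K :: "(real ^ 'n::finite) set"
  assumes m: "2 \<le> m" and K: "compact K" "sigma_finite_hausdorff (m - 2) K"
  obtains w where "\<And>j::nat. smooth (w j)" "\<And>j y. y \<in> ball c r \<Longrightarrow> 0 \<le> w j y \<and> w j y \<le> 1"
    "\<And>j f. f \<in> test_functions (ball c r) \<Longrightarrow> (\<lambda>y. w j y * f y) \<in> test_functions (ball c r - K)"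
    "\<And>y. y \<notin> K \<Longrightarrow> (\<lambda>j. w j y) \<longlonglongrightarrow> 1"
proof -
  obtain R u where u: "\<And>j. riesz_potential m R (u j)" "\<And>j y. y \<in> K \<Longrightarrow> 1 < u j y"
    "\<And>j y. y \<in> ball c r \<Longrightarrow> 0 \<le> u j y" "\<And>y. y \<notin> K \<Longrightarrow> (\<lambda>j::nat. u j y) \<longlonglongrightarrow> 0"
    by (rule potential_sequence[OF m K bounded_ball], rule that)
  have us: "smooth (u j)" for j by (rule riesz_potential_smooth[OF u(1)])
  have ws: "smooth (\<lambda>y. cutoff 0 (u j y))" for j using smooth_compose[OF cutoff_chain us] by simp
  show ?thesis
  proof (rule that[of "\<lambda>j y. cutoff 0 (u j y)"])
    show "0 \<le> cutoff 0 (u j y) \<and> cutoff 0 (u j y) \<le> 1" if "y \<in> ball c r" for j y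
      using cutoff_nonneg cutoff_le_1[OF u(3)[OF that]] by simp
    show "(\<lambda>y. cutoff 0 (u j y) * f y) \<in> test_functions (ball c r - K)"
      if "f \<in> test_functions (ball c r)" for j f
      by (rule vanishing_test[OF that us[of j] u(2) ws]) (auto simp: cutoff_zero)
    have "isCont (cutoff 0) 0"
      using cutoff_chain unfolding derivative_chain_def by (metis DERIV_isCont UNIV_I)
    then have "(\<lambda>j. cutoff 0 (u j y)) \<longlonglongrightarrow> cutoff 0 0" if "y \<notin> K" for y
      using u(4)[OF that] isCont_tendsto_compose by blast
    then show "(\<lambda>j. cutoff 0 (u j y)) \<longlonglongrightarrow> 1" if "y \<notin> K" for y
      using that by (simp add: cutoff_0_0)
  qed (rule ws)
qed

text \<open>\<open>S k l\<close> are the coefficients of \<open>T \<and> \<beta>^(m - 1)\<close>; \<open>hessian_pos\<close> says that at almost every point the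
  largest eigenvalue of \<open>S\<close> is at most \<open>1 / m\<close> times its trace.\<close>

locale stationary_matrix =
  fixes c :: "real ^ 'n::finite" and r :: real and K :: "(real ^ 'n) set" and m :: nat
    and S :: "'n \<Rightarrow> 'n \<Rightarrow> (real ^ 'n \<Rightarrow> real) \<Rightarrow> real"
  assumes m: "2 \<le> m"
    and K: "compact K" "sigma_finite_hausdorff (m - 2) K"
    and add: "f \<in> test_functions (ball c r) \<Longrightarrow> g \<in> test_functions (ball c r) \<Longrightarrow>
      S k l (\<lambda>x. f x + g x) = S k l f + S k l g"
    and scale: "f \<in> test_functions (ball c r) \<Longrightarrow> S k l (\<lambda>x. a * f x) = a * S k l f"
    and symmetric: "f \<in> test_functions (ball c r) \<Longrightarrow> S k l f = S l k f"
    and pos: "f \<in> test_functions (ball c r) \<Longrightarrow> (\<And>x. 0 \<le> f x) \<Longrightarrow> (\<And>k. smooth (v k)) \<Longrightarrow>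
      0 \<le> (\<Sum>k\<in>UNIV. \<Sum>l\<in>UNIV. S k l (\<lambda>x. f x * (v k x * v l x)))"
    and hessian_pos: "f \<in> test_functions (ball c r) \<Longrightarrow> (\<And>x. 0 \<le> f x) \<Longrightarrow> 0 < \<eta> \<Longrightarrow>
      0 \<le> (\<Sum>k\<in>UNIV. \<Sum>l\<in>UNIV. S k l (\<lambda>x. f x * ((sqdist y x + \<eta>) * (if k = l then 1 else 0)
        - real m * ((x $ k - y $ k) * (x $ l - y $ l)))))"
    and divergence_free: "f \<in> test_functions (ball c r - K) \<Longrightarrow> (\<Sum>k\<in>UNIV. S k l (partial_deriv k f)) = 0"
    and bounded: "compact C \<Longrightarrow> C \<subseteq> ball c r \<Longrightarrow> \<exists>M. \<forall>f B. f \<in> test_functions (ball c r) \<longrightarrow>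
      supp f \<subseteq> C \<longrightarrow> (\<forall>x. \<bar>f x\<bar> \<le> B) \<longrightarrow> \<bar>S k l f\<bar> \<le> M * B"
    and convergence: "(\<And>j. F j \<in> test_functions (ball c r)) \<Longrightarrow> f \<in> test_functions (ball c r) \<Longrightarrow>
      compact C \<Longrightarrow> C \<subseteq> ball c r \<Longrightarrow> (\<And>j. supp (F j) \<subseteq> C) \<Longrightarrow> (\<And>j x. \<bar>F j x\<bar> \<le> B) \<Longrightarrow>
      (\<And>x. x \<in> ball c r - K \<Longrightarrow> (\<lambda>j. F j x) \<longlonglongrightarrow> f x) \<Longrightarrow> (\<lambda>j. S k l (F j)) \<longlonglongrightarrow> S k l f"
begin

abbreviation "test \<equiv> test_functions (ball c r)"

lemma zero: "S k l (\<lambda>x. 0) = 0"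
  using scale[OF test_zero, of k l 0] by simp

lemma minus: "f \<in> test \<Longrightarrow> S k l (\<lambda>x. - f x) = - S k l f"
  using scale[of f k l "-1"] by simp

lemma diff:
  assumes "f \<in> test" "g \<in> test"
  shows "S k l (\<lambda>x. f x - g x) = S k l f - S k l g"
  using add[OF assms(1) test_cmult[OF assms(2), of "-1"], of k l] minus[OF assms(2), of k l] by simp

lemma sum:
  assumes "\<And>i. i \<in> A \<Longrightarrow> f i \<in> test"
  shows "S k l (\<lambda>x. \<Sum>i\<in>A. f i x) = (\<Sum>i\<in>A. S k l (f i))"
  using assms
  by (induction A rule: infinite_finite_induct) (simp_all add: zero add test_sum)

text \<open>Each term of the Hessian is minus a nonnegative weight times a matrix of the kind in
  \<open>hessian_pos\<close>; the weight is absorbed into the test function.\<close>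

lemma superharmonic:
  assumes u: "riesz_potential m R u" and f: "f \<in> test" "\<And>x. 0 \<le> f x"
  shows "(\<Sum>k\<in>UNIV. \<Sum>l\<in>UNIV. S k l (\<lambda>x. f x * partial_deriv k (partial_deriv l u) x)) \<le> 0"
proof -
  obtain N and x :: "nat \<Rightarrow> real ^ 'n" and W \<eta> where u: "0 < \<eta>" "\<And>i. i < N \<Longrightarrow> 0 \<le> W i"
    "\<And>k l. partial_deriv k (partial_deriv l u) = (\<lambda>y. \<Sum>i<N.
        - (W i * (sqdist (x i) y + \<eta>) powr (- real m / 2 - 1)
          * ((sqdist (x i) y + \<eta>) * (if k = l then 1 else 0) - real m * ((y $ k - x i $ k) * (y $ l - x i $ l)))))"
    by (rule riesz_potential_hessian[OF m u], rule that)
  define g where "g i y = f y * (W i * (sqdist (x i) y + \<eta>) powr (- real m / 2 - 1))" for i y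
  define H where "H i k l y = (sqdist (x i) y + \<eta>) * (if k = l then 1 else 0)
    - real m * ((y $ k - x i $ k) * (y $ l - x i $ l))" for i k l y
  have b: "0 < sqdist (x i) y + \<eta>" for i y using sqdist_nonneg[of "x i" y] u(1) by simp
  have g: "g i \<in> test" for i
    unfolding g_def
    by (intro test_mult(1)[OF f(1)] smooth_mult smooth_const smooth_powr smooth_add smooth_sqdist b)
  have g0: "0 \<le> g i y" if "i < N" for i y using u(2)[OF that] f(2)[of y] by (simp add: g_def)
  have H: "smooth (H i k l)" for i k l
    unfolding H_def
    by (intro smooth_diff smooth_mult smooth_const smooth_add smooth_sqdist smooth_coord)
  have gH: "(\<lambda>y. g i y * H i k l y) \<in> test" for i k l by (rule test_mult(1)[OF g H])
  have "S k l (\<lambda>y. f y * partial_deriv k (partial_deriv l u) y)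
    = - (\<Sum>i<N. S k l (\<lambda>y. g i y * H i k l y))" for k l
  proof -
    have "(\<lambda>y. f y * partial_deriv k (partial_deriv l u) y) = (\<lambda>y. - (\<Sum>i<N. g i y * H i k l y))"
      unfolding u(3) g_def H_def by (simp add: sum_distrib_left sum_negf mult.assoc)
    moreover have "S k l (\<lambda>y. - (\<Sum>i<N. g i y * H i k l y)) = - S k l (\<lambda>y. \<Sum>i<N. g i y * H i k l y)"
      by (intro minus test_sum gH)
    moreover have "S k l (\<lambda>y. \<Sum>i<N. g i y * H i k l y) = (\<Sum>i<N. S k l (\<lambda>y. g i y * H i k l y))"
      by (intro sum gH)
    ultimately show ?thesis by simp
  qed
  then have "(\<Sum>k\<in>UNIV. \<Sum>l\<in>UNIV. S k l (\<lambda>y. f y * partial_deriv k (partial_deriv l u) y))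
    = - (\<Sum>k\<in>UNIV. \<Sum>l\<in>UNIV. \<Sum>i<N. S k l (\<lambda>y. g i y * H i k l y))"
    by (simp add: sum_negf)
  also have "(\<Sum>k\<in>UNIV. \<Sum>l\<in>UNIV. \<Sum>i<N. S k l (\<lambda>y. g i y * H i k l y))
    = (\<Sum>i<N. \<Sum>k\<in>UNIV. \<Sum>l\<in>UNIV. S k l (\<lambda>y. g i y * H i k l y))"
    by (rule sum_rotate[symmetric])
  finally show ?thesis
  proof (rule ord_eq_le_trans)
    have "0 \<le> (\<Sum>i<N. \<Sum>k\<in>UNIV. \<Sum>l\<in>UNIV. S k l (\<lambda>y. g i y * H i k l y))"
    proof (rule sum_nonneg)
      fix i assume "i \<in> {..<N}"
      then show "0 \<le> (\<Sum>k\<in>UNIV. \<Sum>l\<in>UNIV. S k l (\<lambda>y. g i y * H i k l y))"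
        using hessian_pos[OF g g0 u(1), of i "x i"] unfolding H_def by simp
    qed
    then show "- (\<Sum>i<N. \<Sum>k\<in>UNIV. \<Sum>l\<in>UNIV. S k l (\<lambda>y. g i y * H i k l y)) \<le> 0" by simp
  qed
qed

text \<open>Caccioppoli's inequality: the function \<open>w\<close> is convex in \<open>u\<close>, so its energy is controlled
  by its Laplacian, which can be moved to the test function.\<close>

lemma energy_bound:
  assumes u: "riesz_potential m R u" "\<And>y. y \<in> K \<Longrightarrow> 1 < u y" "\<And>y. y \<in> ball c r \<Longrightarrow> 0 \<le> u y"
    and f: "f \<in> test" "\<And>x. 0 \<le> f x" and w: "w = (\<lambda>y. cutoff 0 (u y))"
  shows "(\<Sum>k\<in>UNIV. \<Sum>l\<in>UNIV. S k l (\<lambda>x. f x * (partial_deriv k w x * partial_deriv l w x)))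
    \<le> 2 * (\<Sum>k\<in>UNIV. \<Sum>l\<in>UNIV. S k l (\<lambda>x. w x * partial_deriv k (partial_deriv l f) x))"
proof -
  let ?d = partial_deriv
  have us: "smooth u" by (rule riesz_potential_smooth[OF u(1)])
  have cs: "smooth (\<lambda>y. cutoff i (u y))" for i using smooth_compose[OF cutoff_chain us] by simp
  have ws: "smooth w" unfolding w by (rule cs)
  have fs: "smooth f" by (rule test_functionsD(1)[OF f(1)])
  have dcutoff: "?d k (\<lambda>y. cutoff i (u y)) x = cutoff (Suc i) (u x) * ?d k u x" for k i x
    using cutoff_chain unfolding derivative_chain_def
    by (intro partial_deriv_compose(1) smooth_differentiable us) simp
  have dw: "?d k w = (\<lambda>x. cutoff 1 (u x) * ?d k u x)" for k
    unfolding w using dcutoff[of k 0] by (intro ext) simp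
  have ddw: "?d k (?d l w) x = cutoff 2 (u x) * (?d k u x * ?d l u x) + cutoff 1 (u x) * ?d k (?d l u) x" for k l x
  proof -
    have "?d k (\<lambda>x. cutoff 1 (u x) * ?d l u x) x
        = ?d k (\<lambda>x. cutoff 1 (u x)) x * ?d l u x + cutoff 1 (u x) * ?d k (?d l u) x"
      by (intro partial_deriv_mult smooth_differentiable cs smooth_partial_deriv us)
    then show ?thesis unfolding dw by (simp add: dcutoff numeral_2_eq_2)
  qed
  \<comment> \<open>With \<open>w = G(u)\<close> the chain rule gives
    \<open>2 f D^2 w - f dw dw = P du du - 2 Q D^2 u\<close>. Both \<open>P\<close> and
    \<open>Q\<close> are nonnegative, by \<open>cutoff_gradient\<close> and since \<open>G\<close>
    decreases, so positivity of \<open>S\<close> and superharmonicity of \<open>u\<close> give the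
    right-hand side a sign.\<close>
  define P where "P = (\<lambda>x. f x * (2 * cutoff 2 (u x) - (cutoff 1 (u x))\<^sup>2))"
  define Q where "Q = (\<lambda>x. - (f x * cutoff 1 (u x)))"
  have P: "P \<in> test" unfolding P_def
    by (intro test_mult(1)[OF f(1)] smooth_diff smooth_mult smooth_const smooth_power cs)
  have P0: "0 \<le> P x" for x
  proof (cases "x \<in> ball c r")
    case True
    then show ?thesis using f(2)[of x] cutoff_gradient[OF u(3)] by (simp add: P_def)
  next
    case False
    then have "f x = 0" using test_functionsD(3)[OF f(1)] supp_zero by blast
    then show ?thesis by (simp add: P_def)
  qed
  have Q: "Q \<in> test" unfolding Q_def
    using test_cmult[OF test_mult(1)[OF f(1) cs[of 1]], of "-1"] by simp
  have Q0: "0 \<le> Q x" for x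
    using f(2)[of x] cutoff_1_nonpos[of "u x"] by (simp add: Q_def mult_nonneg_nonpos)
  have du: "smooth (?d k u)" and ddu: "smooth (?d k (?d l u))" for k l
    by (intro smooth_partial_deriv us)+
  have eq: "2 * S k l (\<lambda>x. f x * ?d k (?d l w) x) - S k l (\<lambda>x. f x * (?d k w x * ?d l w x))
     = S k l (\<lambda>x. P x * (?d k u x * ?d l u x)) - 2 * S k l (\<lambda>x. Q x * ?d k (?d l u) x)" for k l
  proof -
    have t1: "(\<lambda>x. f x * ?d k (?d l w) x) \<in> test"
      by (intro test_mult(1)[OF f(1)] smooth_partial_deriv ws)
    have t2: "(\<lambda>x. f x * (?d k w x * ?d l w x)) \<in> test"
      by (intro test_mult(1)[OF f(1)] smooth_partial_deriv ws smooth_mult)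
    have t3: "(\<lambda>x. P x * (?d k u x * ?d l u x)) \<in> test"
      by (intro test_mult(1)[OF P] smooth_mult du)
    have t4: "(\<lambda>x. Q x * ?d k (?d l u) x) \<in> test"
      by (intro test_mult(1)[OF Q] ddu)
    have "2 * S k l (\<lambda>x. f x * ?d k (?d l w) x) - S k l (\<lambda>x. f x * (?d k w x * ?d l w x))
      = S k l (\<lambda>x. 2 * (f x * ?d k (?d l w) x) - f x * (?d k w x * ?d l w x))"
      using diff[OF test_cmult[OF t1, of 2] t2, of k l] scale[OF t1, of k l 2] by simp
    also have "(\<lambda>x. 2 * (f x * ?d k (?d l w) x) - f x * (?d k w x * ?d l w x))
      = (\<lambda>x. P x * (?d k u x * ?d l u x) - 2 * (Q x * ?d k (?d l u) x))"
      unfolding ddw unfolding dw P_def Q_def by (intro ext) (simp add: algebra_simps power2_eq_square)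
    also have "S k l \<dots> = S k l (\<lambda>x. P x * (?d k u x * ?d l u x)) - 2 * S k l (\<lambda>x. Q x * ?d k (?d l u) x)"
      using diff[OF t3 test_cmult[OF t4, of 2], of k l] scale[OF t4, of k l 2] by simp
    finally show ?thesis .
  qed
  have "2 * (\<Sum>k\<in>UNIV. \<Sum>l\<in>UNIV. S k l (\<lambda>x. f x * ?d k (?d l w) x))
      - (\<Sum>k\<in>UNIV. \<Sum>l\<in>UNIV. S k l (\<lambda>x. f x * (?d k w x * ?d l w x)))
    = (\<Sum>k\<in>UNIV. \<Sum>l\<in>UNIV. S k l (\<lambda>x. P x * (?d k u x * ?d l u x)))
      - 2 * (\<Sum>k\<in>UNIV. \<Sum>l\<in>UNIV. S k l (\<lambda>x. Q x * ?d k (?d l u) x))"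
    by (simp only: sum_distrib_left sum_subtractf[symmetric] eq)
  moreover have "0 \<le> (\<Sum>k\<in>UNIV. \<Sum>l\<in>UNIV. S k l (\<lambda>x. P x * (?d k u x * ?d l u x)))"
    by (intro pos P P0 du)
  moreover note superharmonic[OF u(1) Q Q0]
  ultimately have le: "(\<Sum>k\<in>UNIV. \<Sum>l\<in>UNIV. S k l (\<lambda>x. f x * (?d k w x * ?d l w x)))
      \<le> 2 * (\<Sum>k\<in>UNIV. \<Sum>l\<in>UNIV. S k l (\<lambda>x. f x * ?d k (?d l w) x))"
    by linarith
  have df: "?d l f \<in> test" "?d k (?d l f) \<in> test" for k l
    by (intro test_partial_deriv f(1))+
  have dws: "smooth (?d k w)" "smooth (?d k (?d l w))" for k l by (intro smooth_partial_deriv ws)+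
  have w0: "1 \<le> u y \<Longrightarrow> w y = 0" "1 \<le> u y \<Longrightarrow> ?d l w y = 0" for y l
    unfolding dw by (simp_all add: w cutoff_zero)
  \<comment> \<open>Two integrations by parts move the second derivatives from \<open>w\<close> to
    \<open>f\<close>. The tested functions \<open>f * ?d l w\<close> and \<open>w * ?d l f\<close>
    vanish near \<open>K\<close>, so the divergence equation off \<open>K\<close> applies; the mixed
    terms agree by the symmetry of \<open>S\<close>.\<close>
  have 1: "(\<Sum>k\<in>UNIV. S k l (\<lambda>x. ?d l w x * ?d k f x)) + (\<Sum>k\<in>UNIV. S k l (\<lambda>x. f x * ?d k (?d l w) x)) = 0" for l
  proof -
    have "?d k (\<lambda>x. ?d l w x * f x) = (\<lambda>x. f x * ?d k (?d l w) x + ?d l w x * ?d k f x)" for k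
      by (rule ext, subst partial_deriv_mult) (intro smooth_differentiable dws fs | simp add: mult.commute)+
    then have "S k l (?d k (\<lambda>x. ?d l w x * f x))
        = S k l (\<lambda>x. f x * ?d k (?d l w) x) + S k l (\<lambda>x. ?d l w x * ?d k f x)" for k
      using add[OF test_mult(1)[OF f(1) dws(2)] test_mult(2)[OF df(1) dws(1)]] by simp
    moreover have "(\<Sum>k\<in>UNIV. S k l (?d k (\<lambda>x. ?d l w x * f x))) = 0"
      by (rule divergence_free[OF vanishing_test[OF f(1) us u(2) dws(1) w0(2)]])
    ultimately show ?thesis by (simp add: sum.distrib)
  qed
  have 2: "(\<Sum>k\<in>UNIV. S k l (\<lambda>x. ?d k w x * ?d l f x)) + (\<Sum>k\<in>UNIV. S k l (\<lambda>x. w x * ?d k (?d l f) x)) = 0" for l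
  proof -
    have "?d k (\<lambda>x. w x * ?d l f x) = (\<lambda>x. ?d k w x * ?d l f x + w x * ?d k (?d l f) x)" for k
      by (rule ext, rule partial_deriv_mult) (intro smooth_differentiable ws smooth_partial_deriv fs)+
    then have "S k l (?d k (\<lambda>x. w x * ?d l f x))
        = S k l (\<lambda>x. ?d k w x * ?d l f x) + S k l (\<lambda>x. w x * ?d k (?d l f) x)" for k
      using add[OF test_mult(2)[OF df(1) dws(1)] test_mult(2)[OF df(2) ws]] by simp
    moreover have "(\<Sum>k\<in>UNIV. S k l (?d k (\<lambda>x. w x * ?d l f x))) = 0"
      by (rule divergence_free[OF vanishing_test[OF df(1) us u(2) ws w0(1)]])
    ultimately show ?thesis by (simp add: sum.distrib)
  qed
  have sw: "(\<Sum>l\<in>UNIV. \<Sum>k\<in>UNIV. S k l (\<lambda>x. ?d l w x * ?d k f x))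
      = (\<Sum>l\<in>UNIV. \<Sum>k\<in>UNIV. S k l (\<lambda>x. ?d k w x * ?d l f x))"
  proof -
    have "S k l (\<lambda>x. ?d l w x * ?d k f x) = S l k (\<lambda>x. ?d l w x * ?d k f x)" for k l
      by (rule symmetric[OF test_mult(2)[OF df(1) dws(1)]])
    then show ?thesis by (subst sum.swap) simp
  qed
  have "(\<Sum>l\<in>UNIV. \<Sum>k\<in>UNIV. S k l (\<lambda>x. ?d l w x * ?d k f x))
      + (\<Sum>l\<in>UNIV. \<Sum>k\<in>UNIV. S k l (\<lambda>x. f x * ?d k (?d l w) x)) = 0"
    using 1 by (simp flip: sum.distrib)
  moreover have "(\<Sum>l\<in>UNIV. \<Sum>k\<in>UNIV. S k l (\<lambda>x. ?d k w x * ?d l f x))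
      + (\<Sum>l\<in>UNIV. \<Sum>k\<in>UNIV. S k l (\<lambda>x. w x * ?d k (?d l f) x)) = 0"
    using 2 by (simp flip: sum.distrib)
  ultimately have "(\<Sum>l\<in>UNIV. \<Sum>k\<in>UNIV. S k l (\<lambda>x. f x * ?d k (?d l w) x))
      = (\<Sum>l\<in>UNIV. \<Sum>k\<in>UNIV. S k l (\<lambda>x. w x * ?d k (?d l f) x))"
    using sw by linarith
  then have "(\<Sum>k\<in>UNIV. \<Sum>l\<in>UNIV. S k l (\<lambda>x. f x * ?d k (?d l w) x))
      = (\<Sum>k\<in>UNIV. \<Sum>l\<in>UNIV. S k l (\<lambda>x. w x * ?d k (?d l f) x))"
    by (subst (1 2) sum.swap)
  then show ?thesis using le by simp
qed

text \<open>After Caccioppoli's inequality only \<open>0 \<le> w \<le> 1\<close> and the second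
  derivatives of \<open>f\<close> enter, and \<open>S\<close> has order zero, so one constant serves
  for all potentials.\<close>

lemma energy_uniform:
  assumes f: "f \<in> test" "\<And>x. 0 \<le> f x"
  obtains E where "\<And>R u. riesz_potential m R u \<Longrightarrow> (\<And>y. y \<in> K \<Longrightarrow> 1 < u y) \<Longrightarrow>
      (\<And>y. y \<in> ball c r \<Longrightarrow> 0 \<le> u y) \<Longrightarrow>
    (\<Sum>k\<in>UNIV. \<Sum>l\<in>UNIV. S k l (\<lambda>x. f x * (partial_deriv k (\<lambda>y. cutoff 0 (u y)) x * partial_deriv l (\<lambda>y. cutoff 0 (u y)) x))) \<le> E"
proof -
  let ?d = partial_deriv
  have df: "?d k (?d l f) \<in> test" for k l
    by (intro test_partial_deriv f(1))
  have "\<exists>E. \<forall>w. smooth w \<longrightarrow> (\<forall>x\<in>ball c r. 0 \<le> w x \<and> w x \<le> 1) \<longrightarrow>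
      S k l (\<lambda>x. w x * ?d k (?d l f) x) \<le> E" for k l
  proof -
    let ?g = "?d k (?d l f)"
    obtain B where B: "0 \<le> B" "\<And>x. \<bar>?g x\<bar> \<le> B" by (rule test_bounded[OF df[of k l]], rule that)
    obtain M where M: "\<And>h B. h \<in> test \<Longrightarrow> supp h \<subseteq> supp ?g \<Longrightarrow> (\<forall>x. \<bar>h x\<bar> \<le> B) \<Longrightarrow> \<bar>S k l h\<bar> \<le> M * B"
      using bounded[of "supp ?g" k l] test_functionsD[OF df, of k l] by metis
    have "S k l (\<lambda>x. w x * ?g x) \<le> M * B"
      if w: "smooth w" "\<forall>x\<in>ball c r. 0 \<le> w x \<and> w x \<le> 1" for w
    proof -
      have "\<bar>w x * ?g x\<bar> \<le> B" for x
      proof (cases "x \<in> ball c r")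
        case True
        then have "\<bar>w x * ?g x\<bar> \<le> 1 * B"
          unfolding abs_mult using w(2) B by (intro mult_mono) auto
        then show ?thesis by simp
      next
        case False
        then have "?g x = 0" using test_functionsD(3)[OF df] supp_zero by blast
        then show ?thesis using B(1) by simp
      qed
      then have "\<bar>S k l (\<lambda>x. w x * ?g x)\<bar> \<le> M * B"
        by (intro M test_mult(2)[OF df w(1)] supp_subset) auto
      then show ?thesis by simp
    qed
    then show ?thesis by (intro exI[of _ "M * B"]) simp
  qed
  then obtain E where E: "\<And>k l w. smooth w \<Longrightarrow> (\<forall>x\<in>ball c r. 0 \<le> w x \<and> w x \<le> 1) \<Longrightarrow>
      S k l (\<lambda>x. w x * ?d k (?d l f) x) \<le> E k l" by metis
  show ?thesis
  proof (rule that[of "2 * (\<Sum>k\<in>UNIV. \<Sum>l\<in>UNIV. E k l)"])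
    fix R u assume u: "riesz_potential m R u" "\<And>y. y \<in> K \<Longrightarrow> 1 < u y" "\<And>y. y \<in> ball c r \<Longrightarrow> 0 \<le> u y"
    let ?w = "\<lambda>y. cutoff 0 (u y)"
    have "(\<Sum>k\<in>UNIV. \<Sum>l\<in>UNIV. S k l (\<lambda>x. f x * (?d k ?w x * ?d l ?w x)))
      \<le> 2 * (\<Sum>k\<in>UNIV. \<Sum>l\<in>UNIV. S k l (\<lambda>x. ?w x * ?d k (?d l f) x))"
      by (rule energy_bound[OF u f refl])
    also have "\<dots> \<le> 2 * (\<Sum>k\<in>UNIV. \<Sum>l\<in>UNIV. E k l)"
    proof (intro mult_left_mono sum_mono E)
      show "smooth ?w" using smooth_compose[OF cutoff_chain riesz_potential_smooth[OF u(1)]] by simp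
      show "\<forall>x\<in>ball c r. 0 \<le> ?w x \<and> ?w x \<le> 1" using u(3) cutoff_nonneg cutoff_le_1 by auto
    qed simp
    finally show "(\<Sum>k\<in>UNIV. \<Sum>l\<in>UNIV. S k l (\<lambda>x. f x * (?d k ?w x * ?d l ?w x)))
      \<le> 2 * (\<Sum>k\<in>UNIV. \<Sum>l\<in>UNIV. E k l)" .
  qed
qed

text \<open>The divergence equation for \<open>(2 w - w^2) f\<close> reads
  \<open>X j = - 2 * Y j\<close>, where \<open>Y j\<close> pairs the gradient of \<open>w j\<close>
  with \<open>(1 - w j) f\<close>. Cauchy--Schwarz controls \<open>Y j\<close> by the energy, which
  is at most \<open>E\<close>, and by \<open>Q j\<close>, which tends to 0, while \<open>X j\<close>
  tends to the sum in question.\<close>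

theorem removable:
  assumes f: "f \<in> test"
  shows "(\<Sum>k\<in>UNIV. S k l (partial_deriv k f)) = 0"
proof -
  let ?d = partial_deriv
  obtain R u where u: "\<And>j. riesz_potential m R (u j)" "\<And>j y. y \<in> K \<Longrightarrow> 1 < u j y"
    "\<And>j y. y \<in> ball c r \<Longrightarrow> 0 \<le> u j y" "\<And>y. y \<notin> K \<Longrightarrow> (\<lambda>j::nat. u j y) \<longlonglongrightarrow> 0"
    by (rule potential_sequence[OF m K bounded_ball], rule that)
  define w where "w j = (\<lambda>y. cutoff 0 (u j y))" for j
  have us: "smooth (u j)" for j by (rule riesz_potential_smooth[OF u(1)])
  have ws: "smooth (w j)" for j unfolding w_def using smooth_compose[OF cutoff_chain us] by simp
  have w01: "0 \<le> w j y \<and> w j y \<le> 1" if "y \<in> ball c r" for j y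
    unfolding w_def using cutoff_nonneg cutoff_le_1[OF u(3)[OF that]] by simp
  have wlim: "(\<lambda>j. w j y) \<longlonglongrightarrow> 1" if "y \<notin> K" for y
  proof -
    have "isCont (cutoff 0) 0"
      using cutoff_chain unfolding derivative_chain_def by (metis DERIV_isCont UNIV_I)
    then have "(\<lambda>j. cutoff 0 (u j y)) \<longlonglongrightarrow> cutoff 0 0"
      using u(4)[OF that] isCont_tendsto_compose by blast
    then show ?thesis by (simp add: w_def cutoff_0_0)
  qed
  \<comment> \<open>The energy bound needs a nonnegative weight; \<open>\<psi>\<close> is 1 on the
    support of \<open>f\<close> and so may be inserted next to any factor \<open>f\<close>.\<close>
  obtain \<psi> where \<psi>: "\<psi> \<in> test" "\<And>x. \<psi> x \<ge> 0" "\<And>x. x \<in> supp f \<Longrightarrow> \<psi> x = 1"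
    by (rule bump_exists[OF test_functionsD(2,3)[OF f]], rule that)
  have \<psi>f: "\<psi> x * f x = f x" for x
    using \<psi>(3)[of x] supp_zero[of x f] by (cases "x \<in> supp f") auto
  obtain E where E: "\<And>j. (\<Sum>k\<in>UNIV. \<Sum>l\<in>UNIV. S k l (\<lambda>x. \<psi> x * (?d k (w j) x * ?d l (w j) x))) \<le> E"
    using u(1-3) unfolding w_def by (rule_tac energy_uniform[OF \<psi>(1,2)], blast)
  have dws: "smooth (?d k (w j))" for k j by (intro smooth_partial_deriv ws)
  have df: "?d k f \<in> test" for k by (rule test_partial_deriv[OF f])
  define X where "X j = (\<Sum>k\<in>UNIV. S k l (\<lambda>x. ?d k f x * (2 * w j x - (w j x)\<^sup>2)))" for j
  define Y where "Y j = (\<Sum>k\<in>UNIV. S k l (\<lambda>x. f x * (1 - w j x) * ?d k (w j) x))" for j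
  define Q where "Q j = S l l (\<lambda>x. f x * f x * (1 - w j x)\<^sup>2)" for j
  have fs: "smooth f" by (rule test_functionsD(1)[OF f])
  have chis: "smooth (\<lambda>x. 2 * w j x - (w j x)\<^sup>2)" for j
    by (intro smooth_diff smooth_mult smooth_power smooth_const ws)
  have gs: "smooth (\<lambda>x. 1 - w j x)" for j by (intro smooth_diff smooth_const ws)
  have XY: "X j = - (2 * Y j)" for j
  proof -
    have dchi: "?d k (\<lambda>x. 2 * w j x - (w j x)\<^sup>2) x = 2 * ((1 - w j x) * ?d k (w j) x)" for k x
    proof -
      have "?d k (\<lambda>x. w j x * w j x) x = ?d k (w j) x * w j x + w j x * ?d k (w j) x"
        by (intro partial_deriv_mult smooth_differentiable ws)
      moreover have "?d k (\<lambda>x. 2 * w j x) x = 2 * ?d k (w j) x"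
        by (intro partial_deriv_cmult smooth_differentiable ws)
      moreover have "?d k (\<lambda>x. 2 * w j x - w j x * w j x) x = ?d k (\<lambda>x. 2 * w j x) x - ?d k (\<lambda>x. w j x * w j x) x"
        by (intro partial_deriv_diff smooth_differentiable smooth_mult smooth_const ws)
      ultimately show ?thesis by (simp add: power2_eq_square algebra_simps)
    qed
    have "?d k (\<lambda>x. (2 * w j x - (w j x)\<^sup>2) * f x)
        = (\<lambda>x. ?d k f x * (2 * w j x - (w j x)\<^sup>2) + 2 * (f x * (1 - w j x) * ?d k (w j) x))" for k
    proof
      fix x
      have "?d k (\<lambda>x. (2 * w j x - (w j x)\<^sup>2) * f x) x
        = ?d k (\<lambda>x. 2 * w j x - (w j x)\<^sup>2) x * f x + (2 * w j x - (w j x)\<^sup>2) * ?d k f x"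
        by (intro partial_deriv_mult smooth_differentiable chis fs)
      then show "?d k (\<lambda>x. (2 * w j x - (w j x)\<^sup>2) * f x) x
        = ?d k f x * (2 * w j x - (w j x)\<^sup>2) + 2 * (f x * (1 - w j x) * ?d k (w j) x)"
        by (simp add: dchi algebra_simps)
    qed
    moreover have "(\<lambda>x. ?d k f x * (2 * w j x - (w j x)\<^sup>2)) \<in> test" for k
      by (rule test_mult(1)[OF df chis])
    moreover have t: "(\<lambda>x. f x * (1 - w j x) * ?d k (w j) x) \<in> test" for k
      by (intro test_mult(1) f gs dws)
    ultimately have "S k l (?d k (\<lambda>x. (2 * w j x - (w j x)\<^sup>2) * f x))
        = S k l (\<lambda>x. ?d k f x * (2 * w j x - (w j x)\<^sup>2)) + 2 * S k l (\<lambda>x. f x * (1 - w j x) * ?d k (w j) x)" for k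
      using scale[OF t, of k l 2 k] by (simp only: add test_cmult)
    moreover have "(\<Sum>k\<in>UNIV. S k l (?d k (\<lambda>x. (2 * w j x - (w j x)\<^sup>2) * f x))) = 0"
      by (intro divergence_free vanishing_test[OF f us[of j] u(2) chis]) (auto simp: w_def cutoff_zero)
    ultimately have "X j + 2 * Y j = 0"
      unfolding X_def Y_def by (simp add: sum.distrib sum_distrib_left)
    then show ?thesis by simp
  qed
  \<comment> \<open>Cauchy--Schwarz with a free parameter \<open>h\<close>, which is sent to 0 only
    after \<open>j\<close> has tended to infinity.\<close>
  have young: "\<bar>X j\<bar> \<le> h\<^sup>2 * E + Q j / h\<^sup>2" if h: "0 < h" for h j
  proof -
    have main: "s * X j \<le> h\<^sup>2 * E + Q j / h\<^sup>2" if s: "s * s = 1" for s :: real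
    proof -
      define g where "g x = f x * (1 - w j x)" for x
      define e where "e k = (if k = l then 1 else 0 :: real)" for k
      \<comment> \<open>Positivity of \<open>S\<close> on the vector
        \<open>h dw + (s / h) (1 - w) f e_l\<close>, for \<open>s = 1\<close> and
        \<open>s = - 1\<close>, bounds the mixed term from both sides.\<close>
      define v where "v k x = h * ?d k (w j) x + s / h * g x * e k" for k x
      have gs': "smooth g" unfolding g_def by (intro smooth_mult fs gs)
      have vs: "smooth (v k)" for k
        unfolding v_def by (intro smooth_add smooth_mult smooth_const dws gs')
      have t1: "(\<lambda>x. \<psi> x * (?d k (w j) x * ?d p (w j) x)) \<in> test" for k p
        by (intro test_mult(1)[OF \<psi>(1)] smooth_mult dws)
      have gt: "g \<in> test" unfolding g_def by (rule test_mult(1)[OF f gs])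
      have t2: "(\<lambda>x. g x * ?d k (w j) x) \<in> test" for k by (rule test_mult(1)[OF gt dws])
      have t3: "(\<lambda>x. f x * f x * (1 - w j x)\<^sup>2) \<in> test"
        by (intro test_mult(1)[OF test_mult(1)[OF f fs]] smooth_power gs)
      have exp: "\<psi> x * (v k x * v p x) = h\<^sup>2 * (\<psi> x * (?d k (w j) x * ?d p (w j) x))
          + (s * e p * (g x * ?d k (w j) x) + (s * e k * (g x * ?d p (w j) x)
          + (e k * e p / h\<^sup>2) * (f x * f x * (1 - w j x)\<^sup>2)))" for k p x
      proof -
        have \<psi>g: "\<psi> x * g x = g x" unfolding g_def using \<psi>f[of x] by (simp add: mult.assoc[symmetric])
        have "\<psi> x * (v k x * v p x) = h\<^sup>2 * (\<psi> x * (?d k (w j) x * ?d p (w j) x))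
          + (s * e p * ((\<psi> x * g x) * ?d k (w j) x) + (s * e k * ((\<psi> x * g x) * ?d p (w j) x)
          + (s * s * e k * e p / h\<^sup>2) * ((\<psi> x * g x) * g x)))"
          unfolding v_def using h by (simp add: power2_eq_square field_simps)
        then show ?thesis unfolding \<psi>g s by (simp add: g_def power2_eq_square mult_ac)
      qed
      have Sexp: "S k p (\<lambda>x. \<psi> x * (v k x * v p x)) = h\<^sup>2 * S k p (\<lambda>x. \<psi> x * (?d k (w j) x * ?d p (w j) x))
          + (s * e p * S k p (\<lambda>x. g x * ?d k (w j) x) + (s * e k * S k p (\<lambda>x. g x * ?d p (w j) x)
          + (e k * e p / h\<^sup>2) * S k p (\<lambda>x. f x * f x * (1 - w j x)\<^sup>2)))" for k p
        unfolding exp by (simp only: add scale test_add test_cmult t1 t2 t3)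
      have ee: "(\<Sum>p\<in>UNIV. e p * F p) = F l" for F :: "'n \<Rightarrow> real"
        unfolding e_def by (auto simp: sum.delta if_distrib if_distribR cong: if_cong)
      have "0 \<le> (\<Sum>k\<in>UNIV. \<Sum>p\<in>UNIV. S k p (\<lambda>x. \<psi> x * (v k x * v p x)))"
        by (rule pos[OF \<psi>(1,2) vs])
      also have "\<dots> = h\<^sup>2 * (\<Sum>k\<in>UNIV. \<Sum>p\<in>UNIV. S k p (\<lambda>x. \<psi> x * (?d k (w j) x * ?d p (w j) x)))
          + (s * (\<Sum>k\<in>UNIV. \<Sum>p\<in>UNIV. e p * S k p (\<lambda>x. g x * ?d k (w j) x))
          + (s * (\<Sum>k\<in>UNIV. e k * (\<Sum>p\<in>UNIV. S k p (\<lambda>x. g x * ?d p (w j) x)))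
          + (\<Sum>k\<in>UNIV. e k * (\<Sum>p\<in>UNIV. e p * S k p (\<lambda>x. f x * f x * (1 - w j x)\<^sup>2))) / h\<^sup>2))"
        unfolding Sexp
        by (simp add: sum.distrib sum_distrib_left sum_divide_distrib mult.assoc)
      also have "\<dots> = h\<^sup>2 * (\<Sum>k\<in>UNIV. \<Sum>p\<in>UNIV. S k p (\<lambda>x. \<psi> x * (?d k (w j) x * ?d p (w j) x)))
          + (s * Y j + (s * (\<Sum>p\<in>UNIV. S l p (\<lambda>x. g x * ?d p (w j) x)) + Q j / h\<^sup>2))"
        unfolding ee Y_def Q_def g_def ..
      also have "(\<Sum>p\<in>UNIV. S l p (\<lambda>x. g x * ?d p (w j) x)) = Y j"
        unfolding Y_def using symmetric[OF t2, of l] by (simp add: g_def)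
      finally have "0 \<le> h\<^sup>2 * (\<Sum>k\<in>UNIV. \<Sum>p\<in>UNIV. S k p (\<lambda>x. \<psi> x * (?d k (w j) x * ?d p (w j) x)))
          + 2 * s * Y j + Q j / h\<^sup>2" by simp
      moreover have "h\<^sup>2 * (\<Sum>k\<in>UNIV. \<Sum>p\<in>UNIV. S k p (\<lambda>x. \<psi> x * (?d k (w j) x * ?d p (w j) x))) \<le> h\<^sup>2 * E"
        by (intro mult_left_mono E) simp
      ultimately show ?thesis by (simp add: XY)
    qed
    show ?thesis using main[of 1] main[of "-1"] by (simp add: abs_le_iff)
  qed
  obtain Bf where Bf: "0 \<le> Bf" "\<And>x. \<bar>f x\<bar> \<le> Bf" by (rule test_bounded[OF f], rule that)
  have Xlim: "X \<longlonglongrightarrow> (\<Sum>k\<in>UNIV. S k l (?d k f))"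
    unfolding X_def
  proof (rule tendsto_sum)
    fix k
    obtain B where B: "0 \<le> B" "\<And>x. \<bar>?d k f x\<bar> \<le> B" by (rule test_bounded[OF df[of k]], rule that)
    show "(\<lambda>j. S k l (\<lambda>x. ?d k f x * (2 * w j x - (w j x)\<^sup>2))) \<longlonglongrightarrow> S k l (?d k f)"
    proof (rule convergence[OF test_mult(1)[OF df chis] df test_functionsD(2,3)[OF df]])
      show "supp (\<lambda>x. ?d k f x * (2 * w j x - (w j x)\<^sup>2)) \<subseteq> supp (?d k f)" for j
        by (rule supp_subset) auto
      show "\<bar>?d k f x * (2 * w j x - (w j x)\<^sup>2)\<bar> \<le> B" for j x
      proof (cases "x \<in> ball c r")
        case True
        have "0 \<le> 2 * w j x - (w j x)\<^sup>2" "2 * w j x - (w j x)\<^sup>2 \<le> 1"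
          using w01[OF True, of j] zero_le_power2[of "1 - w j x"] mult_right_mono[of "w j x" 1 "w j x"]
          by (auto simp: power2_eq_square algebra_simps)
        then have "\<bar>?d k f x * (2 * w j x - (w j x)\<^sup>2)\<bar> \<le> B * 1"
          unfolding abs_mult using B by (intro mult_mono) auto
        then show ?thesis by simp
      next
        case False
        then have "?d k f x = 0" using test_functionsD(3)[OF df] supp_zero by blast
        then show ?thesis using B(1) by simp
      qed
      show "(\<lambda>j. ?d k f x * (2 * w j x - (w j x)\<^sup>2)) \<longlonglongrightarrow> ?d k f x" if "x \<in> ball c r - K" for x
      proof -
        have "(\<lambda>j. ?d k f x * (2 * w j x - (w j x)\<^sup>2)) \<longlonglongrightarrow> ?d k f x * (2 * 1 - 1\<^sup>2)"
          by (intro tendsto_intros wlim) (use that in auto)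
        then show ?thesis by simp
      qed
    qed
  qed
  have Qlim: "Q \<longlonglongrightarrow> 0"
  proof -
    have ff: "(\<lambda>x. f x * f x) \<in> test" by (rule test_mult(1)[OF f fs])
    have "Q \<longlonglongrightarrow> S l l (\<lambda>x. 0)"
      unfolding Q_def
    proof (rule convergence[OF test_mult(1)[OF ff smooth_power[OF gs]] test_zero test_functionsD(2,3)[OF f]])
      show "supp (\<lambda>x. f x * f x * (1 - w j x)\<^sup>2) \<subseteq> supp f" for j
        by (rule supp_subset) auto
      show "\<bar>f x * f x * (1 - w j x)\<^sup>2\<bar> \<le> Bf * Bf" for j x
      proof (cases "x \<in> ball c r")
        case True
        have "(1 - w j x)\<^sup>2 \<le> 1" using w01[OF True, of j] by (intro power_le_one) auto
        then have "\<bar>f x\<bar> * \<bar>f x\<bar> * \<bar>(1 - w j x)\<^sup>2\<bar> \<le> Bf * Bf * 1"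
          using Bf by (intro mult_mono) auto
        then show ?thesis by (simp add: abs_mult)
      next
        case False
        then have "f x = 0" using test_functionsD(3)[OF f] supp_zero by blast
        then show ?thesis using Bf(1) by simp
      qed
      show "(\<lambda>j. f x * f x * (1 - w j x)\<^sup>2) \<longlonglongrightarrow> 0" if "x \<in> ball c r - K" for x
      proof -
        have "(\<lambda>j. f x * f x * (1 - w j x)\<^sup>2) \<longlonglongrightarrow> f x * f x * (1 - 1)\<^sup>2"
          by (intro tendsto_intros wlim) (use that in auto)
        then show ?thesis by simp
      qed
    qed
    then show ?thesis by (simp add: zero)
  qed
  let ?X = "\<Sum>k\<in>UNIV. S k l (?d k f)"
  \<comment> \<open>In the limit over \<open>j\<close> the term with \<open>Q j\<close> disappears
    for each fixed \<open>h\<close>.\<close>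
  have bound: "\<bar>?X\<bar> \<le> h\<^sup>2 * E" if "0 < h" for h
  proof -
    have "(\<lambda>j. h\<^sup>2 * E + Q j / h\<^sup>2) \<longlonglongrightarrow> h\<^sup>2 * E + 0 / h\<^sup>2"
      using that by (intro tendsto_intros Qlim) auto
    then show ?thesis
      using LIMSEQ_le[OF tendsto_rabs[OF Xlim], of "\<lambda>j. h\<^sup>2 * E + Q j / h\<^sup>2" "h\<^sup>2 * E"] young[OF that] by simp
  qed
  have "((\<lambda>h. h\<^sup>2 * E) \<longlongrightarrow> 0\<^sup>2 * E) (at_right (0::real))"
    by (intro tendsto_intros)
  then have "\<bar>?X\<bar> \<le> 0\<^sup>2 * E"
    by (rule tendsto_lowerbound) (auto simp: eventually_at_right_field intro!: exI[of _ 1] bound)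
  then show ?thesis by simp
qed

end

section \<open>Supercurrents\<close>

lemma wedge_list_append: "wedge_list (as @ bs) = wedge (wedge_list as) (wedge_list bs)"
  by (induction as) (simp_all add: wedge_list_def wedge_one_left wedge_assoc)

lemma wedge_list_scale:
  "wedge_list (map (\<lambda>a I J x. g x * a I J x) as) = (\<lambda>I J x. g x ^ length as * wedge_list as I J x)"
proof (induction as)
  case (Cons a as)
  have unfold: "wedge_list (b # bs) = wedge b (wedge_list bs)" for b :: "'a superform" and bs
    by (simp add: wedge_list_def)
  have "wedge_list (map (\<lambda>a I J x. g x * a I J x) (a # as))
    = wedge (\<lambda>I J x. g x * a I J x) (\<lambda>I J x. g x ^ length as * wedge_list as I J x)"
    unfolding list.map unfold Cons ..
  also have "\<dots> = (\<lambda>I J x. g x * (g x ^ length as * wedge a (wedge_list as) I J x))"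
    by (simp only: wedge_scale_left wedge_scale_right)
  finally show ?case by (simp add: unfold mult.assoc)
qed (simp add: wedge_list_def)

lemma square_J_scale:
  "wedge (\<lambda>I J x. g x * a I J x) (J_op (\<lambda>I J x. g x * a I J x))
    = (\<lambda>I J x. (g x)\<^sup>2 * wedge a (J_op a) I J x)"
proof -
  have "J_op (\<lambda>I J x. g x * a I J x) = (\<lambda>I J x. g x * J_op a I J x)"
    by (intro ext) (simp add: J_op_def)
  then have "wedge (\<lambda>I J x. g x * a I J x) (J_op (\<lambda>I J x. g x * a I J x))
    = (\<lambda>I J x. g x * (g x * wedge a (J_op a) I J x))"
    by (simp only: wedge_scale_left wedge_scale_right)
  then show ?thesis by (simp add: power2_eq_square mult.assoc)
qed

lemma oneform_scale: "oneform (\<lambda>k x. g x * a k x) = (\<lambda>I J x. g x * oneform a I J x)"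
  unfolding oneform_def by (simp add: sum_distrib_left mult.assoc)

definition smooth_form :: "'n::{finite,linorder} superform \<Rightarrow> bool" where
  "smooth_form a \<longleftrightarrow> (\<forall>I J. smooth (a I J))"

lemma smooth_form_wedge: "smooth_form a \<Longrightarrow> smooth_form b \<Longrightarrow> smooth_form (wedge a b)"
  unfolding smooth_form_def wedge_def by (intro allI smooth_sum smooth_mult smooth_const) auto

lemma smooth_form_one: "smooth_form one_form"
  unfolding smooth_form_def one_form_def by (intro allI smooth_const)

lemma smooth_form_wedge_list: "(\<And>a. a \<in> set as \<Longrightarrow> smooth_form a) \<Longrightarrow> smooth_form (wedge_list as)"
  by (induction as) (simp_all add: wedge_list_def smooth_form_one smooth_form_wedge)

lemma smooth_form_basis: "smooth_form (wedge (dx k) (dxi l))"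
  unfolding smooth_form_def wedge_dx_dxi by (intro allI smooth_const)

lemma smooth_form_square: "(\<And>k. smooth (a k)) \<Longrightarrow> smooth_form (square_form a)"
  unfolding smooth_form_def square_form_eq
  by (intro allI smooth_sum smooth_mult) (simp_all add: smooth_form_basis[unfolded smooth_form_def])

lemma smooth_form_basis_form: "smooth_form (basis_form k i j)"
  unfolding smooth_form_def
proof (intro allI)
  fix I J
  have "basis_form k i j I J = (\<lambda>x. basis_form k i j I J 0)"
    by (intro ext basis_form_const)
  then show "smooth (basis_form k i j I J)" by (metis smooth_const)
qed

text \<open>The sign with which the coefficient of \<open>dx_I \<and> d\<xi>_J\<close> enters the
  superintegral, including the reordering to \<open>dx_1 \<and> d\<xi>_1 \<and> ...\<close>.\<close>

definition top_sign :: "'n::{finite,linorder} set \<Rightarrow> 'n set \<Rightarrow> real" where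
  "top_sign I J = (- 1) ^ (CARD('n) * (CARD('n) - 1) div 2) * super_sign I J (- I) (- J)"

lemma current_apply_eq:
  fixes T :: "'n::{finite,linorder} supercurrent"
  shows "current_apply T a = (\<Sum>I\<in>UNIV. \<Sum>J\<in>UNIV. top_sign I J * T I J (a (- I) (- J)))"
  unfolding current_apply_def top_coeff_def current_wedge_def top_sign_def
  by (simp add: sum_distrib_left mult.assoc Compl_eq_Diff_UNIV[symmetric])

lemma smooth_form_sum_list:
  "(\<And>b. b \<in> set bs \<Longrightarrow> smooth_form (h b)) \<Longrightarrow> smooth_form (\<lambda>I J x. \<Sum>b\<leftarrow>bs. h b I J x)"
proof (induction bs)
  case Nil
  show ?case by (simp add: smooth_form_def smooth_const)
next
  case (Cons b bs)
  then have "smooth_form (\<lambda>I J x. \<Sum>b\<leftarrow>bs. h b I J x)" "smooth_form (h b)" by auto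
  then show ?case unfolding smooth_form_def by (auto intro!: smooth_add)
qed

text \<open>A class on which positivity can be tested factor by factor, since products expand into
  products of single squares. The coefficients are smooth without compact support; a separate test
  function localises.\<close>

definition sum_of_squares :: "'n::{finite,linorder} superform \<Rightarrow> bool" where
  "sum_of_squares g \<longleftrightarrow> (\<exists>bs. (\<forall>b\<in>set bs. \<forall>k. smooth (b k)) \<and>
     g = (\<lambda>I J x. \<Sum>b\<leftarrow>bs. square_form b I J x))"

lemma sum_of_squares_smooth: "sum_of_squares g \<Longrightarrow> smooth_form g"
  unfolding sum_of_squares_def using smooth_form_sum_list[of _ square_form] smooth_form_square by blast

lemma sum_of_squares_add:
  assumes "sum_of_squares g" "sum_of_squares h"
  shows "sum_of_squares (\<lambda>I J x. g I J x + h I J x)"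
proof -
  obtain bs cs where "\<forall>b\<in>set bs. \<forall>k. smooth (b k)" "g = (\<lambda>I J x. \<Sum>b\<leftarrow>bs. square_form b I J x)"
    "\<forall>b\<in>set cs. \<forall>k. smooth (b k)" "h = (\<lambda>I J x. \<Sum>b\<leftarrow>cs. square_form b I J x)"
    using assms unfolding sum_of_squares_def by auto
  then show ?thesis unfolding sum_of_squares_def by (intro exI[of _ "bs @ cs"]) auto
qed

lemma sum_of_squares_sum:
  assumes "finite A" "\<And>p k. p \<in> A \<Longrightarrow> smooth (b p k)"
  shows "sum_of_squares (\<lambda>I J x. \<Sum>p\<in>A. square_form (b p) I J x)"
proof -
  obtain ps where ps: "set ps = A" "distinct ps" using finite_distinct_list[OF assms(1)] by blast
  have "(\<Sum>p\<in>A. square_form (b p) I J x) = (\<Sum>c\<leftarrow>map b ps. square_form c I J x)" for I J x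
    using sum_list_distinct_conv_sum_set[OF ps(2), of "\<lambda>p. square_form (b p) I J x"] ps(1)
    by (simp add: o_def)
  then show ?thesis unfolding sum_of_squares_def
    using assms(2) ps(1) by (intro exI[of _ "map b ps"]) auto
qed

lemma sum_of_squares_square: "(\<And>k. smooth (b k)) \<Longrightarrow> sum_of_squares (square_form b)"
  unfolding sum_of_squares_def by (intro exI[of _ "[b]"]) simp

lemma sum_of_squares_beta: "sum_of_squares (beta :: 'n::{finite,linorder} superform)"
proof -
  have "square_form (\<lambda>k x. if k = j then 1 else 0) I J x = wedge (dx j) (dxi j) I J x"
    for j :: 'n and I J x
  proof -
    have "square_form (\<lambda>k x. if k = j then 1 else 0) I J x
      = (\<Sum>k\<in>UNIV. if k = j then (\<Sum>l\<in>UNIV. if l = j then wedge (dx k) (dxi l) I J x else 0) else 0)"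
      unfolding square_form_eq
    proof (rule sum.cong[OF refl])
      fix k :: 'n
      show "(\<Sum>l\<in>UNIV. (if k = j then 1 else 0) * (if l = j then 1 else 0) * wedge (dx k) (dxi l) I J x)
        = (if k = j then (\<Sum>l\<in>UNIV. if l = j then wedge (dx k) (dxi l) I J x else 0) else 0)"
      proof -
        have "(if k = j then 1 else 0) * (if l = j then 1 else 0) * wedge (dx k) (dxi l) I J x
          = (if k = j then (if l = j then wedge (dx k) (dxi l) I J x else 0) else 0)" for l
          by simp
        then show ?thesis by (simp only:) (cases "k = j"; simp)
      qed
    qed
    then show ?thesis by (simp add: sum.delta)
  qed
  then have "beta = (\<lambda>I J x. \<Sum>j\<in>(UNIV::'n set). square_form (\<lambda>k x. if k = j then 1 else 0) I J x)"
    unfolding beta_def by simp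
  moreover have "sum_of_squares (\<lambda>I J x. \<Sum>j\<in>(UNIV::'n set). square_form (\<lambda>k x. if k = j then 1 else 0) I J x)"
    by (rule sum_of_squares_sum) (auto intro: smooth_const)
  ultimately show ?thesis by simp
qed

lemma sum_of_squares_lagrange:
  assumes a: "\<And>k. smooth (a k)" and b: "\<And>x. b x = (\<Sum>k\<in>UNIV. (a k x)\<^sup>2) + \<rho>\<^sup>2"
  shows "sum_of_squares (lagrange_form b a)"
  unfolding lagrange_identity[of b a \<rho>, OF b]
  by (intro sum_of_squares_add sum_of_squares_sum finite)
    (auto intro!: smooth_mult smooth_diff smooth_minus smooth_const a simp: divide_inverse)

text \<open>No differential equation is assumed, so that the extension across \<open>K\<close> is an
  instance before its minimality is known.\<close>

locale positive_supercurrent =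
  fixes c :: "real ^ 'n::{finite,linorder}" and r :: real and m :: nat and T :: "'n supercurrent"
  assumes m_pos: "1 \<le> m"
    and distr: "distribution (ball c r) (T I J)"
    and degree: "f \<in> test_functions (ball c r) \<Longrightarrow>
      \<not> (card I + m = CARD('n) \<and> card J + m = CARD('n)) \<Longrightarrow> T I J f = 0"
    and positive: "positive_current (ball c r) m T"
    and symm: "symmetric_current (ball c r) T"
begin

abbreviation "test \<equiv> test_functions (ball c r)"

lemma T_add: "f \<in> test \<Longrightarrow> g \<in> test \<Longrightarrow> T I J (\<lambda>x. f x + g x) = T I J f + T I J g"
  and T_scale: "f \<in> test \<Longrightarrow> T I J (\<lambda>x. a * f x) = a * T I J f"
  using distr[of I J] unfolding distribution_def by auto

lemma T_zero: "T I J (\<lambda>x. 0) = 0"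
  using T_scale[OF test_zero, of I J 0] by simp

lemma apply_add:
  assumes "\<And>I J. a I J \<in> test" "\<And>I J. b I J \<in> test"
  shows "current_apply T (\<lambda>I J x. a I J x + b I J x) = current_apply T a + current_apply T b"
  unfolding current_apply_eq using assms by (simp add: T_add distrib_left sum.distrib)

lemma apply_scale:
  assumes "\<And>I J. a I J \<in> test"
  shows "current_apply T (\<lambda>I J x. h * a I J x) = h * current_apply T a"
  unfolding current_apply_eq using assms by (simp add: T_scale sum_distrib_left mult.left_commute)

lemma apply_zero: "current_apply T (\<lambda>I J x. 0) = 0"
  unfolding current_apply_eq by (simp add: T_zero)

lemma apply_sum:
  assumes "\<And>i I J. i \<in> A \<Longrightarrow> a i I J \<in> test"
  shows "current_apply T (\<lambda>I J x. \<Sum>i\<in>A. a i I J x) = (\<Sum>i\<in>A. current_apply T (a i))"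
  using assms
proof (induction A rule: infinite_finite_induct)
  case (insert i A)
  then show ?case using apply_add[of "a i" "\<lambda>I J x. \<Sum>i\<in>A. a i I J x"] by (simp add: test_sum)
qed (simp_all add: apply_zero)

lemma test_form_mult:
  "f \<in> test \<Longrightarrow> smooth_form a \<Longrightarrow> (\<lambda>x. f x * a I J x) \<in> test"
  unfolding smooth_form_def by (intro test_mult(1)) auto

text \<open>The weight \<open>f + h\<close> with \<open>h > 0\<close> has smooth roots, which are distributed over the factors.\<close>

lemma apply_squares_nonneg:
  assumes f: "f \<in> test" "\<And>x. 0 \<le> f x" and as: "length as = m" "\<And>a k. a \<in> set as \<Longrightarrow> smooth (a k)"
  shows "0 \<le> current_apply T (\<lambda>I J x. f x * wedge_list (map square_form as) I J x)"
proof -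
  let ?W = "wedge_list (map square_form as)"
  have Ws: "smooth_form ?W"
    by (intro smooth_form_wedge_list) (auto intro: smooth_form_square as(2))
  obtain \<psi> where \<psi>: "\<psi> \<in> test" "\<And>x. \<psi> x \<ge> 0" "\<And>x. x \<in> supp f \<Longrightarrow> \<psi> x = 1"
    by (rule bump_exists[OF test_functionsD(2,3)[OF f(1)]], rule that)
  have \<psi>f: "\<psi> x ^ (2 * m) * f x = f x" for x
    using \<psi>(3)[of x] supp_zero[of x f] by (cases "x \<in> supp f") auto
  \<comment> \<open>One factor \<open>\<psi>\<close> is split off to make membership in
    \<open>test\<close> visible.\<close>
  define P where "P x = \<psi> x * \<psi> x ^ (2 * m - 1)" for x
  have Pe: "P x = \<psi> x ^ (2 * m)" for x
    unfolding P_def using m_pos by (cases m) simp_all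
  have P: "P \<in> test" unfolding P_def
    by (intro test_mult(1)[OF \<psi>(1)] smooth_power test_functionsD(1)[OF \<psi>(1)])
  have key: "0 \<le> current_apply T (\<lambda>I J x. f x * ?W I J x) + h * current_apply T (\<lambda>I J x. P x * ?W I J x)"
    if h: "0 < h" for h
  proof -
    \<comment> \<open>The factor \<open>g^2\<close> occurs \<open>m\<close> times, and
      \<open>(g^2)^m = \<psi>^(2 m) (f + h) = f + h P\<close>, because \<open>\<psi> = 1\<close> on
      the support of \<open>f\<close>; afterwards \<open>h\<close> tends to 0.\<close>
    define g where "g x = \<psi> x * (f x + h) powr (1 / (2 * real m))" for x
    have fh: "0 < f x + h" for x using f(2)[of x] h by simp
    have g: "g \<in> test" unfolding g_def
      by (intro test_mult(1)[OF \<psi>(1)] smooth_powr smooth_add smooth_const test_functionsD(1)[OF f(1)] fh)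
    have gpow: "((g x)\<^sup>2) ^ m = \<psi> x ^ (2 * m) * (f x + h)" for x
    proof -
      have "((f x + h) powr (1 / (2 * real m))) ^ (2 * m) = (f x + h) powr (real (2 * m) * (1 / (2 * real m)))"
        using fh[of x] by (simp add: powr_power mult.commute)
      also have "\<dots> = f x + h" using m_pos fh[of x] by simp
      finally show ?thesis by (simp add: g_def power_mult_distrib flip: power_mult)
    qed
    let ?as = "map (\<lambda>a. oneform (\<lambda>k x. g x * a k x)) as"
    have "test_form (ball c r) 1 0 (oneform (\<lambda>k x. g x * a k x))" if a: "a \<in> set as" for a
      unfolding test_form_def
    proof (intro conjI allI impI)
      fix I J :: "'n set"
      have "oneform (\<lambda>k x. g x * a k x) I J = (\<lambda>x. \<Sum>k\<in>UNIV. g x * (a k x * dx k I J x))"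
        by (simp add: oneform_def mult.assoc)
      also have "\<dots> \<in> test"
      proof (intro test_sum test_mult(1)[OF g] smooth_mult as(2)[OF a])
        show "smooth (dx k I J)" for k unfolding dx_def by (rule smooth_const)
      qed
      finally show "oneform (\<lambda>k x. g x * a k x) I J \<in> test" .
    next
      fix I J :: "'n set" assume "\<not> (card I = 1 \<and> card J = 0)"
      then show "oneform (\<lambda>k x. g x * a k x) I J = (\<lambda>x. 0)"
        using oneform_degree by blast
    qed
    then have "length ?as = m \<and> (\<forall>a\<in>set ?as. test_form (ball c r) 1 0 a)"
      using as(1) by auto
    then have "0 \<le> current_apply T (wedge_list (map (\<lambda>a. wedge a (J_op a)) ?as))"
      using positive[unfolded positive_current_def, THEN spec, of ?as] by blast
    also have "map (\<lambda>a. wedge a (J_op a)) ?as = map (\<lambda>a I J x. (g x)\<^sup>2 * a I J x) (map square_form as)"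
      by (simp add: oneform_scale square_J_scale square_form_def)
    also have "wedge_list \<dots> = (\<lambda>I J x. ((g x)\<^sup>2) ^ m * ?W I J x)"
      unfolding wedge_list_scale using as(1) by simp
    also have "\<dots> = (\<lambda>I J x. f x * ?W I J x + h * (P x * ?W I J x))"
    proof (intro ext)
      fix I J x
      have "((g x)\<^sup>2) ^ m = f x + h * P x"
        unfolding gpow Pe distrib_left \<psi>f by simp
      then show "((g x)\<^sup>2) ^ m * ?W I J x = f x * ?W I J x + h * (P x * ?W I J x)"
        by (simp add: distrib_right)
    qed
    also have "current_apply T \<dots> = current_apply T (\<lambda>I J x. f x * ?W I J x) + h * current_apply T (\<lambda>I J x. P x * ?W I J x)"
      using test_form_mult[OF f(1) Ws] test_form_mult[OF P Ws]
      by (simp add: apply_add apply_scale test_cmult)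
    finally show ?thesis .
  qed
  have "((\<lambda>h. current_apply T (\<lambda>I J x. f x * ?W I J x) + h * current_apply T (\<lambda>I J x. P x * ?W I J x))
      \<longlongrightarrow> current_apply T (\<lambda>I J x. f x * ?W I J x) + 0 * current_apply T (\<lambda>I J x. P x * ?W I J x)) (at_right (0::real))"
    by (intro tendsto_intros)
  then have "0 \<le> current_apply T (\<lambda>I J x. f x * ?W I J x) + 0 * current_apply T (\<lambda>I J x. P x * ?W I J x)"
    by (rule tendsto_lowerbound) (auto simp: eventually_at_right_field intro!: exI[of _ 1] key)
  then show ?thesis by simp
qed

text \<open>The list \<open>as\<close> holds the factors already reduced to single squares. Each
  step expands the next sum of squares and moves its summands, one at a time, to that list, until
  \<open>apply_squares_nonneg\<close> applies.\<close>

lemma apply_sums_of_squares_nonneg: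
  assumes f: "f \<in> test" "\<And>x. 0 \<le> f x"
    and gs: "\<And>g. g \<in> set gs \<Longrightarrow> sum_of_squares g"
    and as: "length as + length gs = m" "\<And>a k. a \<in> set as \<Longrightarrow> smooth (a k)"
  shows "0 \<le> current_apply T (\<lambda>I J x. f x * wedge_list (map square_form as @ gs) I J x)"
  using gs as
proof (induction gs arbitrary: as)
  case Nil
  then show ?case using apply_squares_nonneg[OF f, of as] by simp
next
  case (Cons g gs)
  note IH = Cons.IH and prems = Cons.prems
  obtain bs where bs: "\<forall>b\<in>set bs. \<forall>k. smooth (b k)" "g = (\<lambda>I J x. \<Sum>b\<leftarrow>bs. square_form b I J x)"
    using Cons.prems(1)[of g] unfolding sum_of_squares_def by auto
  let ?L = "wedge_list (map square_form as)" and ?R = "wedge_list gs"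
  have Ls: "smooth_form ?L"
    by (intro smooth_form_wedge_list) (auto intro: smooth_form_square Cons.prems(3))
  have Rs: "smooth_form ?R"
    by (intro smooth_form_wedge_list sum_of_squares_smooth Cons.prems(1)) simp
  have split: "wedge_list (map square_form as @ h # gs) = wedge ?L (wedge h ?R)" for h
    unfolding wedge_list_append by (simp add: wedge_list_def)
  have "0 \<le> current_apply T (\<lambda>I J x. f x * wedge ?L (wedge (\<lambda>I J x. \<Sum>b\<leftarrow>bs. square_form b I J x) ?R) I J x)"
    using bs(1)
  proof (induction bs)
    case Nil
    then show ?case by (simp add: wedge_zero_left wedge_zero_right apply_zero)
  next
    case (Cons b bs)
    let ?s = "\<lambda>I J x. \<Sum>b\<leftarrow>bs. square_form b I J x"
    have ss: "smooth_form (wedge ?L (wedge ?s ?R))" "smooth_form (wedge ?L (wedge (square_form b) ?R))"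
      by (intro smooth_form_wedge Ls Rs smooth_form_sum_list smooth_form_square; use Cons.prems in auto)+
    have "0 \<le> current_apply T (\<lambda>I J x. f x * wedge_list (map square_form (as @ [b]) @ gs) I J x)"
      by (rule IH) (use Cons.prems prems in auto)
    then have b: "0 \<le> current_apply T (\<lambda>I J x. f x * wedge ?L (wedge (square_form b) ?R) I J x)"
      using split[of "square_form b"] by simp
    have "(\<lambda>I J x. f x * wedge ?L (wedge (\<lambda>I J x. \<Sum>b\<leftarrow>b # bs. square_form b I J x) ?R) I J x)
      = (\<lambda>I J x. f x * wedge ?L (wedge (square_form b) ?R) I J x + f x * wedge ?L (wedge ?s ?R) I J x)"
      by (simp add: wedge_add_left wedge_add_right distrib_left)
    then have "current_apply T (\<lambda>I J x. f x * wedge ?L (wedge (\<lambda>I J x. \<Sum>b\<leftarrow>b # bs. square_form b I J x) ?R) I J x)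
      = current_apply T (\<lambda>I J x. f x * wedge ?L (wedge (square_form b) ?R) I J x)
        + current_apply T (\<lambda>I J x. f x * wedge ?L (wedge ?s ?R) I J x)"
      using apply_add[OF test_form_mult[OF f(1) ss(2)] test_form_mult[OF f(1) ss(1)]] by simp
    then show ?case using b Cons by simp
  qed
  then show ?case unfolding split bs(2) .
qed

text \<open>The coefficients of \<open>T \<and> \<beta>^(m - 1)\<close>, obtained by pairing with
  \<open>dx_k \<and> d\<xi>_l\<close>; this is the matrix to which the removability result is
  applied.\<close>

definition S :: "'n \<Rightarrow> 'n \<Rightarrow> (real ^ 'n::{finite,linorder} \<Rightarrow> real) \<Rightarrow> real" where
  "S k l f = current_apply T (\<lambda>I J x. f x * basis_form (m - 1) k l I J x)"

text \<open>The basis forms have constant coefficients, so \<open>S k l\<close> is a fixed linear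
  combination of the coefficients of \<open>T\<close> and inherits their continuity
  properties.\<close>

lemma S_eq:
  assumes "f \<in> test"
  shows "S k l f = (\<Sum>I\<in>UNIV. \<Sum>J\<in>UNIV. top_sign I J * basis_form (m - 1) k l (- I) (- J) 0 * T I J f)"
proof -
  have "(\<lambda>x. f x * basis_form (m - 1) k l I J x) = (\<lambda>x. basis_form (m - 1) k l I J 0 * f x)" for I J
    by (rule ext, subst basis_form_const[of _ _ _ _ _ _ 0], rule mult.commute)
  then show ?thesis
    unfolding S_def current_apply_eq using assms by (simp add: T_scale mult.assoc)
qed

lemma apply_basis_sum:
  assumes "\<And>k l. h k l \<in> test"
  shows "current_apply T (\<lambda>I J x. \<Sum>k\<in>UNIV. \<Sum>l\<in>UNIV. h k l x * basis_form (m - 1) k l I J x)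
    = (\<Sum>k\<in>UNIV. \<Sum>l\<in>UNIV. S k l (h k l))"
proof -
  have t: "(\<lambda>x. h k l x * basis_form (m - 1) k l I J x) \<in> test" for k l I J
    by (rule test_form_mult[OF assms smooth_form_basis_form])
  have "current_apply T (\<lambda>I J x. \<Sum>k\<in>UNIV. \<Sum>l\<in>UNIV. h k l x * basis_form (m - 1) k l I J x)
    = (\<Sum>k\<in>UNIV. current_apply T (\<lambda>I J x. \<Sum>l\<in>UNIV. h k l x * basis_form (m - 1) k l I J x))"
    by (rule apply_sum) (intro test_sum t)
  also have "\<dots> = (\<Sum>k\<in>UNIV. \<Sum>l\<in>UNIV. S k l (h k l))"
    unfolding S_def by (intro sum.cong refl apply_sum t)
  finally show ?thesis .
qed

lemma wedge_beta_pow_square: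
  "wedge (beta_pow k) (square_form v) = (\<lambda>I J x. \<Sum>i\<in>UNIV. \<Sum>j\<in>UNIV. v i x * v j x * basis_form k i j I J x)"
  unfolding square_form_eq basis_form_def by (simp only: wedge_sum_right wedge_scale_right)

text \<open>Positivity of \<open>T\<close> is applied to \<open>m - 1\<close> factors
  \<open>\<beta>\<close>, which are sums of squares, and one square of \<open>v\<close>.\<close>

lemma S_pos:
  assumes f: "f \<in> test" "\<And>x. 0 \<le> f x" and v: "\<And>k. smooth (v k)"
  shows "0 \<le> (\<Sum>k\<in>UNIV. \<Sum>l\<in>UNIV. S k l (\<lambda>x. f x * (v k x * v l x)))"
proof -
  have "0 \<le> current_apply T (\<lambda>I J x. f x * wedge_list (map square_form [] @ replicate (m - 1) beta @ [square_form v]) I J x)"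
    using m_pos by (intro apply_sums_of_squares_nonneg[OF f])
      (auto intro: sum_of_squares_beta sum_of_squares_square v)
  also have "wedge_list (map square_form [] @ replicate (m - 1) beta @ [square_form v])
      = wedge (beta_pow (m - 1)) (square_form v)"
    by (simp add: wedge_list_append beta_pow_def) (simp add: wedge_list_def wedge_one_right)
  also have "(\<lambda>I J x. f x * wedge (beta_pow (m - 1)) (square_form v) I J x)
      = (\<lambda>I J x. \<Sum>k\<in>UNIV. \<Sum>l\<in>UNIV. (f x * (v k x * v l x)) * basis_form (m - 1) k l I J x)"
    unfolding wedge_beta_pow_square by (simp add: sum_distrib_left mult.assoc)
  also have "current_apply T \<dots> = (\<Sum>k\<in>UNIV. \<Sum>l\<in>UNIV. S k l (\<lambda>x. f x * (v k x * v l x)))"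
    by (intro apply_basis_sum test_mult(1)[OF f(1)] smooth_mult v)
  finally show ?thesis .
qed

text \<open>Positivity is applied to the \<open>m\<close>-th power of the Lagrange form with
  \<open>a = x - y\<close> and \<open>b = |a|^2 + \<eta>\<close>, under the weight
  \<open>f / b^(m - 1)\<close>. By \<open>lagrange_form_power\<close> this is
  \<open>f (b \<beta>^m - m \<beta>^(m - 1) \<and> a \<and> a#)\<close>, and
  \<open>\<beta>^m\<close> accounts for the trace.\<close>

lemma S_hessian_pos:
  assumes f: "f \<in> test" "\<And>x. 0 \<le> f x" and \<eta>: "0 < \<eta>"
  shows "0 \<le> (\<Sum>k\<in>UNIV. \<Sum>l\<in>UNIV. S k l (\<lambda>x. f x * ((sqdist y x + \<eta>) * (if k = l then 1 else 0)
        - real m * ((x $ k - y $ k) * (x $ l - y $ l)))))"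
proof -
  define b where "b x = sqdist y x + \<eta>" for x
  define a where "a k x = x $ k - y $ k" for k x
  define n where "n = m - 1"
  have mn: "m = Suc n" using m_pos by (simp add: n_def)
  have b0: "0 < b x" for x using sqdist_nonneg[of y x] \<eta> by (simp add: b_def)
  have bs: "smooth b" unfolding b_def by (intro smooth_add smooth_sqdist smooth_const)
  have as: "smooth (a k)" for k unfolding a_def by (intro smooth_diff smooth_coord smooth_const)
  define g where "g x = f x * inverse (b x) ^ n" for x
  have g: "g \<in> test" unfolding g_def
    by (intro test_mult(1)[OF f(1)] smooth_power smooth_inverse bs b0)
  have g0: "0 \<le> g x" for x unfolding g_def using f(2)[of x] b0[of x] by simp
  have sos: "sum_of_squares (lagrange_form b a)"
    by (rule sum_of_squares_lagrange[OF as, where b = b and \<rho> = "sqrt \<eta>"]) (use \<eta> in \<open>simp add: b_def a_def sqdist_def\<close>)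
  have "0 \<le> current_apply T (\<lambda>I J x. g x * wedge_list (map square_form [] @ replicate m (lagrange_form b a)) I J x)"
    by (intro apply_sums_of_squares_nonneg[OF g g0]) (auto intro: sos)
  also have "(\<lambda>I J x. g x * wedge_list (map square_form [] @ replicate m (lagrange_form b a)) I J x)
    = (\<lambda>I J x. \<Sum>k\<in>UNIV. \<Sum>l\<in>UNIV. (f x * (b x * (if k = l then 1 else 0) - real m * (a k x * a l x)))
        * basis_form n k l I J x)"
  proof (intro ext)
    fix I J x
    have gb: "g x * b x ^ n = f x" using b0[of x] by (simp add: g_def power_inverse)
    have "g x * wedge_list (map square_form [] @ replicate m (lagrange_form b a)) I J x
      = g x * (b x ^ Suc n * beta_pow (Suc n) I J x - real m * b x ^ n * wedge (beta_pow n) (square_form a) I J x)"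
      unfolding mn using lagrange_form_power[of n b a] by simp
    also have "\<dots> = (g x * b x ^ n) * (b x * beta_pow (Suc n) I J x - real m * wedge (beta_pow n) (square_form a) I J x)"
      by (simp add: algebra_simps)
    also have "\<dots> = f x * (b x * beta_pow (Suc n) I J x - real m * wedge (beta_pow n) (square_form a) I J x)"
      unfolding gb ..
    also have "\<dots> = (\<Sum>k\<in>UNIV. \<Sum>l\<in>UNIV. (f x * (b x * (if k = l then 1 else 0) - real m * (a k x * a l x)))
        * basis_form n k l I J x)"
    proof -
      have "beta_pow (Suc n) I J x = (\<Sum>k\<in>UNIV. \<Sum>l\<in>UNIV. (if k = l then 1 else 0) * basis_form n k l I J x)"
        unfolding beta_pow_basis by (simp add: sum.delta if_distrib if_distribR cong: if_cong)
      then show ?thesis unfolding wedge_beta_pow_square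
        by (simp add: sum_distrib_left sum_subtractf[symmetric] algebra_simps)
    qed
    finally show "g x * wedge_list (map square_form [] @ replicate m (lagrange_form b a)) I J x
      = (\<Sum>k\<in>UNIV. \<Sum>l\<in>UNIV. (f x * (b x * (if k = l then 1 else 0) - real m * (a k x * a l x)))
        * basis_form n k l I J x)" .
  qed
  also have "current_apply T \<dots> = (\<Sum>k\<in>UNIV. \<Sum>l\<in>UNIV. S k l (\<lambda>x. f x * (b x * (if k = l then 1 else 0) - real m * (a k x * a l x))))"
    unfolding n_def
    by (intro apply_basis_sum test_mult(1)[OF f(1)] smooth_diff smooth_mult smooth_const bs as)
  finally show ?thesis unfolding a_def b_def .
qed

text \<open>On balanced degrees \<open>p\<close> the sign in \<open>J_op\<close> is
  \<open>(- 1)^(p + p^2) = 1\<close>, so invariance under it means a symmetric coefficient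
  matrix.\<close>

lemma T_transpose: "f \<in> test \<Longrightarrow> T I J f = T J I f"
proof (cases "card I + m = CARD('n) \<and> card J + m = CARD('n)")
  case True
  assume f: "f \<in> test"
  have "card I = card J" using True by linarith
  have "T I J f = J_op T I J f" using symm f unfolding symmetric_current_def by simp
  also have "\<dots> = (- 1) ^ (card I + card I * card I) * T J I f"
    using \<open>card I = card J\<close> by (simp add: J_op_def)
  also have "even (card I + card I * card I)" by simp
  then have "(- 1 :: real) ^ (card I + card I * card I) = 1" by (rule neg_one_even_power)
  finally show ?thesis by simp
next
  case False
  then show "f \<in> test \<Longrightarrow> ?thesis" using degree[of f I J] degree[of f J I] by auto
qed

lemma S_symmetric:
  assumes f: "f \<in> test"
  shows "S k l f = S l k f"
proof -
  have "top_sign I J * basis_form (m - 1) k l (- I) (- J) 0 * T I J f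
      = top_sign J I * basis_form (m - 1) l k (- J) (- I) 0 * T J I f" for I J
  proof (cases "T I J f = 0")
    case False
    then have "card I + m = CARD('n) \<and> card J + m = CARD('n)" using degree[OF f, of I J] by blast
    then have "card I = card J" by linarith
    moreover from this have "card (- I) = card (- J)"
      by (simp add: Compl_eq_Diff_UNIV card_Diff_subset)
    ultimately have "top_sign I J = top_sign J I"
      unfolding top_sign_def super_sign_def by simp
    then show ?thesis
      using T_transpose[OF f, of I J] basis_form_transpose[of "m - 1" k l "- I" "- J" 0] by simp
  qed (use T_transpose[OF f, of I J] in simp)
  then show ?thesis
    unfolding S_eq[OF f] by (subst sum.swap) simp
qed

text \<open>The component of \<open>dT \<and> \<beta>^(m - 1)\<close> lacking only
  \<open>d\<xi>_l\<close> is, up to a sign depending on \<open>l\<close>, the divergence of the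
  \<open>l\<close>-th column of \<open>S\<close>. The minus sign is that of the distributional
  derivative; all other signs are matched by \<open>exterior_sign\<close>.\<close>

lemma exterior_derivative:
  assumes f: "f \<in> test"
  shows "current_wedge (current_d T) (beta_pow (m - 1)) UNIV (- {l}) f
    = - ((- 1) ^ (CARD('n) * (CARD('n) - 1) div 2) * shuffle_sign (- {l}) {l}
        * (\<Sum>k\<in>UNIV. S k l (partial_deriv k f)))"
proof -
  let ?e = "(- 1 :: real) ^ (CARD('n) * (CARD('n) - 1) div 2)"
  let ?b = "\<lambda>P Q. beta_pow (m - 1) P Q 0"
  define t where "t k I J = T I J (partial_deriv k f)" for k I J
  have df: "partial_deriv k f \<in> test" for k by (rule test_partial_deriv[OF f])
  have dT: "T I J (partial_deriv k (\<lambda>x. beta_pow (m - 1) P Q x * f x)) = ?b P Q * t k I J" for k I J P Q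
  proof -
    have "(\<lambda>x. beta_pow (m - 1) P Q x * f x) = (\<lambda>x. ?b P Q * f x)"
      by (rule ext, subst beta_pow_const[of _ _ _ _ 0], rule refl)
    moreover have "partial_deriv k (\<lambda>x. ?b P Q * f x) = (\<lambda>x. ?b P Q * partial_deriv k f x)"
      by (intro ext partial_deriv_cmult smooth_differentiable test_functionsD(1)[OF f])
    ultimately show ?thesis using T_scale[OF df] by (simp add: t_def)
  qed
  define F where "F I k = (\<Sum>J\<in>Pow (- {l}). super_sign I J (- I) (- {l} - J) * (shuffle_sign {k} (I - {k})
      * (?b (- I) (- {l} - J) * t k (I - {k}) J)))" for I k
  have "current_wedge (current_d T) (beta_pow (m - 1)) UNIV (- {l}) f = - (\<Sum>I\<in>UNIV. \<Sum>k\<in>I. F I k)"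
  proof -
    have "current_wedge (current_d T) (beta_pow (m - 1)) UNIV (- {l}) f
      = (\<Sum>I\<in>UNIV. \<Sum>J\<in>Pow (- {l}). \<Sum>k\<in>I. - (super_sign I J (- I) (- {l} - J) * (shuffle_sign {k} (I - {k})
        * (?b (- I) (- {l} - J) * t k (I - {k}) J))))"
      unfolding current_wedge_def current_d_def distr_deriv_def dT
      by (simp add: sum_distrib_left Compl_eq_Diff_UNIV[symmetric] del: Pow_Compl)
    also have "\<dots> = (\<Sum>I\<in>UNIV. \<Sum>k\<in>I. - F I k)"
      unfolding F_def sum_negf[symmetric] by (intro sum.cong refl sum.swap)
    finally show ?thesis by (simp add: sum_negf)
  qed
  \<comment> \<open>After removing \<open>k\<close>, the set \<open>I\<close> is the index set of
    the coefficient of \<open>T\<close> that is differentiated, as in the expansion of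
    \<open>S\<close>.\<close>
  also have "(\<Sum>I\<in>UNIV. \<Sum>k\<in>I. F I k) = (\<Sum>k\<in>UNIV. \<Sum>I\<in>{I. k \<notin> I}. F (insert k I) k)"
  proof -
    have "(\<Sum>I\<in>UNIV. \<Sum>k\<in>I. F I k) = (\<Sum>I\<in>UNIV. \<Sum>k\<in>{k \<in> UNIV. k \<in> I}. F I k)" by simp
    also have "\<dots> = (\<Sum>k\<in>UNIV. \<Sum>I\<in>{I \<in> UNIV. k \<in> I}. F I k)" by (rule sum.swap_restrict) auto
    also have "\<dots> = (\<Sum>k\<in>UNIV. \<Sum>I\<in>{I. k \<notin> I}. F (insert k I) k)"
    proof (rule sum.cong[OF refl])
      fix k
      show "(\<Sum>I\<in>{I \<in> UNIV. k \<in> I}. F I k) = (\<Sum>I\<in>{I. k \<notin> I}. F (insert k I) k)"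
        by (rule sum.reindex_bij_witness[of _ "insert k" "\<lambda>I. I - {k}"]) (auto simp: insert_absorb)
    qed
    finally show ?thesis .
  qed
  also have "\<dots> = (\<Sum>k\<in>UNIV. ?e * shuffle_sign (- {l}) {l} * S k l (partial_deriv k f))"
  proof (intro sum.cong refl)
    fix k
    have ee: "?e * ?e = 1" by (simp flip: power_mult_distrib)
    let ?s = "shuffle_sign (- {l}) {l}"
    have "?e * ?s * S k l (partial_deriv k f) = (\<Sum>I\<in>UNIV. \<Sum>J\<in>UNIV. ?s * super_sign I J (- I) (- J)
        * basis_form (m - 1) k l (- I) (- J) 0 * t k I J)"
    proof -
      have "?e * ?s * (top_sign I J * b * tt) = ?s * super_sign I J (- I) (- J) * b * tt"
        for I J :: "'n set" and b tt :: real
      proof -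
        have "?e * ?s * (top_sign I J * b * tt) = (?e * ?e) * (?s * super_sign I J (- I) (- J) * b * tt)"
          unfolding top_sign_def by (simp only: mult_ac)
        then show ?thesis unfolding ee by simp
      qed
      then show ?thesis unfolding S_eq[OF df] t_def sum_distrib_left by (intro sum.cong refl)
    qed
    also have "\<dots> = (\<Sum>I\<in>{I. k \<notin> I}. \<Sum>J\<in>UNIV. ?s * super_sign I J (- I) (- J)
        * basis_form (m - 1) k l (- I) (- J) 0 * t k I J)"
      by (rule sum.mono_neutral_right) (auto simp: basis_form_def wedge_basis_right)
    also have "\<dots> = (\<Sum>I\<in>{I. k \<notin> I}. \<Sum>J\<in>Pow (- {l}). ?s * super_sign I J (- I) (- J)
        * basis_form (m - 1) k l (- I) (- J) 0 * t k I J)"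
      by (intro sum.cong refl sum.mono_neutral_right) (auto simp: basis_form_def wedge_basis_right)
    also have "\<dots> = (\<Sum>I\<in>{I. k \<notin> I}. F (insert k I) k)"
      unfolding F_def
    proof (intro sum.cong refl)
      fix I J assume "I \<in> {I. k \<notin> I}" "J \<in> Pow (- {l})"
      then have kl: "k \<notin> I" "l \<notin> J" by auto
      show "?s * super_sign I J (- I) (- J) * basis_form (m - 1) k l (- I) (- J) 0 * t k I J
        = super_sign (insert k I) J (- insert k I) (- {l} - J) * (shuffle_sign {k} (insert k I - {k})
          * (?b (- insert k I) (- {l} - J) * t k (insert k I - {k}) J))"
      proof (cases "t k I J = 0")
        case True
        then show ?thesis using kl by simp
      next
        case False
        then have "card I = card J" using degree[OF df] unfolding t_def by (metis add_right_cancel)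
        then have sgn: "super_sign (insert k I) J (- insert k I) (- insert l J) * shuffle_sign {k} I
          = ?s * (super_sign I J (- I) (- J) * super_sign (- insert k I) (- insert l J) {k} {l})"
          using exterior_sign[OF kl] by blast
        have sets: "- I - {k} = - insert k I" "- J - {l} = - insert l J" "- {l} - J = - insert l J"
          "insert k I - {k} = I" using kl by auto
        have "basis_form (m - 1) k l (- I) (- J) 0
          = super_sign (- insert k I) (- insert l J) {k} {l} * ?b (- insert k I) (- insert l J)"
          unfolding basis_form_def wedge_basis_right sets using kl by simp
        then have "?s * super_sign I J (- I) (- J) * basis_form (m - 1) k l (- I) (- J) 0 * t k I J
          = (?s * (super_sign I J (- I) (- J) * super_sign (- insert k I) (- insert l J) {k} {l}))
            * (?b (- insert k I) (- insert l J) * t k I J)" by simp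
        then show ?thesis unfolding sgn[symmetric] sets by simp
      qed
    qed
    finally show "(\<Sum>I\<in>{I. k \<notin> I}. F (insert k I) k) = ?e * ?s * S k l (partial_deriv k f)" by simp
  qed
  also have "\<dots> = ?e * shuffle_sign (- {l}) {l} * (\<Sum>k\<in>UNIV. S k l (partial_deriv k f))"
    by (simp add: sum_distrib_left)
  finally show ?thesis .
qed

text \<open>The bidegree is \<open>(n - m + 1) + (m - 1) = n\<close> and
  \<open>(n - m) + (m - 1) = n - 1\<close>, so every other component vanishes by counting.\<close>

lemma exterior_derivative_degree:
  assumes f: "f \<in> test" and IJ: "\<not> (I = UNIV \<and> (\<exists>l. J = - {l}))"
  shows "current_wedge (current_d T) (beta_pow (m - 1)) I J f = 0"
  unfolding current_wedge_def
proof (intro sum.neutral ballI)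
  fix I' J' assume IJ': "I' \<in> Pow I" "J' \<in> Pow J"
  let ?b = "beta_pow (m - 1) (I - I') (J - J') 0"
  have const: "(\<lambda>x. beta_pow (m - 1) (I - I') (J - J') x * f x) = (\<lambda>x. ?b * f x)"
    by (rule ext, subst beta_pow_const[of _ _ _ _ 0], rule refl)
  have "current_d T I' J' (\<lambda>x. ?b * f x) = 0"
  proof (cases "?b = 0")
    case True
    have "partial_deriv k (\<lambda>x. 0) = (\<lambda>x. 0)" for k :: 'n by (rule partial_deriv_const)
    then show ?thesis unfolding current_d_def distr_deriv_def True by (simp add: T_zero)
  next
    case False
    then have cb: "card (I - I') = m - 1" "card (J - J') = m - 1" using beta_pow_degree by blast+
    show ?thesis unfolding current_d_def distr_deriv_def
    proof (intro sum.neutral ballI)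
      fix k assume k: "k \<in> I'"
      have "T (I' - {k}) J' (partial_deriv k (\<lambda>x. ?b * f x)) = 0"
      proof (rule degree[OF test_partial_deriv[OF test_cmult[OF f]]], rule notI)
        assume d: "card (I' - {k}) + m = CARD('n) \<and> card J' + m = CARD('n)"
        have "card I' = Suc (card (I' - {k}))" by (rule card_Suc_Diff1[symmetric]) (use k in auto)
        moreover have "card I = card I' + card (I - I')" "card J = card J' + card (J - J')"
          using IJ' by (simp_all add: card_Diff_subset card_mono)
        ultimately have c: "card I = CARD('n)" "Suc (card J) = CARD('n)" using d cb m_pos by linarith+
        then have "I = UNIV" by (simp add: card_eq_UNIV_imp_eq_UNIV)
        moreover have "card (- J) = 1"
          using c(2) by (simp add: Compl_eq_Diff_UNIV card_Diff_subset)
        then obtain l where "- J = {l}" using card_1_singletonE by blast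
        then have "J = - {l}" by blast
        ultimately show False using IJ by blast
      qed
      then show "shuffle_sign {k} (I' - {k}) * - T (I' - {k}) J' (partial_deriv k (\<lambda>x. ?b * f x)) = 0" by simp
    qed
  qed
  then show "super_sign I' J' (I - I') (J - J') * current_d T I' J'
      (\<lambda>x. beta_pow (m - 1) (I - I') (J - J') x * f x) = 0"
    unfolding const by simp
qed

end

section \<open>Coefficient measures\<close>

lemma radon_measurable:
  assumes "radon_on U \<mu>" "smooth f"
  shows "f \<in> borel_measurable \<mu>"
proof -
  have "f \<in> borel_measurable borel"
    by (intro borel_measurable_continuous_onI smooth_continuous_on assms(2))
  moreover have "sets \<mu> = sets borel" using assms(1) unfolding radon_on_def by simp
  ultimately show ?thesis using measurable_cong_sets by blast
qed

lemma radon_indicator: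
  assumes "radon_on U \<mu>" "compact C" "C \<subseteq> U"
  shows "integrable \<mu> (\<lambda>x. B * indicator C x :: real)"
proof (rule integrable_mult_right)
  have "C \<in> sets \<mu>" using assms unfolding radon_on_def by (simp add: borel_compact)
  moreover have "emeasure \<mu> C < \<infinity>" using assms unfolding radon_on_def by simp
  ultimately show "integrable \<mu> (indicator C :: _ \<Rightarrow> real)" by (simp add: integrable_real_indicator)
qed

lemma abs_le_indicator:
  assumes "supp f \<subseteq> C" "\<And>x. \<bar>f x\<bar> \<le> B"
  shows "\<bar>f x\<bar> \<le> B * indicator C x"
  using assms supp_zero[of x f] by (cases "x \<in> C") auto

lemma radon_integrable:
  assumes "radon_on U \<mu>" "f \<in> test_functions U"
  shows "integrable \<mu> f"
proof -
  note f = test_functionsD[OF assms(2)]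
  obtain B where B: "\<And>x. \<bar>f x\<bar> \<le> B" by (rule test_bounded[OF assms(2)], rule that)
  show ?thesis
  proof (rule Bochner_Integration.integrable_bound[OF radon_indicator[OF assms(1) f(2,3), of B] radon_measurable[OF assms(1) f(1)]])
    show "AE x in \<mu>. norm (f x) \<le> norm (B * indicator (supp f) x)"
    proof (intro AE_I2)
      fix x
      have "\<bar>f x\<bar> \<le> B * indicator (supp f) x" by (rule abs_le_indicator[OF order_refl B])
      then show "norm (f x) \<le> norm (B * indicator (supp f) x)" by simp
    qed
  qed
qed

lemma radon_integral_bound:
  assumes \<mu>: "radon_on U \<mu>" and f: "f \<in> test_functions U" and C: "compact C" "C \<subseteq> U" "supp f \<subseteq> C"
    and B: "\<And>x. \<bar>f x\<bar> \<le> B"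
  shows "\<bar>integral\<^sup>L \<mu> f\<bar> \<le> measure \<mu> C * B"
proof -
  have "\<bar>integral\<^sup>L \<mu> f\<bar> \<le> integral\<^sup>L \<mu> (\<lambda>x. \<bar>f x\<bar>)" by (rule integral_abs_bound)
  also have "\<dots> \<le> integral\<^sup>L \<mu> (\<lambda>x. B * indicator C x)"
    using abs_le_indicator[OF C(3) B]
    by (intro integral_mono integrable_abs radon_integrable[OF \<mu> f] radon_indicator[OF \<mu> C(1,2)])
  also have "\<dots> = measure \<mu> C * B"
  proof -
    have "C \<in> sets \<mu>" using \<mu> C(1) unfolding radon_on_def by (simp add: borel_compact)
    then have "C \<inter> space \<mu> = C" using sets.sets_into_space by blast
    then show ?thesis by simp
  qed
  finally show ?thesis .
qed

text \<open>Dominated convergence under \<open>B * indicator C\<close>; exceptions in the null set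
  \<open>N\<close> are harmless, and outside \<open>U\<close> all functions vanish.\<close>

lemma radon_integral_convergence:
  fixes F :: "nat \<Rightarrow> real ^ 'n::finite \<Rightarrow> real"
  assumes \<mu>: "radon_on U \<mu>" and F: "\<And>j. F j \<in> test_functions U" and f: "f \<in> test_functions U"
    and C: "compact C" "C \<subseteq> U" "\<And>j. supp (F j) \<subseteq> C" and B: "\<And>j x. \<bar>F j x\<bar> \<le> B"
    and N: "N \<in> sets borel" "emeasure \<mu> N = 0" and lim: "\<And>x. x \<in> U - N \<Longrightarrow> (\<lambda>j. F j x) \<longlonglongrightarrow> f x"
  shows "(\<lambda>j. integral\<^sup>L \<mu> (F j)) \<longlonglongrightarrow> integral\<^sup>L \<mu> f"
proof (rule integral_dominated_convergence[OF radon_measurable[OF \<mu>] radon_measurable[OF \<mu>] radon_indicator[OF \<mu> C(1,2), of B]])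
  have "AE x in \<mu>. x \<notin> N"
    using \<mu> N by (intro AE_not_in) (auto simp: null_sets_def radon_on_def)
  then show "AE x in \<mu>. (\<lambda>j. F j x) \<longlonglongrightarrow> f x"
  proof eventually_elim
    case (elim x)
    show ?case
    proof (cases "x \<in> U")
      case True
      then show ?thesis using lim elim by simp
    next
      case False
      then have "f x = 0" "F j x = 0" for j
        using supp_zero[of x f] supp_zero[of x "F j"] test_functionsD(3)[OF f] test_functionsD(3)[OF F] by blast+
      then show ?thesis by simp
    qed
  qed
  show "AE x in \<mu>. norm (F j x) \<le> B * indicator C x" for j
    using abs_le_indicator[OF C(3) B] by (intro AE_I2) simp
qed (use F f test_functionsD(1) in auto)

lemma signed_measure_linear:
  assumes "is_signed_measure_on U L \<mu> \<nu>"
  shows "f \<in> test_functions U \<Longrightarrow> g \<in> test_functions U \<Longrightarrow> L (\<lambda>x. f x + g x) = L f + L g"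
    and "f \<in> test_functions U \<Longrightarrow> L (\<lambda>x. a * f x) = a * L f"
proof -
  have r: "radon_on U \<mu>" "radon_on U \<nu>"
    and L: "\<And>f. f \<in> test_functions U \<Longrightarrow> L f = integral\<^sup>L \<mu> f - integral\<^sup>L \<nu> f"
    using assms unfolding is_signed_measure_on_def by auto
  show "L (\<lambda>x. f x + g x) = L f + L g" if "f \<in> test_functions U" "g \<in> test_functions U"
    using that radon_integrable[OF r(1)] radon_integrable[OF r(2)] by (simp add: L test_add)
  show "L (\<lambda>x. a * f x) = a * L f" if "f \<in> test_functions U"
    using that by (simp add: L test_cmult right_diff_distrib)
qed

lemma signed_measure_bounded:
  assumes L: "is_signed_measure_on U L \<mu> \<nu>" and C: "compact C" "C \<subseteq> U"
  shows "\<exists>M. \<forall>f B. f \<in> test_functions U \<longrightarrow> supp f \<subseteq> C \<longrightarrow> (\<forall>x. \<bar>f x\<bar> \<le> B) \<longrightarrow> \<bar>L f\<bar> \<le> M * B"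
proof (intro exI[of _ "measure \<mu> C + measure \<nu> C"] allI impI)
  fix f B assume f: "f \<in> test_functions U" "supp f \<subseteq> C" "\<forall>x. \<bar>f x\<bar> \<le> B"
  have "\<bar>integral\<^sup>L \<mu> f\<bar> \<le> measure \<mu> C * B" "\<bar>integral\<^sup>L \<nu> f\<bar> \<le> measure \<nu> C * B"
    using L C f unfolding is_signed_measure_on_def by (auto intro!: radon_integral_bound)
  moreover have "L f = integral\<^sup>L \<mu> f - integral\<^sup>L \<nu> f"
    using L f(1) unfolding is_signed_measure_on_def by simp
  ultimately show "\<bar>L f\<bar> \<le> (measure \<mu> C + measure \<nu> C) * B"
    by (simp add: distrib_right)
qed

lemma signed_measure_convergence:
  fixes F :: "nat \<Rightarrow> real ^ 'n::finite \<Rightarrow> real"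
  assumes L: "is_signed_measure_on U L \<mu> \<nu>" and N: "N \<in> sets borel" "emeasure \<mu> N = 0" "emeasure \<nu> N = 0"
    and F: "\<And>j. F j \<in> test_functions U" and f: "f \<in> test_functions U"
    and C: "compact C" "C \<subseteq> U" "\<And>j. supp (F j) \<subseteq> C" and B: "\<And>j x. \<bar>F j x\<bar> \<le> B"
    and lim: "\<And>x. x \<in> U - N \<Longrightarrow> (\<lambda>j. F j x) \<longlonglongrightarrow> f x"
  shows "(\<lambda>j. L (F j)) \<longlonglongrightarrow> L f"
proof -
  have r: "radon_on U \<mu>" "radon_on U \<nu>"
    and L: "\<And>f. f \<in> test_functions U \<Longrightarrow> L f = integral\<^sup>L \<mu> f - integral\<^sup>L \<nu> f"
    using L unfolding is_signed_measure_on_def by auto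
  show ?thesis
    unfolding L[OF f] L[OF F]
    by (intro tendsto_diff radon_integral_convergence[OF r(1) F f C B N(1,2) lim]
        radon_integral_convergence[OF r(2) F f C B N(1,3) lim])
qed

lemma signed_measure_distribution:
  assumes L: "is_signed_measure_on U L \<mu> \<nu>"
  shows "distribution U L"
  unfolding distribution_def
proof (intro conjI ballI allI impI)
  fix f :: "nat \<Rightarrow> real ^ 'a \<Rightarrow> real" assume f: "test_null_sequence U f"
  then obtain C where C: "compact C" "C \<subseteq> U" "\<And>j. supp (f j) \<subseteq> C"
    unfolding test_null_sequence_def by blast
  have ft: "f j \<in> test_functions U" for j using f unfolding test_null_sequence_def by blast
  \<comment> \<open>Only uniform convergence of the functions themselves enters, the list of
    derivatives being empty: signed measures have order zero.\<close>
  have "uniform_limit UNIV (\<lambda>j. fold partial_deriv [] (f j)) (\<lambda>_. 0) sequentially"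
    using f unfolding test_null_sequence_def by blast
  then have unif: "uniform_limit UNIV f (\<lambda>_. 0) sequentially" by simp
  obtain M where M: "\<forall>g B. g \<in> test_functions U \<longrightarrow> supp g \<subseteq> C \<longrightarrow> (\<forall>x. \<bar>g x\<bar> \<le> B) \<longrightarrow> \<bar>L g\<bar> \<le> M * B"
    using signed_measure_bounded[OF L C(1,2)] by (rule exE)
  show "(\<lambda>j. L (f j)) \<longlonglongrightarrow> 0"
  proof (rule tendstoI)
    fix e :: real assume e: "0 < e"
    define d where "d = e / (2 * (\<bar>M\<bar> + 1))"
    have d: "0 < d" using e by (simp add: d_def)
    have "\<forall>\<^sub>F j in sequentially. \<forall>x\<in>UNIV. dist (f j x) 0 < d"
      using uniform_limitD[OF unif d] .
    then show "\<forall>\<^sub>F j in sequentially. dist (L (f j)) 0 < e"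
    proof eventually_elim
      case (elim j)
      then have "\<forall>x. \<bar>f j x\<bar> \<le> d" by (auto simp: less_imp_le)
      then have "\<bar>L (f j)\<bar> \<le> M * d" using M ft C(3) by blast
      also have "\<dots> \<le> (\<bar>M\<bar> + 1) * d" using d by (intro mult_right_mono) auto
      also have "\<dots> = e / 2" unfolding d_def by (simp add: field_simps)
      also have "\<dots> < e" using e by simp
      finally show ?case by simp
    qed
  qed
qed (use signed_measure_linear[OF L] in auto)

section \<open>The extension theorem\<close>

text \<open>Symmetry, degree and positivity pass from \<open>T\<close> to \<open>T'\<close> by
  testing with powers of \<open>w j\<close> and letting \<open>j\<close> tend to infinity. The
  closedness condition does not pass this way, since derivatives fall on \<open>w j\<close>; it is
  rewritten as vanishing divergence of \<open>S\<close>, and \<open>removable\<close> takes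
  over.\<close>

theorem theorem7p2:
  fixes c :: "real ^ 'n::{finite,linorder}" and r :: real
    and K :: "(real ^ 'n::{finite,linorder}) set"
    and m :: nat
    and T T' :: "'n supercurrent"
  assumes "2 \<le> m"
    and "0 < r"
    and "compact K"
    and "sigma_finite_hausdorff (m - 2) K"
    and "minimal_current (ball c r - K) m T"
    and "finite_mass (ball c r - K) m T"
    and "trivial_extension (ball c r - K) (ball c r) T T'"
  shows "minimal_current (ball c r) m T'"
proof -
  let ?V = "ball c r" and ?U = "ball c r - K"
  let ?test = "test_functions ?V"
  have UV: "f \<in> test_functions ?U \<Longrightarrow> f \<in> ?test" for f by (rule test_mono) auto
  \<comment> \<open>The part of \<open>K\<close> inside the ball, a null set for the measures that
    represent the coefficients of \<open>T'\<close>.\<close>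
  define N where "N = ?V \<inter> K"
  have N: "N \<in> sets borel" "?V - ?U = N"
    using borel_compact[OF assms(3)] by (auto simp: N_def)
  have ext: "\<exists>\<mu> \<nu>. is_signed_measure_on ?U (T I J) \<mu> \<nu> \<and> is_signed_measure_on ?V (T' I J) \<mu> \<nu> \<and>
      emeasure \<mu> N = 0 \<and> emeasure \<nu> N = 0" for I J
    using assms(7) N(2) unfolding trivial_extension_def by auto
  have TT': "T I J f = T' I J f" if "f \<in> test_functions ?U" for I J f
    using ext[of I J] that UV[OF that] unfolding is_signed_measure_on_def by auto
  have distr: "distribution ?V (T' I J)" for I J
    using ext[of I J] signed_measure_distribution by blast
  have T'_scale: "T' I J (\<lambda>x. a * f x) = a * T' I J f" if "f \<in> ?test" for I J a f
    using distr[of I J] that unfolding distribution_def by blast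
  have bounded: "\<exists>M. \<forall>f B. f \<in> ?test \<longrightarrow> supp f \<subseteq> C \<longrightarrow> (\<forall>x. \<bar>f x\<bar> \<le> B) \<longrightarrow> \<bar>T' I J f\<bar> \<le> M * B"
    if "compact C" "C \<subseteq> ?V" for C I J
    using ext[of I J] signed_measure_bounded[OF _ that] by blast
  have convergence: "(\<lambda>j. T' I J (F j)) \<longlonglongrightarrow> T' I J f"
    if F: "\<And>j. F j \<in> ?test" and f: "f \<in> ?test" and C: "compact C" "C \<subseteq> ?V" "\<And>j. supp (F j) \<subseteq> C"
      and B: "\<And>j x. \<bar>F j x\<bar> \<le> B" and lim: "\<And>x. x \<in> ?V - K \<Longrightarrow> (\<lambda>j. F j x) \<longlonglongrightarrow> f x"
    for F :: "nat \<Rightarrow> real ^ 'n::{finite,linorder} \<Rightarrow> real" and f C B I J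
  proof -
    obtain \<mu> \<nu> where "is_signed_measure_on ?V (T' I J) \<mu> \<nu>" "emeasure \<mu> N = 0" "emeasure \<nu> N = 0"
      using ext by blast
    then show ?thesis
      by (rule signed_measure_convergence[OF _ N(1) _ _ F f C B]) (use lim in \<open>auto simp: N_def\<close>)
  qed
  obtain w where ws: "\<And>j::nat. smooth (w j)" and w01: "\<And>j y. y \<in> ?V \<Longrightarrow> 0 \<le> w j y \<and> w j y \<le> 1"
    and wU: "\<And>j f. f \<in> ?test \<Longrightarrow> (\<lambda>y. w j y * f y) \<in> test_functions ?U"
    and wlim: "\<And>y. y \<notin> K \<Longrightarrow> (\<lambda>j. w j y) \<longlonglongrightarrow> 1"
    by (rule cutoff_sequence[OF assms(1,3,4), of c r], rule that)
  \<comment> \<open>Powers occur because each of the \<open>2 m\<close> factors of degree 1 in the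
    positivity test receives a factor \<open>w j\<close>.\<close>
  have wpow_lim: "(\<lambda>j. T' I J (\<lambda>x. w j x ^ p * f x)) \<longlonglongrightarrow> T' I J f" if f: "f \<in> ?test" for I J f p
  proof -
    obtain B where B: "\<And>x. \<bar>f x\<bar> \<le> B" by (rule test_bounded[OF f], rule that)
    show ?thesis
    proof (rule convergence[OF test_mult(2)[OF f smooth_power[OF ws]] f test_functionsD(2,3)[OF f]])
      show "supp (\<lambda>x. w j x ^ p * f x) \<subseteq> supp f" for j by (rule supp_subset) auto
      show "\<bar>w j x ^ p * f x\<bar> \<le> B" for j x
      proof (cases "x \<in> ?V")
        case True
        then have "\<bar>w j x ^ p\<bar> \<le> 1" using w01[OF True, of j] by (simp add: power_le_one)
        then have "\<bar>w j x ^ p * f x\<bar> \<le> 1 * B"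
          unfolding abs_mult using B[of x] by (intro mult_mono) auto
        then show ?thesis by simp
      next
        case False
        then have "f x = 0" using test_functionsD(3)[OF f] supp_zero by blast
        then show ?thesis using B[of x] by simp
      qed
      show "(\<lambda>j. w j x ^ p * f x) \<longlonglongrightarrow> f x" if "x \<in> ?V - K" for x
      proof -
        have "(\<lambda>j. w j x ^ p * f x) \<longlonglongrightarrow> 1 ^ p * f x"
          by (intro tendsto_intros wlim) (use that in auto)
        then show ?thesis by simp
      qed
    qed
  qed
  have w_lim: "(\<lambda>j. T I J (\<lambda>x. w j x * f x)) \<longlonglongrightarrow> T' I J f" if f: "f \<in> ?test" for I J f
    using wpow_lim[OF f, of I J 1] TT'[OF wU[OF f]] by simp
  have T: "supercurrent ?U m m T" "positive_current ?U m T" "symmetric_current ?U T"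
    "\<And>I J f. f \<in> test_functions ?U \<Longrightarrow> current_wedge (current_d T) (beta_pow (m - 1)) I J f = 0"
    using assms(5) unfolding minimal_current_def by auto
  have degree: "T' I J f = 0" if f: "f \<in> ?test" and IJ: "\<not> (card I + m = CARD('n) \<and> card J + m = CARD('n))" for I J f
  proof -
    have "T I J (\<lambda>x. w j x * f x) = 0" for j
      using T(1) IJ wU[OF f, of j] unfolding supercurrent_def by blast
    then show ?thesis using w_lim[OF f, of I J] LIMSEQ_unique[OF _ tendsto_const] by fastforce
  qed
  have symm: "symmetric_current ?V T'"
    unfolding symmetric_current_def
  proof (intro allI ballI)
    fix I J :: "'n set" and f assume f: "f \<in> ?test"
    let ?s = "(- 1 :: real) ^ (card I + card J * card I)"
    have "?s * T J I (\<lambda>x. w j x * f x) = T I J (\<lambda>x. w j x * f x)" for j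
      using T(3) wU[OF f, of j] unfolding symmetric_current_def J_op_def by blast
    then have "(\<lambda>j. T I J (\<lambda>x. w j x * f x)) \<longlonglongrightarrow> ?s * T' J I f"
      using tendsto_mult[OF tendsto_const[of ?s] w_lim[OF f, of J I]] by simp
    then show "J_op T' I J f = T' I J f"
      using LIMSEQ_unique[OF _ w_lim[OF f, of I J]] by (simp add: J_op_def)
  qed
  have positive: "positive_current ?V m T'"
    unfolding positive_current_def
  proof (intro allI impI)
    fix as :: "'n superform list"
    assume as: "length as = m \<and> (\<forall>a\<in>set as. test_form ?V 1 0 a)"
    let ?W = "wedge_list (map (\<lambda>a. wedge a (J_op a)) as)"
    have Wt: "?W I J \<in> ?test" for I J
    proof -
      \<comment> \<open>Compact support comes from the first form of the list, which is nonempty as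
        \<open>m \<ge> 2\<close>; of the other factors only smoothness is used.\<close>
      obtain a as' where aas: "as = a # as'" using as assms(1) by (cases as) auto
      have sm: "smooth_form a \<and> smooth_form (J_op a)" if "a \<in> set as" for a
      proof -
        have "smooth (a I J)" for I J
          using as that unfolding test_form_def by (meson test_functionsD(1))
        then show ?thesis unfolding smooth_form_def J_op_def by (auto intro: smooth_mult smooth_const)
      qed
      have rest: "smooth_form (wedge_list (map (\<lambda>a. wedge a (J_op a)) as'))"
        by (intro smooth_form_wedge_list) (use sm aas in \<open>auto intro: smooth_form_wedge\<close>)
      have W: "?W = wedge a (wedge (J_op a) (wedge_list (map (\<lambda>a. wedge a (J_op a)) as')))"
        unfolding aas by (simp add: wedge_list_def wedge_assoc)
      have R: "smooth_form (wedge (J_op a) (wedge_list (map (\<lambda>a. wedge a (J_op a)) as')))"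
        using sm[of a] aas rest by (intro smooth_form_wedge) auto
      have at: "a I J \<in> ?test" for I J using as aas unfolding test_form_def by simp
      show ?thesis
        unfolding W unfolding wedge_def[of a]
        by (intro test_sum test_cmult test_mult(1)[OF at]) (use R in \<open>simp add: smooth_form_def\<close>)
    qed
    have "0 \<le> current_apply T' (\<lambda>I J x. w j x ^ (2 * m) * ?W I J x)" for j
    proof -
      let ?as = "map (\<lambda>a I J x. w j x * a I J x) as"
      have "test_form ?U 1 0 (\<lambda>I J x. w j x * a I J x)" if "a \<in> set as" for a
      proof -
        have a: "a I J \<in> ?test" "\<not> (card I = 1 \<and> card J = 0) \<Longrightarrow> a I J = (\<lambda>x. 0)" for I J
          using as that unfolding test_form_def by auto
        show ?thesis unfolding test_form_def using wU[OF a(1)] a(2) by simp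
      qed
      then have "length ?as = m \<and> (\<forall>a\<in>set ?as. test_form ?U 1 0 a)" using as by auto
      then have "0 \<le> current_apply T (wedge_list (map (\<lambda>a. wedge a (J_op a)) ?as))"
        using T(2)[unfolded positive_current_def, THEN spec, of ?as] by blast
      also have "map (\<lambda>a. wedge a (J_op a)) ?as
          = map (\<lambda>a I J x. (w j x)\<^sup>2 * a I J x) (map (\<lambda>a. wedge a (J_op a)) as)"
        by (simp add: square_J_scale)
      also have "wedge_list \<dots> = (\<lambda>I J x. w j x ^ (2 * m) * ?W I J x)"
        unfolding wedge_list_scale using as by (simp flip: power_mult)
      \<comment> \<open>The coefficients of this form are supported off \<open>K\<close>, where
        \<open>T\<close> and \<open>T'\<close> agree.\<close>
      also have "current_apply T \<dots> = current_apply T' \<dots>"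
      proof -
        have "(\<lambda>x. w j x ^ (2 * m) * ?W I J x) \<in> test_functions ?U" for I J
        proof -
          have "(\<lambda>x. w j x * (w j x ^ (2 * m - 1) * ?W I J x)) \<in> test_functions ?U"
            by (intro wU test_mult(2)[OF Wt] smooth_power ws)
          moreover have "w j x ^ (2 * m) = w j x * w j x ^ (2 * m - 1)" for x
            using assms(1) by (simp flip: power_Suc)
          ultimately show ?thesis by (simp add: mult.assoc)
        qed
        then show ?thesis unfolding current_apply_eq by (simp add: TT')
      qed
      finally show ?thesis .
    qed
    moreover have "(\<lambda>j. current_apply T' (\<lambda>I J x. w j x ^ (2 * m) * ?W I J x)) \<longlonglongrightarrow> current_apply T' ?W"
      unfolding current_apply_eq by (intro tendsto_intros wpow_lim Wt)
    ultimately show "0 \<le> current_apply T' ?W"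
      by (intro LIMSEQ_le_const[where a = 0]) auto
  qed
  interpret positive_supercurrent c r m T'
    by unfold_locales (use assms(1) distr degree positive symm in auto)
  \<comment> \<open>Off \<open>K\<close> both currents agree, so the minimality of \<open>T\<close>,
    read through \<open>exterior_derivative\<close> for \<open>T'\<close>, gives the divergence
    equation there.\<close>
  have div: "(\<Sum>k\<in>UNIV. S k l (partial_deriv k f)) = 0" if f: "f \<in> test_functions ?U" for f l
  proof -
    have "current_wedge (current_d T') (beta_pow (m - 1)) UNIV (- {l}) f
        = current_wedge (current_d T) (beta_pow (m - 1)) UNIV (- {l}) f"
    proof -
      have "T' I J (partial_deriv k (\<lambda>x. beta_pow (m - 1) P Q x * f x))
          = T I J (partial_deriv k (\<lambda>x. beta_pow (m - 1) P Q x * f x))" for I J P Q k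
      proof -
        have "(\<lambda>x. beta_pow (m - 1) P Q x * f x) = (\<lambda>x. beta_pow (m - 1) P Q 0 * f x)"
        proof
          fix x
          have "beta_pow (m - 1) P Q x = beta_pow (m - 1) P Q 0" by (rule beta_pow_const)
          then show "beta_pow (m - 1) P Q x * f x = beta_pow (m - 1) P Q 0 * f x" by simp
        qed
        then show ?thesis using TT'[OF test_partial_deriv[OF test_cmult[OF f]]] by simp
      qed
      then show ?thesis unfolding current_wedge_def current_d_def distr_deriv_def by simp
    qed
    also have "\<dots> = 0" by (rule T(4)[OF f])
    finally have "(- 1 :: real) ^ (CARD('n) * (CARD('n) - 1) div 2) * shuffle_sign (- {l}) {l}
        * (\<Sum>k\<in>UNIV. S k l (partial_deriv k f)) = 0"
      using exterior_derivative[OF UV[OF f], of l] by simp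
    then show ?thesis by (simp add: shuffle_sign_def)
  qed
  have S_bounded: "\<exists>M. \<forall>f B. f \<in> ?test \<longrightarrow> supp f \<subseteq> C \<longrightarrow> (\<forall>x. \<bar>f x\<bar> \<le> B) \<longrightarrow> \<bar>S k l f\<bar> \<le> M * B"
    if C: "compact C" "C \<subseteq> ?V" for C k l
  proof -
    obtain M where M: "\<And>I J f B. f \<in> ?test \<Longrightarrow> supp f \<subseteq> C \<Longrightarrow> (\<forall>x. \<bar>f x\<bar> \<le> B) \<Longrightarrow> \<bar>T' I J f\<bar> \<le> M I J * B"
      using bounded[OF C] by metis
    let ?c = "\<lambda>I J. \<bar>top_sign I J * basis_form (m - 1) k l (- I) (- J) 0\<bar>"
    show ?thesis
    proof (intro exI[of _ "\<Sum>I\<in>UNIV. \<Sum>J\<in>UNIV. ?c I J * M I J"] allI impI)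
      fix f B assume f: "f \<in> ?test" "supp f \<subseteq> C" "\<forall>x. \<bar>f x\<bar> \<le> B"
      have "\<bar>S k l f\<bar> \<le> (\<Sum>I\<in>UNIV. \<bar>\<Sum>J\<in>UNIV. top_sign I J * basis_form (m - 1) k l (- I) (- J) 0 * T' I J f\<bar>)"
        unfolding S_eq[OF f(1)] by (rule sum_abs)
      also have "\<dots> \<le> (\<Sum>I\<in>UNIV. \<Sum>J\<in>UNIV. ?c I J * (M I J * B))"
        by (intro sum_mono order_trans[OF sum_abs])
          (auto simp: abs_mult intro!: mult_left_mono M[OF f])
      also have "\<dots> = (\<Sum>I\<in>UNIV. \<Sum>J\<in>UNIV. ?c I J * M I J) * B"
        by (simp add: sum_distrib_right mult.assoc)
      finally show "\<bar>S k l f\<bar> \<le> (\<Sum>I\<in>UNIV. \<Sum>J\<in>UNIV. ?c I J * M I J) * B" .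
    qed
  qed
  interpret matrix: stationary_matrix c r K m S
  proof
    show "2 \<le> m" "compact K" "sigma_finite_hausdorff (m - 2) K" by (fact assms)+
  next
    fix f g k l assume "f \<in> ?test" "g \<in> ?test"
    then show "S k l (\<lambda>x. f x + g x) = S k l f + S k l g"
      by (simp add: S_eq test_add T_add distrib_left sum.distrib)
  next
    fix f k l a assume "f \<in> ?test"
    then show "S k l (\<lambda>x. a * f x) = a * S k l f"
      by (simp add: S_eq test_cmult T_scale sum_distrib_left mult.left_commute)
  next
    fix f k l assume "f \<in> ?test"
    then show "S k l f = S l k f" by (rule S_symmetric)
  next
    fix f and v :: "'n \<Rightarrow> real ^ 'n::{finite,linorder} \<Rightarrow> real" assume "f \<in> ?test" "\<And>x. 0 \<le> f x" "\<And>k. smooth (v k)"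
    then show "0 \<le> (\<Sum>k\<in>UNIV. \<Sum>l\<in>UNIV. S k l (\<lambda>x. f x * (v k x * v l x)))" by (rule S_pos)
  next
    fix f y and \<eta> :: real assume "f \<in> ?test" "\<And>x. 0 \<le> f x" "0 < \<eta>"
    then show "0 \<le> (\<Sum>k\<in>UNIV. \<Sum>l\<in>UNIV. S k l (\<lambda>x. f x * ((sqdist y x + \<eta>) * (if k = l then 1 else 0)
        - real m * ((x $ k - y $ k) * (x $ l - y $ l)))))" by (rule S_hessian_pos)
  next
    fix f l assume "f \<in> test_functions ?U"
    then show "(\<Sum>k\<in>UNIV. S k l (partial_deriv k f)) = 0" by (rule div)
  next
    fix C k l assume "compact C" "C \<subseteq> ?V"
    then show "\<exists>M. \<forall>f B. f \<in> ?test \<longrightarrow> supp f \<subseteq> C \<longrightarrow> (\<forall>x. \<bar>f x\<bar> \<le> B) \<longrightarrow> \<bar>S k l f\<bar> \<le> M * B"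
      by (rule S_bounded)
  next
    fix F :: "nat \<Rightarrow> real ^ 'n::{finite,linorder} \<Rightarrow> real" and f C B k l
    assume F: "\<And>j. F j \<in> ?test" and f: "f \<in> ?test" and C: "compact C" "C \<subseteq> ?V" "\<And>j. supp (F j) \<subseteq> C"
      and B: "\<And>j x. \<bar>F j x\<bar> \<le> B" and lim: "\<And>x. x \<in> ?V - K \<Longrightarrow> (\<lambda>j. F j x) \<longlonglongrightarrow> f x"
    \<comment> \<open>Pointwise convergence off \<open>K\<close> is enough because \<open>K\<close>
      is negligible for the coefficients of \<open>T'\<close>, of which \<open>S\<close> is a finite
      combination.\<close>
    show "(\<lambda>j. S k l (F j)) \<longlonglongrightarrow> S k l f"
      unfolding S_eq[OF F] S_eq[OF f] by (intro tendsto_intros convergence[OF F f C B lim])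
  qed
  have closed: "current_wedge (current_d T') (beta_pow (m - 1)) I J f = 0" if f: "f \<in> ?test" for I J f
  proof (cases "I = UNIV \<and> (\<exists>l. J = - {l})")
    case True
    then obtain l where "I = UNIV" "J = - {l}" by blast
    then show ?thesis using exterior_derivative[OF f, of l] matrix.removable[OF f, of l] by simp
  next
    case False
    then show ?thesis by (rule exterior_derivative_degree[OF f])
  qed
  show ?thesis
    unfolding minimal_current_def supercurrent_def using distr degree positive symm closed by blast
qed

end
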